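(* Let $\Gamma$ be a countable group with an infinite normal subgroup $\Gamma_0$ such that the inclusion $\Gamma_0\subset\Gamma$ has relative property (T) and $\Gamma/\Gamma_0$ is finitely generated. Let $\Gamma\curvearrowright^{\alpha}(X,\mu)$ be a free ergodic measure preserving profinite action on a standard probability space such that the restriction of $\alpha$ to $\Gamma_0$ is also ergodic. Suppose that $\alpha$ is the limit of the actions $\Gamma\curvearrowright^{\alpha_n}X_n$, with $X_n$ finite, and for every $n$ let $r_n:X\rightarrow X_n$ be the quotient map. Let $\Lambda$ be a countable group and let $w:\Gamma\times X\rightarrow\Lambda$ be a measurable cocycle for $\alpha$. Then there exists $n$ such that $w$ is cohomologous to a cocycle $w':\Gamma\times X\rightarrow\Lambda$ of the form $w'=w''\circ(\mathrm{id}\times r_n)$, for some cocycle $w'':\Gamma\times X_n\rightarrow\Lambda$.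
   Context: A standard probability space is one isomorphic to the unit interval with Lebesgue measure. Relative property (T): an inclusion of countable groups $\Gamma_0\subset\Gamma$ has relative property (T) if every unitary representation of $\Gamma$ which weakly contains the trivial representation of $\Gamma$ contains the trivial representation of $\Gamma_0$ (i.e. has a non-zero $\Gamma_0$-invariant vector). Profinite actions: a measure preserving action $\Gamma\curvearrowright(X,\mu)$ is profinite if it is the inverse limit of a sequence of measure preserving actions $\Gamma\curvearrowright(X_n,\mu_n)$ on finite probability spaces. Here one is given measure preserving, onto, $\Gamma$-equivariant maps $q_n:X_{n+1}\to X_n$; $X=\{(x_n)_n : x_n\in X_n,\ q_n(x_{n+1})=x_n\ \forall n\}$; $\mu$ is the unique probability measure making all coordinate maps $r_n:X\to X_n$ measure preserving; and $\gamma(x_n)_n=(\gamma x_n)_n$. An action is free if $\mu(\{x:\gamma x=x\})=0$ for all $\gamma\neq e$. A cocycle for a measure preserving action $\Gamma\curvearrowright X$ with values in a countable group $\Lambda$ is a measurable map $w:\Gamma\times X\to\Lambda$ with $w(\gamma_1\gamma_2,x)=w(\gamma_1,\gamma_2x)w(\gamma_2,x)$ for all $\gamma_1,\gamma_2\in\Gamma$ and a.e. $x\in X$. Two cocycles $w,w'$ are cohomologous if there is a measurable map $\phi:X\to\Lambda$ with $w'(\gamma,x)=\phi(\gamma x)w(\gamma,x)\phi(x)^{-1}$ for all $\gamma\in\Gamma$ and a.e. $x\in X$. *)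

theory Defs
  imports "HOL-Probability.Probability_Measure" "HOL-Algebra.Group_Action" "HOL-Algebra.Generated_Groups" "HOL-Algebra.Module"
begin

section \<open>Unitary representations and relative property (T)\<close>

definition complex_ring :: "complex ring" where
  "complex_ring = \<lparr>carrier = UNIV, mult = (*), one = 1, zero = 0, add = (+)\<rparr>"

text \<open>Only the additive structure, the scalar multiplication and the inner product of such a
  record are meaningful; the ring multiplication and unit inherited from \<open>module\<close> are ignored.\<close>

record 'v inner_module = "(complex, 'v) module" +
  iprod :: "'v \<Rightarrow> 'v \<Rightarrow> complex"

locale complex_hilbert_space =
  Module.module complex_ring H for H :: "('v, 'm) inner_module_scheme" (structure) +
  assumes iprod_add: "\<lbrakk>x \<in> carrier H; y \<in> carrier H; z \<in> carrier H\<rbrakk> \<Longrightarrow>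
      iprod H (x \<oplus>\<^bsub>H\<^esub> y) z = iprod H x z + iprod H y z"
    and iprod_smult: "\<lbrakk>x \<in> carrier H; y \<in> carrier H\<rbrakk> \<Longrightarrow>
      iprod H (c \<odot>\<^bsub>H\<^esub> x) y = c * iprod H x y"
    and iprod_commute: "\<lbrakk>x \<in> carrier H; y \<in> carrier H\<rbrakk> \<Longrightarrow>
      iprod H x y = cnj (iprod H y x)"
    and iprod_pos: "\<lbrakk>x \<in> carrier H; x \<noteq> \<zero>\<^bsub>H\<^esub>\<rbrakk> \<Longrightarrow> Re (iprod H x x) > 0"
    and complete: "\<lbrakk>range u \<subseteq> carrier H;
      \<And>e. e > 0 \<Longrightarrow> \<exists>N. \<forall>m\<ge>N. \<forall>n\<ge>N.
        sqrt (Re (iprod H (u m \<ominus>\<^bsub>H\<^esub> u n) (u m \<ominus>\<^bsub>H\<^esub> u n))) < e\<rbrakk> \<Longrightarrow>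
      \<exists>l\<in>carrier H.
        (\<lambda>n. sqrt (Re (iprod H (u n \<ominus>\<^bsub>H\<^esub> l) (u n \<ominus>\<^bsub>H\<^esub> l)))) \<longlonglongrightarrow> 0"

definition unitary_operator :: "('v, 'm) inner_module_scheme \<Rightarrow> ('v \<Rightarrow> 'v) \<Rightarrow> bool" where
  "unitary_operator H U \<longleftrightarrow>
     bij_betw U (carrier H) (carrier H) \<and>
     (\<forall>x\<in>carrier H. \<forall>y\<in>carrier H. U (x \<oplus>\<^bsub>H\<^esub> y) = U x \<oplus>\<^bsub>H\<^esub> U y) \<and>
     (\<forall>c. \<forall>x\<in>carrier H. U (c \<odot>\<^bsub>H\<^esub> x) = c \<odot>\<^bsub>H\<^esub> U x) \<and>
     (\<forall>x\<in>carrier H. \<forall>y\<in>carrier H. iprod H (U x) (U y) = iprod H x y)"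

definition unitary_representation ::
  "('g, 'a) monoid_scheme \<Rightarrow> ('v, 'm) inner_module_scheme \<Rightarrow> ('g \<Rightarrow> 'v \<Rightarrow> 'v) \<Rightarrow> bool" where
  "unitary_representation G H \<pi> \<longleftrightarrow>
     complex_hilbert_space H \<and>
     (\<forall>g\<in>carrier G. unitary_operator H (\<pi> g)) \<and>
     (\<forall>g\<in>carrier G. \<forall>h\<in>carrier G. \<forall>x\<in>carrier H. \<pi> (g \<otimes>\<^bsub>G\<^esub> h) x = \<pi> g (\<pi> h x)) \<and>
     (\<forall>x\<in>carrier H. \<pi> \<one>\<^bsub>G\<^esub> x = x)"

text \<open>Weak containment of \<open>\<sigma>\<close> (on \<open>K\<close>) in \<open>\<pi>\<close> (on \<open>H\<close>), for representations of a discrete group: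
  every diagonal matrix coefficient of \<open>\<sigma>\<close> is a limit, uniformly on finite (that is, compact)
  sets, of finite sums of diagonal matrix coefficients of \<open>\<pi>\<close>.\<close>

definition weakly_contains ::
  "('g, 'a) monoid_scheme \<Rightarrow> ('v, 'm) inner_module_scheme \<Rightarrow> ('g \<Rightarrow> 'v \<Rightarrow> 'v) \<Rightarrow>
   ('u, 'k) inner_module_scheme \<Rightarrow> ('g \<Rightarrow> 'u \<Rightarrow> 'u) \<Rightarrow> bool" where
  "weakly_contains G H \<pi> K \<sigma> \<longleftrightarrow>
     (\<forall>\<xi>\<in>carrier K. \<forall>F. finite F \<and> F \<subseteq> carrier G \<longrightarrow>
       (\<forall>e>0. \<exists>\<eta>s. set \<eta>s \<subseteq> carrier H \<and>
         (\<forall>g\<in>F. cmod (iprod K (\<sigma> g \<xi>) \<xi> - (\<Sum>\<eta>\<leftarrow>\<eta>s. iprod H (\<pi> g \<eta>) \<eta>)) < e)))"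

definition complex_line :: "complex inner_module" where
  "complex_line = \<lparr>carrier = UNIV, mult = (*), one = 1, zero = 0, add = (+), smult = (*),
     iprod = (\<lambda>x y. x * cnj y)\<rparr>"

definition trivial_rep :: "'g \<Rightarrow> complex \<Rightarrow> complex" where
  "trivial_rep g z = z"

lemma cring_complex_ring: "cring complex_ring"
  by (unfold_locales) (auto simp: complex_ring_def algebra_simps Units_def intro: exI[of _ "- x" for x] add.right_inverse add.left_inverse)

lemma complex_hilbert_space_complex_line: "complex_hilbert_space complex_line"
proof -
  interpret C: cring complex_ring by (rule cring_complex_ring)
  have ag: "abelian_group complex_line"
    by (rule abelian_groupI)
      (auto simp: complex_line_def algebra_simps intro: exI[of _ "- x" for x] add.left_inverse)
  have m: "Module.module complex_ring complex_line"
    by (rule Module.moduleI[OF cring_complex_ring ag])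
      (auto simp: complex_line_def complex_ring_def algebra_simps)
  interpret A: abelian_group complex_line by (rule ag)
  have uminus: "\<ominus>\<^bsub>complex_line\<^esub> x = - x" for x
    by (rule A.minus_equality) (auto simp: complex_line_def)
  have nrm: "sqrt (Re (iprod complex_line (x \<ominus>\<^bsub>complex_line\<^esub> y) (x \<ominus>\<^bsub>complex_line\<^esub> y)))
      = dist x y" for x y
    unfolding a_minus_def uminus
    by (simp add: complex_line_def dist_norm cmod_def power2_eq_square algebra_simps)
  show ?thesis
  proof (intro complex_hilbert_space.intro m complex_hilbert_space_axioms.intro)
    fix u :: "nat \<Rightarrow> complex"
    assume "\<And>e. e > 0 \<Longrightarrow> \<exists>N. \<forall>m\<ge>N. \<forall>n\<ge>N.
        sqrt (Re (iprod complex_line (u m \<ominus>\<^bsub>complex_line\<^esub> u n)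
          (u m \<ominus>\<^bsub>complex_line\<^esub> u n))) < e"
    then have "Cauchy u" unfolding nrm Cauchy_def by auto
    then obtain l where "u \<longlonglongrightarrow> l" using Cauchy_convergent convergent_def by blast
    then show "\<exists>l\<in>carrier complex_line. (\<lambda>n. sqrt (Re (iprod complex_line
        (u n \<ominus>\<^bsub>complex_line\<^esub> l) (u n \<ominus>\<^bsub>complex_line\<^esub> l)))) \<longlonglongrightarrow> 0"
      unfolding nrm using tendsto_dist_iff by (auto simp: complex_line_def)
  qed (auto simp: complex_line_def algebra_simps complex_eq_iff sum_power2_gt_zero_iff
         power2_eq_square[symmetric])
qed

lemma unitary_representation_trivial_rep: "unitary_representation G complex_line trivial_rep"
  by (auto simp: unitary_representation_def unitary_operator_def trivial_rep_def
      complex_hilbert_space_complex_line bij_betw_def inj_on_def)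

text \<open>The Hilbert spaces range over all those whose underlying set is contained in the type
  \<^typ>\<open>nat \<Rightarrow> complex\<close>, with arbitrary operations. Up to isomorphism these include all separable
  Hilbert spaces, since a separable Hilbert space has at most the cardinality of the continuum.
  For countable \<open>G\<close> this is no restriction: if \<open>\<pi>\<close> weakly contains the trivial
  representation, then so does the restriction of \<open>\<pi>\<close> to the separable subspace generated
  by a sequence of almost invariant unit vectors.\<close>

definition relative_property_T :: "('g, 'a) monoid_scheme \<Rightarrow> 'g set \<Rightarrow> bool" where
  "relative_property_T G N \<longleftrightarrow>
     (\<forall>(H :: (nat \<Rightarrow> complex) inner_module) \<pi>.
        unitary_representation G H \<pi> \<and> weakly_contains G H \<pi> complex_line trivial_rep \<longrightarrow>
        (\<exists>\<xi>\<in>carrier H. \<xi> \<noteq> \<zero>\<^bsub>H\<^esub> \<and> (\<forall>g\<in>N. \<pi> g \<xi> = \<xi>)))"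

definition finitely_generated_group :: "('g, 'a) monoid_scheme \<Rightarrow> bool" where
  "finitely_generated_group G \<longleftrightarrow>
     (\<exists>S. finite S \<and> S \<subseteq> carrier G \<and> generate G S = carrier G)"


section \<open>Measure preserving actions\<close>

definition measure_preserving :: "'x measure \<Rightarrow> 'y measure \<Rightarrow> ('x \<Rightarrow> 'y) \<Rightarrow> bool" where
  "measure_preserving M N f \<longleftrightarrow> f \<in> M \<rightarrow>\<^sub>M N \<and> distr M N f = N"

text \<open>Isomorphism is understood modulo null sets. The interval carries the Borel
  \<open>\<sigma>\<close>-algebra; modulo null sets, its completion is the Lebesgue one.\<close>

definition isomorphic_mod_null :: "'x measure \<Rightarrow> 'y measure \<Rightarrow> bool" where
  "isomorphic_mod_null M N \<longleftrightarrow>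
     (\<exists>A\<in>null_sets M. \<exists>B\<in>null_sets N. \<exists>f g.
        measure_preserving (restrict_space M (space M - A)) (restrict_space N (space N - B)) f \<and>
        measure_preserving (restrict_space N (space N - B)) (restrict_space M (space M - A)) g \<and>
        (\<forall>x\<in>space M - A. g (f x) = x) \<and> (\<forall>y\<in>space N - B. f (g y) = y))"

definition standard_probability_space :: "'x measure \<Rightarrow> bool" where
  "standard_probability_space M \<longleftrightarrow>
     isomorphic_mod_null M (restrict_space lborel {0..1::real})"

definition mp_action ::
  "('g, 'a) monoid_scheme \<Rightarrow> 'x measure \<Rightarrow> ('g \<Rightarrow> 'x \<Rightarrow> 'x) \<Rightarrow> bool" where
  "mp_action G M \<alpha> \<longleftrightarrow>
     prob_space M \<and> group_action G (space M) \<alpha> \<and>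
     (\<forall>g\<in>carrier G. measure_preserving M M (\<alpha> g))"

definition free_action ::
  "('g, 'a) monoid_scheme \<Rightarrow> 'x measure \<Rightarrow> ('g \<Rightarrow> 'x \<Rightarrow> 'x) \<Rightarrow> bool" where
  "free_action G M \<alpha> \<longleftrightarrow>
     (\<forall>g\<in>carrier G. g \<noteq> \<one>\<^bsub>G\<^esub> \<longrightarrow> {x \<in> space M. \<alpha> g x = x} \<in> null_sets M)"

definition ergodic_action ::
  "('g, 'a) monoid_scheme \<Rightarrow> 'x measure \<Rightarrow> ('g \<Rightarrow> 'x \<Rightarrow> 'x) \<Rightarrow> bool" where
  "ergodic_action G M \<alpha> \<longleftrightarrow>
     (\<forall>A\<in>sets M. (\<forall>g\<in>carrier G. \<alpha> g -` A \<inter> space M = A) \<longrightarrow>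
        measure M A = 0 \<or> measure M A = 1)"

definition finite_probability_space :: "'x measure \<Rightarrow> bool" where
  "finite_probability_space M \<longleftrightarrow>
     prob_space M \<and> finite (space M) \<and> sets M = Pow (space M)"

definition inverse_system ::
  "('g, 'a) monoid_scheme \<Rightarrow> (nat \<Rightarrow> 'y measure) \<Rightarrow> (nat \<Rightarrow> 'g \<Rightarrow> 'y \<Rightarrow> 'y) \<Rightarrow>
   (nat \<Rightarrow> 'y \<Rightarrow> 'y) \<Rightarrow> bool" where
  "inverse_system G MX \<alpha>X q \<longleftrightarrow>
     (\<forall>n. finite_probability_space (MX n) \<and> mp_action G (MX n) (\<alpha>X n)) \<and>
     (\<forall>n. measure_preserving (MX (Suc n)) (MX n) (q n) \<and>
          q n ` space (MX (Suc n)) = space (MX n) \<and>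
          (\<forall>g\<in>carrier G. \<forall>x\<in>space (MX (Suc n)). q n (\<alpha>X (Suc n) g x) = \<alpha>X n g (q n x)))"

definition inverse_limit_set ::
  "(nat \<Rightarrow> 'y measure) \<Rightarrow> (nat \<Rightarrow> 'y \<Rightarrow> 'y) \<Rightarrow> (nat \<Rightarrow> 'y) set" where
  "inverse_limit_set MX q = {x. \<forall>n. x n \<in> space (MX n) \<and> q n (x (Suc n)) = x n}"

definition coord :: "nat \<Rightarrow> (nat \<Rightarrow> 'y) \<Rightarrow> 'y" where
  "coord n x = x n"

text \<open>The product space below only contributes its \<open>\<sigma>\<close>-algebra, generated by the coordinate
  maps; the measure of \<open>M\<close> is pinned down by its coordinate marginals.\<close>

definition inverse_limit_action ::
  "('g, 'a) monoid_scheme \<Rightarrow> (nat \<Rightarrow> 'y measure) \<Rightarrow> (nat \<Rightarrow> 'g \<Rightarrow> 'y \<Rightarrow> 'y) \<Rightarrow>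
   (nat \<Rightarrow> 'y \<Rightarrow> 'y) \<Rightarrow> (nat \<Rightarrow> 'y) measure \<Rightarrow> ('g \<Rightarrow> (nat \<Rightarrow> 'y) \<Rightarrow> (nat \<Rightarrow> 'y)) \<Rightarrow> bool" where
  "inverse_limit_action G MX \<alpha>X q M \<alpha> \<longleftrightarrow>
     inverse_system G MX \<alpha>X q \<and>
     space M = inverse_limit_set MX q \<and>
     sets M = sets (restrict_space (Pi\<^sub>M UNIV MX) (inverse_limit_set MX q)) \<and>
     prob_space M \<and>
     (\<forall>n. measure_preserving M (MX n) (coord n)) \<and>
     (\<forall>g\<in>carrier G. \<forall>x\<in>space M. \<alpha> g x = (\<lambda>n. \<alpha>X n g (x n)))"


section \<open>Cocycles\<close>

definition cocycle ::
  "('g, 'a) monoid_scheme \<Rightarrow> 'x measure \<Rightarrow> ('g \<Rightarrow> 'x \<Rightarrow> 'x) \<Rightarrow> ('l, 'b) monoid_scheme \<Rightarrow>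
   ('g \<times> 'x \<Rightarrow> 'l) \<Rightarrow> bool" where
  "cocycle G M \<alpha> L w \<longleftrightarrow>
     w \<in> count_space (carrier G) \<Otimes>\<^sub>M M \<rightarrow>\<^sub>M count_space (carrier L) \<and>
     (\<forall>g\<in>carrier G. \<forall>h\<in>carrier G. AE x in M.
        w (g \<otimes>\<^bsub>G\<^esub> h, x) = w (g, \<alpha> h x) \<otimes>\<^bsub>L\<^esub> w (h, x))"

definition cohomologous ::
  "('g, 'a) monoid_scheme \<Rightarrow> 'x measure \<Rightarrow> ('g \<Rightarrow> 'x \<Rightarrow> 'x) \<Rightarrow> ('l, 'b) monoid_scheme \<Rightarrow>
   ('g \<times> 'x \<Rightarrow> 'l) \<Rightarrow> ('g \<times> 'x \<Rightarrow> 'l) \<Rightarrow> bool" where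
  "cohomologous G M \<alpha> L w w' \<longleftrightarrow>
     (\<exists>\<phi> \<in> M \<rightarrow>\<^sub>M count_space (carrier L). \<forall>g\<in>carrier G. AE x in M.
        w' (g, x) = \<phi> (\<alpha> g x) \<otimes>\<^bsub>L\<^esub> w (g, x) \<otimes>\<^bsub>L\<^esub> inv\<^bsub>L\<^esub> (\<phi> x))"

end

theory Submission
  imports Defs "HOL-Library.Function_Algebras"
begin

text \<open>The group acts on \<open>X \<times> X \<times> \<Lambda>\<close> by \<open>\<gamma>(x, y, t) = (\<gamma>x, \<gamma>y, w(\<gamma>, x) t w(\<gamma>, y)\<^sup>-\<^sup>1)\<close>.
  The normalised indicators of the pairs \<open>x, y\<close> with equal image in \<open>X\<^sub>n\<close> and \<open>t = 1\<close> are almost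
  invariant vectors, because \<open>w(\<gamma>, \<cdot>)\<close> is nearly constant on most atoms of \<open>X\<^sub>n\<close>. Relative property (T)
  and normality give a \<open>\<Gamma>\<^sub>0\<close>-invariant vector close to one of them. The dominant value of \<open>t\<close> at \<open>(x, y)\<close>
  is then a partially defined \<open>\<Lambda>\<close>-valued kernel \<open>p\<close> with \<open>p(\<gamma>x, \<gamma>y) = w(\<gamma>, x) p(x, y) w(\<gamma>, y)\<^sup>-\<^sup>1\<close> for
  \<open>\<gamma> \<in> \<Gamma>\<^sub>0\<close>, equal to \<open>1\<close> on most pairs. By ergodicity of \<open>\<Gamma>\<^sub>0\<close>, for almost every (not just most) \<open>x\<close> the
  relation \<open>p(x, y) p(y, y') = p(x, y')\<close> holds for most \<open>(y, y')\<close> in the atom of \<open>x\<close>; hence for \<open>x, z\<close> in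
  one atom, \<open>p(x, y) p(z, y)\<^sup>-\<^sup>1\<close> has a majority value over \<open>y\<close>. Taking for \<open>z\<close> a base point of the atom gives
  the function that conjugates \<open>w\<close>, restricted to \<open>\<Gamma>\<^sub>0\<close>, to a cocycle constant on the atoms of \<open>X\<^sub>n\<close>.
  For each \<open>\<gamma> \<in> \<Gamma>\<close> the set of pairs where the new cocycle at \<open>\<gamma>\<close> agrees is \<open>\<Gamma>\<^sub>0\<close>-invariant, so the
  same ergodicity argument makes it constant on the atoms of a finer level, and finitely many \<open>\<gamma>\<close>
  suffice.\<close>

section \<open>Semi-inner product spaces\<close>

text \<open>The coordinate \<open>t\<close> linearises a cocycle with nonabelian values: a kernel
  becomes a family of point masses over the pairs, and the cocycle moves these masses by bijections
  of \<open>\<Lambda>\<close>, hence unitarily. A vector supported on \<open>t = 1\<close> over the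
  pairs in one atom is invariant when the cocycle is constant on atoms, so its displacement measures
  how far the cocycle is from descending to that level. Every error is relative to the size
  \<open>c\<close> of an atom, which ergodicity makes the same for almost every point; hence the
  factor \<open>1 / sqrt c\<close> in the vectors. A fixed vector at squared distance
  \<open>1/400\<close>, read with threshold \<open>1/2\<close>, gives a kernel that is wrong on at
  most \<open>1/100\<close> of the pairs. The obstacle is that this is an average over
  \<open>x\<close>, that nothing makes the kernel exactly multiplicative, and that it is equivariant
  under \<open>N0\<close> alone. The measure of bad pairs seen from \<open>x\<close> is an
  \<open>N0\<close>-invariant function, and such a function is bounded almost everywhere by its
  mean. Once the error is small at almost every point, two majorities in an atom always meet, and
  values can be compared exactly.\<close>

locale semi_hilbert =
  fixes V :: "'v::ab_group_add set"
    and sc :: "complex \<Rightarrow> 'v \<Rightarrow> 'v"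
    and ip :: "'v \<Rightarrow> 'v \<Rightarrow> complex"
  assumes zero_mem: "0 \<in> V"
    and add_mem: "x \<in> V \<Longrightarrow> y \<in> V \<Longrightarrow> x + y \<in> V"
    and uminus_mem: "x \<in> V \<Longrightarrow> - x \<in> V"
    and sc_mem: "x \<in> V \<Longrightarrow> sc c x \<in> V"
    and ip_add_left: "x \<in> V \<Longrightarrow> y \<in> V \<Longrightarrow> z \<in> V \<Longrightarrow> ip (x + y) z = ip x z + ip y z"
    and ip_sc_left: "x \<in> V \<Longrightarrow> y \<in> V \<Longrightarrow> ip (sc c x) y = c * ip x y"
    and ip_cnj: "x \<in> V \<Longrightarrow> y \<in> V \<Longrightarrow> ip x y = cnj (ip y x)"
    and ip_nonneg: "x \<in> V \<Longrightarrow> 0 \<le> Re (ip x x)"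
    and complete_V: "range u \<subseteq> V \<Longrightarrow>
      (\<And>e. e > 0 \<Longrightarrow> \<exists>N. \<forall>m\<ge>N. \<forall>n\<ge>N. Re (ip (u m - u n) (u m - u n)) < e) \<Longrightarrow>
      \<exists>l\<in>V. (\<lambda>n. Re (ip (u n - l) (u n - l))) \<longlonglongrightarrow> 0"
begin

text \<open>Vectors will be functions, not classes modulo null sets, so the form is only
  semidefinite and \<open>sq x = 0\<close> stands in for \<open>x = 0\<close>. Squares keep roots
  out of the estimates.\<close>

definition sq :: "'v \<Rightarrow> real" where "sq x = Re (ip x x)"

lemma sq_nonneg: "x \<in> V \<Longrightarrow> 0 \<le> sq x"
  unfolding sq_def by (rule ip_nonneg)

lemma diff_mem: "x \<in> V \<Longrightarrow> y \<in> V \<Longrightarrow> x - y \<in> V"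
  using add_mem[of x "- y"] uminus_mem[of y] by simp

lemma ip_zero_left: "y \<in> V \<Longrightarrow> ip 0 y = 0"
  using ip_add_left[of 0 0 y] zero_mem by simp

lemma ip_uminus_left: "x \<in> V \<Longrightarrow> y \<in> V \<Longrightarrow> ip (- x) y = - ip x y"
  using ip_add_left[of x "- x" y] uminus_mem[of x] ip_zero_left[of y]
  by (simp add: eq_neg_iff_add_eq_0 add.commute)

lemma ip_diff_left: "x \<in> V \<Longrightarrow> y \<in> V \<Longrightarrow> z \<in> V \<Longrightarrow> ip (x - y) z = ip x z - ip y z"
  using ip_add_left[of x "- y" z] uminus_mem[of y] ip_uminus_left[of y z] by simp

lemma ip_add_right: "x \<in> V \<Longrightarrow> y \<in> V \<Longrightarrow> z \<in> V \<Longrightarrow> ip z (x + y) = ip z x + ip z y"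
  using ip_cnj[of z "x + y"] ip_cnj[of z x] ip_cnj[of z y] ip_add_left[of x y z] add_mem[of x y]
  by simp

lemma ip_diff_right: "x \<in> V \<Longrightarrow> y \<in> V \<Longrightarrow> z \<in> V \<Longrightarrow> ip z (x - y) = ip z x - ip z y"
  using ip_cnj[of z "x - y"] ip_cnj[of z x] ip_cnj[of z y] ip_diff_left[of x y z] diff_mem[of x y]
  by simp

lemma ip_sc_right: "x \<in> V \<Longrightarrow> y \<in> V \<Longrightarrow> ip y (sc c x) = cnj c * ip y x"
  using ip_cnj[of y "sc c x"] ip_cnj[of y x] ip_sc_left[of x y c] sc_mem[of x c] by simp

lemma ip_self: "x \<in> V \<Longrightarrow> ip x x = complex_of_real (sq x)"
  unfolding sq_def using ip_cnj[of x x] by (simp add: complex_eq_iff)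

lemma sq_sc: "x \<in> V \<Longrightarrow> sq (sc c x) = (cmod c)\<^sup>2 * sq x"
proof -
  assume x: "x \<in> V"
  have "ip (sc c x) (sc c x) = (c * cnj c) * ip x x"
    using x by (simp add: ip_sc_left ip_sc_right sc_mem)
  also have "\<dots> = (c * cnj c) * complex_of_real (sq x)" by (simp only: ip_self[OF x])
  also have "\<dots> = complex_of_real ((cmod c)\<^sup>2 * sq x)"
    by (simp only: complex_norm_square of_real_mult)
  finally show ?thesis unfolding sq_def[of "sc c x"] by simp
qed

lemma sq_add: "x \<in> V \<Longrightarrow> y \<in> V \<Longrightarrow> sq (x + y) = sq x + sq y + 2 * Re (ip x y)"
  unfolding sq_def using ip_cnj[of x y]
  by (simp add: ip_add_left ip_add_right add_mem)

lemma sq_diff: "x \<in> V \<Longrightarrow> y \<in> V \<Longrightarrow> sq (x - y) = sq x + sq y - 2 * Re (ip x y)"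
  unfolding sq_def using ip_cnj[of x y]
  by (simp add: ip_diff_left ip_diff_right diff_mem)

lemma sq_zero: "sq 0 = 0"
  unfolding sq_def using ip_zero_left[OF zero_mem] by simp

lemma sq_add_le: "x \<in> V \<Longrightarrow> y \<in> V \<Longrightarrow> sq (x + y) \<le> 2 * sq x + 2 * sq y"
  using sq_add[of x y] sq_diff[of x y] sq_nonneg[of "x - y"] diff_mem[of x y] by simp

lemma sq_diff_le: "x \<in> V \<Longrightarrow> y \<in> V \<Longrightarrow> sq (x - y) \<le> 2 * sq x + 2 * sq y"
  using sq_add[of x y] sq_diff[of x y] sq_nonneg[of "x + y"] add_mem[of x y] by simp

text \<open>The multiple of \<open>y\<close> is aligned with \<open>ip x y\<close>, so the cross
  term is real and a single real parameter \<open>t\<close> remains. For \<open>sq y > 0\<close> the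
  choice \<open>t = 1 / sq y\<close> yields both Cauchy--Schwarz and the orthogonality of minimal
  vectors.\<close>

lemma sq_diff_sc_ip:
  assumes x: "x \<in> V" and y: "y \<in> V"
  shows "sq (x - sc (complex_of_real t * ip x y) y) =
    sq x - 2 * t * (cmod (ip x y))\<^sup>2 + t\<^sup>2 * (cmod (ip x y))\<^sup>2 * sq y"
proof -
  define a where "a = ip x y"
  define c where "c = complex_of_real t * a"
  have "sq (x - sc c y) = sq x + (cmod c)\<^sup>2 * sq y - 2 * Re (cnj c * a)"
    using x y by (simp add: sq_diff sc_mem sq_sc ip_sc_right a_def)
  also have "cnj c * a = complex_of_real (t * (cmod a)\<^sup>2)"
    unfolding c_def by (simp add: complex_norm_square[symmetric] mult.commute mult.left_commute)
  also have "(cmod c)\<^sup>2 = t\<^sup>2 * (cmod a)\<^sup>2"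
    unfolding c_def by (simp add: norm_mult power_mult_distrib)
  finally show ?thesis unfolding c_def a_def by simp
qed

lemma Cauchy_Schwarz:
  assumes x: "x \<in> V" and y: "y \<in> V"
  shows "(cmod (ip x y))\<^sup>2 \<le> sq x * sq y"
proof -
  define A where "A = (cmod (ip x y))\<^sup>2"
  have key: "0 \<le> sq x - 2 * t * A + t\<^sup>2 * A * sq y" for t :: real
    unfolding A_def sq_diff_sc_ip[OF x y, symmetric] using x y by (intro sq_nonneg diff_mem sc_mem)
  show ?thesis
  proof (cases "sq y = 0")
    case True
    have "A \<le> 0"
    proof (rule ccontr)
      assume "\<not> A \<le> 0"
      \<comment> \<open>With \<open>sq y = 0\<close> the quadratic in \<open>key\<close> is affine
        in \<open>t\<close>; this \<open>t\<close> brings it down to \<open>-1\<close>.\<close>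
      then show False using key[of "(sq x + 1) / (2 * A)"] True by simp
    qed
    then show ?thesis using True by (simp add: A_def)
  next
    case False
    then have p: "sq y > 0" using sq_nonneg[OF y] by simp
    have e: "(1 / sq y)\<^sup>2 * A * sq y = (1 / sq y) * A"
      using p by (simp add: power2_eq_square)
    have "A / sq y \<le> sq x" using key[of "1 / sq y"] unfolding e by simp
    then show ?thesis using p by (simp add: A_def pos_divide_le_eq)
  qed
qed

lemma ip_eq_0: 
  assumes "x \<in> V" "y \<in> V" "sq x = 0"
  shows "ip x y = 0" "ip y x = 0"
  using Cauchy_Schwarz[of x y] Cauchy_Schwarz[of y x] assms by simp_all

lemma parallelogram: "x \<in> V \<Longrightarrow> y \<in> V \<Longrightarrow> sq (x + y) + sq (x - y) = 2 * sq x + 2 * sq y"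
  by (simp add: sq_add sq_diff)

lemma LIMSEQ_ip:
  assumes "range u \<subseteq> V" "l \<in> V" "y \<in> V" "(\<lambda>n. sq (u n - l)) \<longlonglongrightarrow> 0"
  shows "(\<lambda>n. ip (u n) y) \<longlonglongrightarrow> ip l y"
proof -
  have "(\<lambda>n. cmod (ip (u n) y - ip l y)) \<longlonglongrightarrow> 0"
  proof (rule Lim_null_comparison)
    have "(\<lambda>n. sqrt (sq (u n - l) * sq y)) \<longlonglongrightarrow> sqrt (0 * sq y)"
      by (intro tendsto_intros assms)
    then show "(\<lambda>n. sqrt (sq (u n - l) * sq y)) \<longlonglongrightarrow> 0" by simp
    show "\<forall>\<^sub>F n in sequentially. norm (cmod (ip (u n) y - ip l y)) \<le> sqrt (sq (u n - l) * sq y)"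
    proof (rule always_eventually, rule allI)
      fix n
      have un: "u n \<in> V" using assms(1) by auto
      have "(cmod (ip (u n - l) y))\<^sup>2 \<le> sq (u n - l) * sq y"
        using un assms by (intro Cauchy_Schwarz diff_mem)
      then have "cmod (ip (u n - l) y) \<le> sqrt (sq (u n - l) * sq y)"
        by (rule real_le_rsqrt)
      then show "norm (cmod (ip (u n) y - ip l y)) \<le> sqrt (sq (u n - l) * sq y)"
        using un assms by (simp add: ip_diff_left)
    qed
  qed
  then have "(\<lambda>n. ip (u n) y - ip l y) \<longlonglongrightarrow> 0" by (rule tendsto_norm_zero_cancel)
  then show ?thesis by (simp add: LIM_zero_iff)
qed

text \<open>Otherwise removing the component of \<open>z\<close> along \<open>k\<close> would lower
  \<open>sq z\<close> by \<open>(cmod (ip z k))\<^sup>2 / sq k\<close>.\<close>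

lemma orthogonal_of_minimal:
  assumes z: "z \<in> V" and k: "k \<in> V" and min: "\<And>c. sq z \<le> sq (z - sc c k)"
  shows "ip z k = 0"
proof (rule ccontr)
  define A where "A = (cmod (ip z k))\<^sup>2"
  assume "ip z k \<noteq> 0"
  then have A: "A > 0" and "sq k \<noteq> 0" using ip_eq_0(2)[OF k z] by (auto simp: A_def)
  then have p: "sq k > 0" using sq_nonneg[OF k] by simp
  have e: "(1 / sq k)\<^sup>2 * A * sq k = (1 / sq k) * A"
    using p by (simp add: power2_eq_square)
  have "sq z \<le> sq z - 2 * (1 / sq k) * A + (1 / sq k)\<^sup>2 * A * sq k"
    using min unfolding A_def sq_diff_sc_ip[OF z k, symmetric] .
  then have "A / sq k \<le> 0" unfolding e by simp
  then show False using A p by (simp add: divide_le_0_iff)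
qed

text \<open>The minimising-sequence argument, with closedness tested by sequences in the seminorm.
  The nearest point is determined only up to null vectors, so existence is all that is
  claimed.\<close>

lemma projection_exists:
  assumes KV: "K \<subseteq> V" and K0: "0 \<in> K"
    and Kadd: "\<And>x y. x \<in> K \<Longrightarrow> y \<in> K \<Longrightarrow> x + y \<in> K"
    and Ksc: "\<And>x c. x \<in> K \<Longrightarrow> sc c x \<in> K"
    and Kclosed: "\<And>u l. range u \<subseteq> K \<Longrightarrow> l \<in> V \<Longrightarrow> (\<lambda>n. sq (u n - l)) \<longlonglongrightarrow> 0 \<Longrightarrow> l \<in> K"
    and x: "x \<in> V"
  shows "\<exists>p\<in>K. \<forall>k\<in>K. ip (x - p) k = 0"
proof -
  define d where "d = (INF k\<in>K. sq (x - k))"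
  have bdd: "bdd_below ((\<lambda>k. sq (x - k)) ` K)"
    using KV x by (intro bdd_belowI2[of _ 0] sq_nonneg diff_mem) auto
  have dle: "d \<le> sq (x - k)" if "k \<in> K" for k
    unfolding d_def by (rule cINF_lower[OF bdd that])
  have "\<exists>k\<in>K. sq (x - k) < d + 1 / Suc n" for n
  proof -
    have "d < d + 1 / Suc n" by simp
    then show ?thesis unfolding d_def using K0 bdd by (subst (asm) cINF_less_iff) auto
  qed
  then obtain u where u: "\<And>n. u n \<in> K" "\<And>n. sq (x - u n) < d + 1 / Suc n" by metis
  have uV: "u n \<in> V" for n using u(1) KV by auto
  have cauchy: "\<exists>N. \<forall>m\<ge>N. \<forall>n\<ge>N. Re (ip (u m - u n) (u m - u n)) < e" if e: "e > 0" for e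
  proof -
    obtain N where N: "1 / Suc N < e / 4" 
      using reals_Archimedean[of "e/4"] e by (auto simp: inverse_eq_divide)
    have "sq (u m - u n) < e" if mn: "m \<ge> N" "n \<ge> N" for m n
    proof -
      \<comment> \<open>The midpoint lies in \<open>K\<close>, so its squared distance from
        \<open>x\<close> is at least \<open>d\<close>; the parallelogram law then leaves less than
        \<open>2 / Suc n + 2 / Suc m\<close>, which explains \<open>e / 4\<close> in the choice of
        \<open>N\<close>.\<close>
      let ?h = "sc (1/2) (u m + u n)"
      have h: "?h \<in> K" by (intro Ksc Kadd u)
      have hV: "?h \<in> V" using h KV by auto
      have smV: "u m + u n \<in> V" by (intro add_mem uV)
      have "sq ((x - u n) + (x - u m)) + sq ((x - u n) - (x - u m))
          = 2 * sq (x - u n) + 2 * sq (x - u m)"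
        using uV x by (intro parallelogram diff_mem)
      moreover have "(x - u n) - (x - u m) = u m - u n" by simp
      \<comment> \<open>\<open>sc\<close> is not assumed to distribute over sums, so both sides are
        expanded through inner products.\<close>
      moreover have "sq ((x - u n) + (x - u m)) = 4 * sq (x - ?h)"
      proof -
        have e1: "(x - u n) + (x - u m) = (x + x) - (u m + u n)" by (simp add: algebra_simps)
        have e2: "sq (x + x) = 4 * sq x" using sq_add[OF x x] by (simp add: sq_def)
        have e3: "Re (ip (x + x) (u m + u n)) = 2 * Re (ip x (u m + u n))"
          using x smV by (simp add: ip_add_left)
        have "sq ((x + x) - (u m + u n)) = 4 * sq x + sq (u m + u n) - 4 * Re (ip x (u m + u n))"
          using x smV by (simp add: sq_diff add_mem e2 e3)
        moreover have "sq (x - ?h) = sq x + sq (u m + u n) / 4 - Re (ip x (u m + u n))"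
          using x smV by (simp add: sq_diff sc_mem sq_sc ip_sc_right power2_eq_square)
        ultimately show ?thesis unfolding e1 by simp
      qed
      moreover have "d \<le> sq (x - ?h)" by (rule dle[OF h])
      moreover have "sq (x - u n) < d + 1 / Suc n" "sq (x - u m) < d + 1 / Suc m" by (rule u)+
      moreover have "1 / real (Suc n) \<le> 1 / Suc N" "1 / real (Suc m) \<le> 1 / Suc N"
        using mn by (auto intro!: divide_left_mono)
      ultimately show ?thesis using N by (simp only:)
    qed
    then show ?thesis unfolding sq_def by blast
  qed
  have ruV: "range u \<subseteq> V" using uV by auto
  obtain l where l: "l \<in> V" "(\<lambda>n. sq (u n - l)) \<longlonglongrightarrow> 0"
    using complete_V[OF ruV cauchy] unfolding sq_def by blast
  have lK: "l \<in> K" using Kclosed[OF _ l] u by auto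
  have sql: "sq (x - l) \<le> d"
  proof -
    have xuV: "range (\<lambda>n. x - u n) \<subseteq> V" using uV x by (auto intro: diff_mem)
    have xl: "x - l \<in> V" using x l by (intro diff_mem)
    \<comment> \<open>Expansion around \<open>l\<close>: the squared error and the cross term both
      vanish in the limit, the latter by continuity of the form.\<close>
    have eq: "sq (x - u n) = sq (x - l) + sq (u n - l) - 2 * Re (ip (u n - l) (x - l))" for n
    proof -
      have "x - u n = (x - l) - (u n - l)" by simp
      moreover have "Re (ip (x - l) (u n - l)) = Re (ip (u n - l) (x - l))"
        using ip_cnj[of "x - l" "u n - l"] xl uV l by (simp add: diff_mem)
      ultimately show ?thesis using sq_diff[OF xl diff_mem[OF uV l(1)], of n] by simp
    qed
    have "(\<lambda>n. ip (u n) (x - l)) \<longlonglongrightarrow> ip l (x - l)"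
      by (rule LIMSEQ_ip[OF ruV l(1) xl l(2)])
    then have "(\<lambda>n. ip (u n) (x - l) - ip l (x - l)) \<longlonglongrightarrow> 0" by (simp add: LIM_zero_iff)
    then have "(\<lambda>n. ip (u n - l) (x - l)) \<longlonglongrightarrow> 0"
      using uV l xl by (simp add: ip_diff_left)
    then have lim: "(\<lambda>n. Re (ip (u n - l) (x - l))) \<longlonglongrightarrow> 0" by (auto dest: tendsto_Re)
    have "(\<lambda>n. sq (x - u n)) \<longlonglongrightarrow> sq (x - l) + 0 - 2 * 0"
      unfolding eq by (intro tendsto_intros l lim)
    then have a: "(\<lambda>n. sq (x - u n)) \<longlonglongrightarrow> sq (x - l)" by simp
    have b: "(\<lambda>n. d + 1 / real (Suc n)) \<longlonglongrightarrow> d + 0"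
      by (intro tendsto_intros lim_1_over_n[THEN LIMSEQ_Suc])
    have "sq (x - l) \<le> d + 0"
      by (rule LIMSEQ_le[OF a b]) (use u(2) in \<open>auto intro: less_imp_le\<close>)
    then show ?thesis by simp
  qed
  have "ip (x - l) k = 0" if k: "k \<in> K" for k
  proof (rule orthogonal_of_minimal)
    show "x - l \<in> V" using x l by (intro diff_mem)
    show "k \<in> V" using k KV by auto
    fix c
    have "sq (x - l) \<le> sq (x - (l + sc c k))"
      using sql dle[of "l + sc c k"] Kadd[OF lK Ksc[OF k, of c]] by linarith
    then show "sq (x - l) \<le> sq (x - l - sc c k)" by (simp add: algebra_simps)
  qed
  then show ?thesis using lK by blast
qed

end

section \<open>Representations and vectors near the fixed space\<close>

locale semi_hilbert_rep = semi_hilbert V sc ip + group G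
  for V :: "'v::ab_group_add set" and sc ip and G :: "('g, 'a) monoid_scheme" (structure) +
  fixes U :: "'g \<Rightarrow> 'v \<Rightarrow> 'v"
  assumes U_mem: "g \<in> carrier G \<Longrightarrow> x \<in> V \<Longrightarrow> U g x \<in> V"
    and U_add: "g \<in> carrier G \<Longrightarrow> x \<in> V \<Longrightarrow> y \<in> V \<Longrightarrow> U g (x + y) = U g x + U g y"
    and U_sc: "g \<in> carrier G \<Longrightarrow> x \<in> V \<Longrightarrow> U g (sc c x) = sc c (U g x)"
    and U_ip: "g \<in> carrier G \<Longrightarrow> x \<in> V \<Longrightarrow> y \<in> V \<Longrightarrow> ip (U g x) (U g y) = ip x y"
    and U_mult: "g \<in> carrier G \<Longrightarrow> h \<in> carrier G \<Longrightarrow> x \<in> V \<Longrightarrow> U (g \<otimes> h) x = U g (U h x)"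
    and U_one: "x \<in> V \<Longrightarrow> U \<one> x = x"
begin

lemma U_diff: 
  assumes "g \<in> carrier G" "x \<in> V" "y \<in> V"
  shows "U g (x - y) = U g x - U g y"
  using U_add[OF assms(1) diff_mem[OF assms(2,3)] assms(3)] by (simp add: algebra_simps)

lemma sq_U: "g \<in> carrier G \<Longrightarrow> x \<in> V \<Longrightarrow> sq (U g x) = sq x"
  by (simp add: sq_def U_ip)

lemma U_inv_cancel:
  assumes "g \<in> carrier G" "x \<in> V"
  shows "U g (U (inv g) x) = x" "U (inv g) (U g x) = x"
  using U_mult[of g "inv g" x] U_mult[of "inv g" g x] assms by (simp_all add: U_one)

lemma ip_U_left:
  assumes "g \<in> carrier G" "x \<in> V" "y \<in> V"
  shows "ip (U g x) y = ip x (U (inv g) y)"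
proof -
  have "ip (U g x) (U g (U (inv g) y)) = ip x (U (inv g) y)"
    using assms by (intro U_ip U_mem) auto
  then show ?thesis using U_inv_cancel(1)[OF assms(1,3)] by simp
qed

lemma ip_U_right:
  assumes "g \<in> carrier G" "x \<in> V" "y \<in> V"
  shows "ip x (U g y) = ip (U (inv g) x) y"
  using ip_U_left[of "inv g" x y] assms by simp

definition fixed :: "'g set \<Rightarrow> 'v set" where
  "fixed N = {x \<in> V. \<forall>g\<in>N. sq (U g x - x) = 0}"

text \<open>\<open>U g\<close> is isometric, so \<open>U g - 1\<close> at most doubles the seminorm,
  whence the factor 4; the displacement of \<open>u n\<close> is a null vector and drops
  out.\<close>

lemma fixed_closed:
  assumes N: "N \<subseteq> carrier G" and u: "range u \<subseteq> fixed N" and l: "l \<in> V"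
    and lim: "(\<lambda>n. sq (u n - l)) \<longlonglongrightarrow> 0"
  shows "l \<in> fixed N"
proof -
  have "sq (U g l - l) = 0" if g: "g \<in> N" for g
  proof -
    have gG: "g \<in> carrier G" using g N by auto
    have un: "u n \<in> V" "sq (U g (u n) - u n) = 0" for n
      using u g unfolding fixed_def by auto
    have "sq (U g l - l) \<le> 4 * sq (u n - l)" for n
    proof -
      define a where "a = U g (u n) - u n"
      define b where "b = (u n - l) - (U g (u n) - U g l)"
      have aV: "a \<in> V" unfolding a_def using un gG by (intro diff_mem U_mem)
      have d: "u n - l \<in> V" using un l by (intro diff_mem)
      have b': "b = (u n - l) - U g (u n - l)" unfolding b_def using U_diff[OF gG un(1) l] by simp
      have bV: "b \<in> V" unfolding b' by (rule diff_mem[OF d U_mem[OF gG d]])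
      have "U g l - l = b + a" unfolding a_def b_def by simp
      then have "sq (U g l - l) = sq b + sq a + 2 * Re (ip b a)" using sq_add[OF bV aV] by simp
      also have "\<dots> = sq b" using un(2)[of n] ip_eq_0(2)[OF aV bV] by (simp add: a_def)
      also have "\<dots> \<le> 2 * sq (u n - l) + 2 * sq (U g (u n - l))"
        unfolding b' using d gG by (intro sq_diff_le U_mem)
      finally show ?thesis using sq_U[OF gG d] by simp
    qed
    then have "sq (U g l - l) \<le> 4 * 0"
      by (intro LIMSEQ_le_const[OF tendsto_mult_left[OF lim]]) auto
    moreover have "0 \<le> sq (U g l - l)" using gG l by (intro sq_nonneg diff_mem U_mem)
    ultimately show ?thesis by simp
  qed
  then show ?thesis using l by (simp add: fixed_def)
qed

lemma fixed_add:
  assumes N: "N \<subseteq> carrier G" and x: "x \<in> fixed N" and y: "y \<in> fixed N"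
  shows "x + y \<in> fixed N"
proof -
  have xy: "x \<in> V" "y \<in> V" using x y by (auto simp: fixed_def)
  have "sq (U g (x + y) - (x + y)) = 0" if g: "g \<in> N" for g
  proof -
    have gG: "g \<in> carrier G" using g N by auto
    have m: "U g x - x \<in> V" "U g y - y \<in> V" using xy gG by (auto intro: diff_mem U_mem)
    have "U g (x + y) - (x + y) = (U g x - x) + (U g y - y)" using U_add[OF gG xy] by simp
    then have "sq (U g (x + y) - (x + y)) \<le> 2 * sq (U g x - x) + 2 * sq (U g y - y)"
      using sq_add_le[OF m] by (simp only:)
    also have "\<dots> = 0" using x y g by (simp add: fixed_def)
    finally show ?thesis using sq_nonneg[of "U g (x + y) - (x + y)"] xy gG
      by (auto intro: antisym diff_mem U_mem add_mem)
  qed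
  then show ?thesis using xy by (simp add: fixed_def add_mem)
qed

text \<open>Distributivity of \<open>sc\<close> is not among the axioms, so the scaling of a
  difference is computed by expanding the form.\<close>

lemma sc_diff_null:
  assumes "x \<in> V" "y \<in> V" "sq (x - y) = 0"
  shows "sq (sc c x - sc c y) = 0"
proof -
  have "sq (sc c x - sc c y) = (cmod c)\<^sup>2 * sq (x - y)"
  proof -
    have "Re (ip (sc c x) (sc c y)) = (cmod c)\<^sup>2 * Re (ip x y)"
    proof -
      have "ip (sc c x) (sc c y) = (c * cnj c) * ip x y"
        using assms by (simp add: ip_sc_left ip_sc_right sc_mem)
      also have "c * cnj c = complex_of_real ((cmod c)\<^sup>2)" by (rule complex_norm_square[symmetric])
      finally show ?thesis by (simp del: of_real_power)
    qed
    then show ?thesis using assms(1,2) by (simp add: sq_diff sc_mem sq_sc algebra_simps)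
  qed
  then show ?thesis using assms by simp
qed

lemma fixed_sc:
  assumes N: "N \<subseteq> carrier G" and x: "x \<in> fixed N"
  shows "sc c x \<in> fixed N"
proof -
  have xV: "x \<in> V" using x by (auto simp: fixed_def)
  have "sq (U g (sc c x) - sc c x) = 0" if g: "g \<in> N" for g
  proof -
    have gG: "g \<in> carrier G" using g N by auto
    show ?thesis using x g xV gG sc_diff_null[OF U_mem[OF gG xV] xV]
      by (simp add: fixed_def U_sc)
  qed
  then show ?thesis using xV by (simp add: fixed_def sc_mem)
qed

lemma U_0: "g \<in> carrier G \<Longrightarrow> U g 0 = 0"
  using U_add[of g 0 0] zero_mem by simp

lemma fixed_zero:
  assumes N: "N \<subseteq> carrier G" shows "0 \<in> fixed N"
  using N by (auto simp: fixed_def zero_mem U_0 sq_zero)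

text \<open>\<open>h g = g (inv g h g)\<close>, and the conjugate lies in \<open>N\<close>. This is
  how normality acts on the Hilbert space side: vectors orthogonal to the fixed space stay so under
  all of \<open>G\<close>.\<close>

lemma fixed_normal:
  assumes nor: "normal N G" and g: "g \<in> carrier G" and x: "x \<in> fixed N"
  shows "U g x \<in> fixed N"
proof -
  have xV: "x \<in> V" using x by (auto simp: fixed_def)
  have "sq (U h (U g x) - U g x) = 0" if h: "h \<in> N" for h
  proof -
    have N: "N \<subseteq> carrier G" using nor normal_imp_subgroup subgroup.subset by blast
    then have hG: "h \<in> carrier G" using h by auto
    define k where "k = inv g \<otimes> h \<otimes> g"
    have k: "k \<in> N" unfolding k_def using normal.inv_op_closed1[OF nor g h] .
    then have kG: "k \<in> carrier G" using N by auto
    have "h \<otimes> g = g \<otimes> k" unfolding k_def using g hG by (simp add: m_assoc[symmetric])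
    then have "U h (U g x) = U g (U k x)"
      using U_mult[OF hG g xV] U_mult[OF g kG xV] by simp
    then have "U h (U g x) - U g x = U g (U k x - x)"
      using U_diff[OF g U_mem[OF kG xV] xV] by simp
    then show ?thesis using sq_U[OF g, of "U k x - x"] xV kG x k
      by (simp add: U_mem diff_mem fixed_def)
  qed
  then show ?thesis using xV g by (simp add: fixed_def U_mem)
qed

end

text \<open>A countable family \<open>e\<close> of vectors embeds its closed span, written here as a double
  orthogonal complement, into \<^typ>\<open>nat \<Rightarrow> complex\<close> through the coefficients against \<open>e\<close>; this is how
  representations are moved to the carrier type over which relative property (T) quantifies.\<close>

locale semi_hilbert_subrep = semi_hilbert_rep V sc ip G U
  for V :: "'v::ab_group_add set" and sc ip and G :: "('g, 'a) monoid_scheme" (structure) and U +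
  fixes e :: "nat \<Rightarrow> 'v"
  assumes e_mem: "e k \<in> V"
    and U_e: "g \<in> carrier G \<Longrightarrow> \<exists>j. U g (e k) = e j"
begin

definition perp :: "'v set" where "perp = {h \<in> V. \<forall>k. ip h (e k) = 0}"
definition clspan :: "'v set" where "clspan = {f \<in> V. \<forall>h\<in>perp. ip f h = 0}"
definition J :: "'v \<Rightarrow> nat \<Rightarrow> complex" where "J f = (\<lambda>k. ip f (e k))"
text \<open>\<open>J\<close> identifies vectors that differ by a null vector. The inner product and
  the action are transported through one chosen preimage; they do not depend on it, because null
  vectors are orthogonal to everything and \<open>U g\<close> is isometric.\<close>

definition rp :: "(nat \<Rightarrow> complex) \<Rightarrow> 'v" where "rp = inv_into clspan J"

definition space_H :: "(nat \<Rightarrow> complex) inner_module" where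
  "space_H = \<lparr>carrier = J ` clspan, mult = (\<lambda>u v. u), one = (\<lambda>_. 0), zero = (\<lambda>_. 0), 
     add = (\<lambda>u v k. u k + v k), smult = (\<lambda>c u k. c * u k),
     iprod = (\<lambda>u v. ip (rp u) (rp v))\<rparr>"

definition rep_H :: "'g \<Rightarrow> (nat \<Rightarrow> complex) \<Rightarrow> (nat \<Rightarrow> complex)" where
  "rep_H g u = J (U g (rp u))"

lemma clspan_V: "x \<in> clspan \<Longrightarrow> x \<in> V" by (simp add: clspan_def)

lemma clspan_closures:
  "0 \<in> clspan" "x \<in> clspan \<Longrightarrow> y \<in> clspan \<Longrightarrow> x + y \<in> clspan" 
  "x \<in> clspan \<Longrightarrow> y \<in> clspan \<Longrightarrow> x - y \<in> clspan" "x \<in> clspan \<Longrightarrow> sc c x \<in> clspan"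
  "x \<in> clspan \<Longrightarrow> - x \<in> clspan"
  unfolding clspan_def perp_def
  by (auto simp: zero_mem add_mem diff_mem sc_mem ip_zero_left ip_add_left ip_diff_left ip_sc_left uminus_mem ip_uminus_left)

lemma e_clspan: "e k \<in> clspan"
proof -
  have "ip (e k) h = 0" if "h \<in> perp" for h
    using that e_mem ip_cnj[of "e k" h] by (auto simp: perp_def)
  then show ?thesis by (simp add: clspan_def e_mem)
qed

lemma clspan_closed:
  assumes u: "range u \<subseteq> clspan" and l: "l \<in> V" and lim: "(\<lambda>n. sq (u n - l)) \<longlonglongrightarrow> 0"
  shows "l \<in> clspan"
proof -
  have "ip l h = 0" if h: "h \<in> perp" for h
  proof -
    have "(\<lambda>n. ip (u n) h) \<longlonglongrightarrow> ip l h"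
      using u l lim h by (intro LIMSEQ_ip) (auto simp: perp_def clspan_def)
    moreover have "ip (u n) h = 0" for n using u h by (auto simp: clspan_def)
    ultimately show ?thesis by (simp add: LIMSEQ_const_iff)
  qed
  then show ?thesis using l by (simp add: clspan_def)
qed

lemma U_perp: 
  assumes g: "g \<in> carrier G" and h: "h \<in> perp"
  shows "U g h \<in> perp"
proof -
  have hV: "h \<in> V" using h by (simp add: perp_def)
  have "ip (U g h) (e k) = 0" for k
  proof -
    obtain j where "U (inv g) (e k) = e j" using U_e[of "inv g" k] g by auto
    then show ?thesis using ip_U_left[OF g hV e_mem, of k] h by (simp add: perp_def)
  qed
  then show ?thesis using g hV by (simp add: perp_def U_mem)
qed

lemma U_clspan:
  assumes g: "g \<in> carrier G" and f: "f \<in> clspan"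
  shows "U g f \<in> clspan"
proof -
  have fV: "f \<in> V" using f by (simp add: clspan_def)
  have "ip (U g f) h = 0" if h: "h \<in> perp" for h
  proof -
    have "ip (U g f) h = ip f (U (inv g) h)" using h by (intro ip_U_left g fV) (simp add: perp_def)
    also have "\<dots> = 0" using f U_perp[of "inv g" h] g h by (simp add: clspan_def)
    finally show ?thesis .
  qed
  then show ?thesis using g fV by (simp add: clspan_def U_mem)
qed

text \<open>Such an \<open>f\<close> lies in both \<open>clspan\<close> and \<open>perp\<close>, so
  it is orthogonal to itself. Hence the coefficients determine a vector of \<open>clspan\<close> up
  to a null vector.\<close>

lemma clspan_perp_null:
  assumes "f \<in> clspan" "\<And>k. ip f (e k) = 0" shows "sq f = 0"
proof -
  have "f \<in> perp" using assms by (simp add: perp_def clspan_def)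
  then have "ip f f = 0" using assms(1) by (simp add: clspan_def)
  then show ?thesis by (simp add: sq_def)
qed

lemma J_eq_iff:
  assumes "x \<in> clspan" "y \<in> clspan"
  shows "J x = J y \<longleftrightarrow> sq (x - y) = 0"
proof
  assume eq: "J x = J y"
  have "ip (x - y) (e k) = 0" for k
    using assms e_mem fun_cong[OF eq, of k] by (simp add: J_def ip_diff_left clspan_V)
  then show "sq (x - y) = 0" using clspan_closures(3)[OF assms] by (rule clspan_perp_null[rotated])
next
  assume z: "sq (x - y) = 0"
  have "ip x (e k) = ip y (e k)" for k
    using ip_eq_0(1)[OF diff_mem e_mem z, of k] assms e_mem by (simp add: ip_diff_left clspan_V)
  then show "J x = J y" by (simp add: J_def)
qed

lemma rp:
  assumes x: "x \<in> clspan"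
  shows "rp (J x) \<in> clspan" "J (rp (J x)) = J x" "sq (rp (J x) - x) = 0"
proof -
  show a: "rp (J x) \<in> clspan" unfolding rp_def using x by (auto intro: inv_into_into)
  show b: "J (rp (J x)) = J x" unfolding rp_def using x by (auto intro: f_inv_into_f)
  show "sq (rp (J x) - x) = 0" using J_eq_iff[OF a x] b by simp
qed

lemma ip_cong:
  assumes "x \<in> V" "y \<in> V" "x' \<in> V" "y' \<in> V" "sq (x' - x) = 0" "sq (y' - y) = 0"
  shows "ip x' y' = ip x y"
proof -
  have "ip (x' - x) y' = 0" using assms by (intro ip_eq_0 diff_mem)
  moreover have "ip x (y' - y) = 0" using assms by (intro ip_eq_0 diff_mem)
  ultimately show ?thesis using assms by (simp add: ip_diff_left ip_diff_right)
qed

lemma iprod_H: "x \<in> clspan \<Longrightarrow> y \<in> clspan \<Longrightarrow> iprod space_H (J x) (J y) = ip x y"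
  unfolding space_H_def by (simp add: ip_cong rp clspan_V)

lemma rep_H_J: 
  assumes g: "g \<in> carrier G" and x: "x \<in> clspan"
  shows "rep_H g (J x) = J (U g x)"
proof -
  have "sq (U g (rp (J x)) - U g x) = 0"
    using U_diff[OF g clspan_V clspan_V, OF rp(1) x, OF x] sq_U[OF g diff_mem, OF clspan_V clspan_V, OF rp(1) x, OF x] rp(3)[OF x]
    by simp
  then show ?thesis unfolding rep_H_def using J_eq_iff[OF U_clspan U_clspan, OF g rp(1)[OF x] g x] by simp
qed

lemma J_add: "x \<in> clspan \<Longrightarrow> y \<in> clspan \<Longrightarrow> J (x + y) = (\<lambda>k. J x k + J y k)"
  by (simp add: J_def ip_add_left clspan_V e_mem)

lemma J_diff: "x \<in> clspan \<Longrightarrow> y \<in> clspan \<Longrightarrow> J (x - y) = (\<lambda>k. J x k - J y k)"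
  by (simp add: J_def ip_diff_left clspan_V e_mem)

lemma J_sc: "x \<in> clspan \<Longrightarrow> J (sc c x) = (\<lambda>k. c * J x k)"
  by (simp add: J_def ip_sc_left clspan_V e_mem)

lemma J_uminus: "x \<in> clspan \<Longrightarrow> J (- x) = (\<lambda>k. - J x k)"
  by (simp add: J_def ip_uminus_left clspan_V e_mem)

lemma J_0: "J 0 = (\<lambda>k. 0)"
  by (simp add: J_def ip_zero_left e_mem)

lemma abelian_group_H: "abelian_group space_H"
proof (rule abelian_groupI)
  fix u v assume "u \<in> carrier space_H" "v \<in> carrier space_H"
  then show "u \<oplus>\<^bsub>space_H\<^esub> v \<in> carrier space_H"
    by (auto simp: space_H_def J_add[symmetric] clspan_closures)
next
  fix u assume "u \<in> carrier space_H"
  then obtain x where x: "x \<in> clspan" "u = J x" by (auto simp: space_H_def)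
  have "J (- x) \<in> carrier space_H" using x by (auto simp: space_H_def intro!: clspan_closures)
  moreover have "J (- x) \<oplus>\<^bsub>space_H\<^esub> u = \<zero>\<^bsub>space_H\<^esub>"
    unfolding x(2) J_uminus[OF x(1)] by (simp add: space_H_def)
  ultimately show "\<exists>y\<in>carrier space_H. y \<oplus>\<^bsub>space_H\<^esub> u = \<zero>\<^bsub>space_H\<^esub>" by blast
next
  show "\<zero>\<^bsub>space_H\<^esub> \<in> carrier space_H"
    using clspan_closures(1) by (auto simp: space_H_def J_0[symmetric])
qed (auto simp: space_H_def algebra_simps)

lemma minus_H: 
  assumes "x \<in> clspan" "y \<in> clspan"
  shows "J x \<ominus>\<^bsub>space_H\<^esub> J y = J (x - y)"
proof -
  interpret A: abelian_group space_H by (rule abelian_group_H)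
  have c: "J (- y) \<in> J ` clspan" by (intro imageI clspan_closures assms)
  have m: "J (- y) = \<ominus>\<^bsub>space_H\<^esub> J y"
    by (rule A.minus_equality[symmetric])
      (use assms c in \<open>auto simp: space_H_def J_uminus\<close>)
  show ?thesis unfolding a_minus_def m[symmetric] 
    using assms clspan_closures by (simp add: J_diff J_uminus) (simp add: space_H_def)
qed

text \<open>Passing to coefficients collapses the null vectors, which makes the form definite. For
  completeness a Cauchy sequence is lifted to \<open>V\<close>, and its limit stays in the closed
  set \<open>clspan\<close>.\<close>

lemma hilbert_H: "complex_hilbert_space space_H"
proof -
  have m: "Module.module complex_ring space_H"
    by (rule Module.moduleI[OF cring_complex_ring abelian_group_H])
      (auto simp: space_H_def complex_ring_def algebra_simps J_sc[symmetric] clspan_closures)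
  show ?thesis
  proof (intro complex_hilbert_space.intro m complex_hilbert_space_axioms.intro)
    fix u v w assume "u \<in> carrier space_H" "v \<in> carrier space_H" "w \<in> carrier space_H"
    then obtain x y z where x: "x \<in> clspan" "u = J x" and y: "y \<in> clspan" "v = J y" 
      and z: "z \<in> clspan" "w = J z" by (auto simp: space_H_def)
    have a: "u \<oplus>\<^bsub>space_H\<^esub> v = J (x + y)" using x y by (simp add: J_add) (simp add: space_H_def)
    show "iprod space_H (u \<oplus>\<^bsub>space_H\<^esub> v) w = iprod space_H u w + iprod space_H v w"
      unfolding a using x y z by (simp add: iprod_H clspan_closures ip_add_left clspan_V)
  next
    fix c u v assume "u \<in> carrier space_H" "v \<in> carrier space_H" 
    then obtain x y where x: "x \<in> clspan" "u = J x" and y: "y \<in> clspan" "v = J y" 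
      by (auto simp: space_H_def)
    have a: "c \<odot>\<^bsub>space_H\<^esub> u = J (sc c x)" using x by (simp add: J_sc) (simp add: space_H_def)
    show "iprod space_H (c \<odot>\<^bsub>space_H\<^esub> u) v = c * iprod space_H u v"
      unfolding a using x y by (simp add: iprod_H clspan_closures ip_sc_left clspan_V)
  next
    fix u v assume "u \<in> carrier space_H" "v \<in> carrier space_H" 
    then obtain x y where x: "x \<in> clspan" "u = J x" and y: "y \<in> clspan" "v = J y" 
      by (auto simp: space_H_def)
    show "iprod space_H u v = cnj (iprod space_H v u)"
      using x y ip_cnj[of x y] by (simp add: iprod_H clspan_V)
  next
    fix u assume u: "u \<in> carrier space_H" "u \<noteq> \<zero>\<^bsub>space_H\<^esub>"
    then obtain x where x: "x \<in> clspan" "u = J x" by (auto simp: space_H_def)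
    have "J x \<noteq> J 0" using x u by (simp add: J_0) (simp add: space_H_def)
    then have "sq x \<noteq> 0" using J_eq_iff[OF x(1) clspan_closures(1)] by simp
    then have "sq x > 0" using sq_nonneg[OF clspan_V[OF x(1)]] by simp
    then show "Re (iprod space_H u u) > 0" using x by (simp add: iprod_H sq_def)
  next
    fix u :: "nat \<Rightarrow> nat \<Rightarrow> complex"
    assume u: "range u \<subseteq> carrier space_H" and c: "\<And>e. e > 0 \<Longrightarrow> \<exists>N. \<forall>m\<ge>N. \<forall>n\<ge>N.
        sqrt (Re (iprod space_H (u m \<ominus>\<^bsub>space_H\<^esub> u n) (u m \<ominus>\<^bsub>space_H\<^esub> u n))) < e"
    have "\<exists>x. x \<in> clspan \<and> u n = J x" for n using u by (auto simp: space_H_def)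
    then obtain x where x: "\<And>n. x n \<in> clspan" "\<And>n. u n = J (x n)" by metis
    have sqd: "Re (iprod space_H (u n \<ominus>\<^bsub>space_H\<^esub> J y) (u n \<ominus>\<^bsub>space_H\<^esub> J y)) = sq (x n - y)" 
      if "y \<in> clspan" for n y
      using x that by (simp add: minus_H iprod_H clspan_closures sq_def)
    have "\<exists>N. \<forall>m\<ge>N. \<forall>n\<ge>N. Re (ip (x m - x n) (x m - x n)) < e" if e: "e > 0" for e
    proof -
      obtain N where N: "\<And>m n. m \<ge> N \<Longrightarrow> n \<ge> N \<Longrightarrow> 
        sqrt (Re (iprod space_H (u m \<ominus>\<^bsub>space_H\<^esub> u n) (u m \<ominus>\<^bsub>space_H\<^esub> u n))) < sqrt e"
        using c[of "sqrt e"] e by auto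
      have "sq (x m - x n) < e" if "m \<ge> N" "n \<ge> N" for m n
        using N[OF that] sqd[OF x(1), of m n] x(2)[of n] by simp
      then show ?thesis unfolding sq_def by blast
    qed
    then obtain l where l: "l \<in> V" "(\<lambda>n. sq (x n - l)) \<longlonglongrightarrow> 0"
      using complete_V[of x] x(1) clspan_V unfolding sq_def by blast
    have lc: "l \<in> clspan" using x(1) by (intro clspan_closed[OF _ l]) auto
    have "(\<lambda>n. sqrt (sq (x n - l))) \<longlonglongrightarrow> sqrt 0" by (intro tendsto_intros l)
    then have "(\<lambda>n. sqrt (Re (iprod space_H (u n \<ominus>\<^bsub>space_H\<^esub> J l) (u n \<ominus>\<^bsub>space_H\<^esub> J l)))) \<longlonglongrightarrow> 0"
      unfolding sqd[OF lc] by simp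
    then show "\<exists>l\<in>carrier space_H. (\<lambda>n. sqrt (Re (iprod space_H
        (u n \<ominus>\<^bsub>space_H\<^esub> l) (u n \<ominus>\<^bsub>space_H\<^esub> l)))) \<longlonglongrightarrow> 0"
      using lc by (auto simp: space_H_def)
  qed
qed

lemma unitary_representation_H: "unitary_representation G space_H rep_H"
proof -
  have unit: "unitary_operator space_H (rep_H g)" if g: "g \<in> carrier G" for g
    unfolding unitary_operator_def
  proof (intro conjI ballI allI)
    have carr: "carrier space_H = J ` clspan" by (simp add: space_H_def)
    have gi: "inv g \<in> carrier G" using g by simp
    show "bij_betw (rep_H g) (carrier space_H) (carrier space_H)"
      unfolding carr
      by (rule bij_betw_byWitness[where f' = "rep_H (inv g)"])
        (use g gi in \<open>auto simp: rep_H_J U_clspan U_inv_cancel clspan_V\<close>)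
  next
    fix u v assume "u \<in> carrier space_H" "v \<in> carrier space_H" 
    then obtain x y where x: "x \<in> clspan" "u = J x" and y: "y \<in> clspan" "v = J y" 
      by (auto simp: space_H_def)
    have a: "J z \<oplus>\<^bsub>space_H\<^esub> J z' = J (z + z')" if "z \<in> clspan" "z' \<in> clspan" for z z'
      using that by (simp add: J_add) (simp add: space_H_def)
    show "rep_H g (u \<oplus>\<^bsub>space_H\<^esub> v) = rep_H g u \<oplus>\<^bsub>space_H\<^esub> rep_H g v"
      using x y g by (simp add: a rep_H_J clspan_closures U_clspan U_add clspan_V)
    show "iprod space_H (rep_H g u) (rep_H g v) = iprod space_H u v"
      using x y g by (simp add: rep_H_J iprod_H U_clspan U_ip clspan_V)
  next
    fix c u assume "u \<in> carrier space_H" 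
    then obtain x where x: "x \<in> clspan" "u = J x" by (auto simp: space_H_def)
    have a: "c \<odot>\<^bsub>space_H\<^esub> J z = J (sc c z)" if "z \<in> clspan" for z
      using that by (simp add: J_sc) (simp add: space_H_def)
    show "rep_H g (c \<odot>\<^bsub>space_H\<^esub> u) = c \<odot>\<^bsub>space_H\<^esub> rep_H g u"
      using x g by (simp add: a rep_H_J clspan_closures U_clspan U_sc clspan_V)
  qed
  show ?thesis unfolding unitary_representation_def
  proof (intro conjI ballI)
    fix u assume "u \<in> carrier space_H" 
    then obtain x where x: "x \<in> clspan" "u = J x" by (auto simp: space_H_def)
    show "rep_H \<one> u = u" using x by (simp add: rep_H_J U_one clspan_V)
    fix g h assume "g \<in> carrier G" "h \<in> carrier G"
    then show "rep_H (g \<otimes> h) u = rep_H g (rep_H h u)"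
      using x by (simp add: rep_H_J U_mult clspan_V U_clspan)
  qed (use hilbert_H unit in auto)
qed

end

section \<open>Applying relative property (T) to almost invariant vectors\<close>

context semi_hilbert_rep
begin

text \<open>Apply the property to the closed span of the translates of \<open>\<xi> n - P (\<xi> n)\<close>, \<open>P\<close> being the
  projection onto the \<open>N\<close>-fixed vectors: this span is orthogonal to the \<open>N\<close>-fixed vectors.\<close>

lemma relative_property_T_near_fixed:
  fixes \<xi> :: "nat \<Rightarrow> 'v"
  assumes T: "relative_property_T G N" and nor: "normal N G" and cnt: "countable (carrier G)"
    and \<xi>: "\<And>n. \<xi> n \<in> V" and ai: "\<And>g. g \<in> carrier G \<Longrightarrow> (\<lambda>n. sq (U g (\<xi> n) - \<xi> n)) \<longlonglongrightarrow> 0"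
    and \<delta>: "\<delta> > 0"
  shows "\<exists>n. \<exists>\<eta>\<in>fixed N. sq (\<xi> n - \<eta>) < \<delta>"
proof (rule ccontr)
  assume "\<not> ?thesis"
  then have far: "\<delta> \<le> sq (\<xi> n - \<eta>)" if "\<eta> \<in> fixed N" for n \<eta> using \<open>\<not> _\<close> that by (meson leI)
  have N: "N \<subseteq> carrier G" using nor normal_imp_subgroup subgroup.subset by blast
  have "\<exists>p\<in>fixed N. \<forall>k\<in>fixed N. ip (\<xi> n - p) k = 0" for n
    by (rule projection_exists[OF _ fixed_zero[OF N] fixed_add[OF N] fixed_sc[OF N] fixed_closed[OF N] \<xi>])
      (auto simp: fixed_def)
  then obtain P where P: "\<And>n. P n \<in> fixed N" "\<And>n k. k \<in> fixed N \<Longrightarrow> ip (\<xi> n - P n) k = 0" 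
    by metis
  define \<zeta> where "\<zeta> n = \<xi> n - P n" for n
  have PV: "P n \<in> V" for n using P(1)[of n] by (simp add: fixed_def)
  have \<zeta>V: "\<zeta> n \<in> V" for n unfolding \<zeta>_def using \<xi> PV by (intro diff_mem)
  have \<zeta>big: "\<delta> \<le> sq (\<zeta> n)" for n unfolding \<zeta>_def by (intro far P)
  have \<zeta>perp: "ip k (\<zeta> n) = 0" if "k \<in> fixed N" for k n
    using P(2)[OF that, of n] ip_cnj[of k "\<zeta> n"] \<zeta>V that by (simp add: \<zeta>_def[symmetric] fixed_def)
  \<comment> \<open>The displacement of \<open>\<xi> n\<close> is the orthogonal sum of those of
    \<open>P n\<close> and \<open>\<zeta> n\<close>: translates of \<open>P n\<close> are again
    fixed vectors, hence orthogonal to all translates of \<open>\<zeta> n\<close>. So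
    \<open>\<zeta> n\<close> inherits the almost invariance, while its length stays bounded
    below.\<close>
  have \<zeta>ai: "sq (U g (\<zeta> n) - \<zeta> n) \<le> sq (U g (\<xi> n) - \<xi> n)" if g: "g \<in> carrier G" for g n
  proof -
    define a where "a = U g (\<zeta> n) - \<zeta> n"
    define b where "b = U g (P n) - P n"
    have gi: "inv g \<in> carrier G" using g by simp
    have aV: "a \<in> V" and bV: "b \<in> V" unfolding a_def b_def using g \<zeta>V PV by (auto intro: diff_mem U_mem)
    have k: "ip (U h (P n)) (U h' (\<zeta> n)) = 0" if h: "h \<in> carrier G" "h' \<in> carrier G" for h h'
    proof -
      have "ip (U h (P n)) (U h' (\<zeta> n)) = ip (U (inv h') (U h (P n))) (\<zeta> n)"
        using h PV \<zeta>V by (intro ip_U_right U_mem)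
      then show ?thesis using h by (simp add: \<zeta>perp fixed_normal nor P)
    qed
    have k': "ip (U h (P n)) (\<zeta> n) = 0" "ip (P n) (U h (\<zeta> n)) = 0" if h: "h \<in> carrier G" for h
      using k[OF h one_closed] k[OF one_closed h] \<zeta>V PV by (simp_all add: U_one)
    have "ip b a = 0" unfolding a_def b_def 
      using g \<zeta>V PV k[OF g g] k'[OF g] \<zeta>perp[OF P(1)]
      by (simp add: ip_diff_left ip_diff_right U_mem diff_mem)
    moreover have "U g (\<xi> n) - \<xi> n = b + a"
    proof -
      have "U g (\<zeta> n) = U g (\<xi> n) - U g (P n)" unfolding \<zeta>_def using g \<xi> PV by (intro U_diff)
      then show ?thesis unfolding a_def b_def by (simp add: \<zeta>_def)
    qed
    ultimately show ?thesis using sq_add[OF bV aV] sq_nonneg[OF bV] by (simp add: a_def)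
  qed
  define en where "en = from_nat_into (carrier G)"
  have ne: "carrier G \<noteq> {}" by auto
  \<comment> \<open>All translates by all of \<open>G\<close> are listed, through a pairing of
    indices, so that the action maps the list into itself.\<close>
  define e where "e k = (case prod_decode k of (i, n) \<Rightarrow> U (en i) (\<zeta> n))" for k
  have en: "en i \<in> carrier G" for i unfolding en_def by (rule from_nat_into[OF ne])
  have e_surj: "\<exists>k. e k = U g (\<zeta> n)" if g: "g \<in> carrier G" for g n
  proof -
    obtain i where "en i = g" unfolding en_def using g cnt by (metis from_nat_into_surj)
    then have "e (prod_encode (i, n)) = U g (\<zeta> n)" by (simp add: e_def)
    then show ?thesis by blast
  qed
  interpret S: semi_hilbert_subrep V sc ip G U e
  proof
    show "e k \<in> V" for k using en \<zeta>V by (auto simp: e_def split: prod.split intro: U_mem)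
    fix g k assume g: "g \<in> carrier G"
    obtain i n where k: "prod_decode k = (i, n)" by fastforce
    have "U g (e k) = U (g \<otimes> en i) (\<zeta> n)" using g en \<zeta>V by (simp add: e_def k U_mult)
    moreover obtain j where "e j = U (g \<otimes> en i) (\<zeta> n)"
      using e_surj[OF m_closed[OF g en], of i n] by blast
    ultimately show "\<exists>j. U g (e k) = e j" by (intro exI[of _ j]) simp
  qed
  have \<zeta>c: "\<zeta> n \<in> S.clspan" for n
  proof -
    obtain k where "e k = U \<one> (\<zeta> n)" using e_surj[OF one_closed, of n] by blast
    then show ?thesis using S.e_clspan[of k] U_one[OF \<zeta>V] by simp
  qed
  have "weakly_contains G S.space_H S.rep_H complex_line trivial_rep"
    unfolding weakly_contains_def
  proof (intro ballI allI impI)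
    fix z :: complex and F and d :: real
    assume F: "finite F \<and> F \<subseteq> carrier G" and d: "d > 0"
    define r where "r = (cmod z)\<^sup>2"
    \<comment> \<open>\<open>r + 1\<close> in place of \<open>r\<close> covers \<open>z = 0\<close>
      and makes the final estimate \<open>r * d / (r + 1) < d\<close> strict.\<close>
    have ev: "\<forall>\<^sub>F n in sequentially. \<forall>g\<in>F. sq (U g (\<xi> n) - \<xi> n) < \<delta> * (d / (r + 1))\<^sup>2"
    proof -
      have "\<delta> * (d / (r + 1))\<^sup>2 > 0" using \<delta> d by (auto simp: r_def add_nonneg_eq_0_iff)
      then show ?thesis using F
        by (intro eventually_ball_finite) (auto intro: order_tendstoD(2)[OF ai])
    qed
    then obtain n where n: "\<And>g. g \<in> F \<Longrightarrow> sq (U g (\<xi> n) - \<xi> n) < \<delta> * (d / (r + 1))\<^sup>2"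
      using eventually_happens[OF ev] by auto
    define s where "s = sq (\<zeta> n)"
    have s: "s \<ge> \<delta>" "s > 0" using \<zeta>big[of n] \<delta> by (auto simp: s_def)
    \<comment> \<open>This scales the vector to squared norm \<open>r\<close>, the constant value of
      the coefficient of \<open>z\<close> in the trivial representation; a single coefficient then
      suffices.\<close>
    define c where "c = complex_of_real (cmod z / sqrt s)"
    define \<eta> where "\<eta> = sc c (\<zeta> n)"
    have \<eta>: "\<eta> \<in> S.clspan" unfolding \<eta>_def by (intro S.clspan_closures \<zeta>c)
    have "cmod (iprod complex_line (trivial_rep g z) z -
         (\<Sum>v\<leftarrow>[S.J \<eta>]. iprod S.space_H (S.rep_H g v) v)) < d" if g: "g \<in> F" for g
    proof -
      have gG: "g \<in> carrier G" using g F by auto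
      have cc: "c * cnj c = complex_of_real (r / s)"
      proof -
        have "c * cnj c = complex_of_real ((cmod c)\<^sup>2)" by (rule complex_norm_square[symmetric])
        also have "(cmod c)\<^sup>2 = r / s" using s by (simp add: c_def r_def power_divide norm_divide)
        finally show ?thesis .
      qed
      have "iprod S.space_H (S.rep_H g (S.J \<eta>)) (S.J \<eta>) = ip (U g \<eta>) \<eta>"
        using gG \<eta> by (simp add: S.rep_H_J S.iprod_H S.U_clspan)
      also have "\<dots> = (c * cnj c) * ip (U g (\<zeta> n)) (\<zeta> n)"
        using gG \<zeta>V by (simp add: \<eta>_def U_sc ip_sc_left ip_sc_right U_mem sc_mem)
      also have "\<dots> = complex_of_real (r / s) * (ip (U g (\<zeta> n) - \<zeta> n) (\<zeta> n) + ip (\<zeta> n) (\<zeta> n))"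
        unfolding cc using gG \<zeta>V by (simp add: ip_diff_left U_mem)
      also have "\<dots> = complex_of_real (r / s) * ip (U g (\<zeta> n) - \<zeta> n) (\<zeta> n) + complex_of_real r"
        using s \<zeta>V by (simp add: ip_self s_def[symmetric] distrib_left)
      finally have eq: "iprod S.space_H (S.rep_H g (S.J \<eta>)) (S.J \<eta>) = 
        complex_of_real (r / s) * ip (U g (\<zeta> n) - \<zeta> n) (\<zeta> n) + complex_of_real r" .
      have "iprod complex_line (trivial_rep g z) z = complex_of_real r"
        unfolding r_def complex_norm_square by (simp add: complex_line_def trivial_rep_def)
      then have "cmod (iprod complex_line (trivial_rep g z) z -
         (\<Sum>v\<leftarrow>[S.J \<eta>]. iprod S.space_H (S.rep_H g v) v)) 
         = cmod (complex_of_real (r / s) * ip (U g (\<zeta> n) - \<zeta> n) (\<zeta> n))"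
        by (simp add: eq)
      also have "\<dots> = (r / s) * cmod (ip (U g (\<zeta> n) - \<zeta> n) (\<zeta> n))"
        using s by (simp only: norm_mult norm_of_real) (simp add: r_def)
      also have "\<dots> \<le> (r / s) * (s * (d / (r + 1)))"
      proof (rule mult_left_mono)
        have "(cmod (ip (U g (\<zeta> n) - \<zeta> n) (\<zeta> n)))\<^sup>2 \<le> sq (U g (\<zeta> n) - \<zeta> n) * s"
          unfolding s_def using gG \<zeta>V by (intro Cauchy_Schwarz diff_mem U_mem)
        also have "\<dots> \<le> (\<delta> * (d / (r + 1))\<^sup>2) * s"
          using \<zeta>ai[OF gG, of n] n[OF g] s by (intro mult_right_mono) auto
        also have "\<dots> \<le> (s * (d / (r + 1))\<^sup>2) * s"
          using s by (intro mult_right_mono) auto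
        also have "\<dots> = (s * (d / (r + 1)))\<^sup>2" by (simp add: power2_eq_square algebra_simps)
        finally show "cmod (ip (U g (\<zeta> n) - \<zeta> n) (\<zeta> n)) \<le> s * (d / (r + 1))"
          by (rule power2_le_imp_le) (use s d in \<open>auto simp: r_def\<close>)
      qed (use s in \<open>auto simp: r_def\<close>)
      also have "\<dots> = r * d / (r + 1)" using s by simp
      also have "\<dots> < d"
      proof -
        have "r \<ge> 0" by (simp add: r_def)
        then show ?thesis using d by (simp add: pos_divide_less_eq algebra_simps)
      qed
      finally show ?thesis .
    qed
    moreover have "set [S.J \<eta>] \<subseteq> carrier S.space_H" using \<eta> by (simp add: S.space_H_def)
    ultimately show "\<exists>\<eta>s. set \<eta>s \<subseteq> carrier S.space_H \<and> (\<forall>g\<in>F. cmod (iprod complex_line (trivial_rep g z) z -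
         (\<Sum>\<eta>\<leftarrow>\<eta>s. iprod S.space_H (S.rep_H g \<eta>) \<eta>)) < d)" by blast
  qed
  with S.unitary_representation_H
  have "unitary_representation G S.space_H S.rep_H \<and>
      weakly_contains G S.space_H S.rep_H complex_line trivial_rep" ..
  then have "\<exists>u\<in>carrier S.space_H. u \<noteq> \<zero>\<^bsub>S.space_H\<^esub> \<and> (\<forall>g\<in>N. S.rep_H g u = u)"
    by (rule T[unfolded relative_property_T_def, THEN spec, THEN spec, THEN mp])
  then obtain u where u: "u \<in> carrier S.space_H" "u \<noteq> \<zero>\<^bsub>S.space_H\<^esub>" "\<And>g. g \<in> N \<Longrightarrow> S.rep_H g u = u"
    by (elim bexE conjE) simp
  then obtain f where f: "f \<in> S.clspan" "u = S.J f" by (auto simp: S.space_H_def)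
  have "sq (U g f - f) = 0" if g: "g \<in> N" for g
  proof -
    have gG: "g \<in> carrier G" using g N by auto
    show ?thesis using u(3)[OF g] f gG S.J_eq_iff[OF S.U_clspan[OF gG f(1)] f(1)] 
      by (simp add: S.rep_H_J)
  qed
  then have ff: "f \<in> fixed N" using f S.clspan_V by (simp add: fixed_def)
  \<comment> \<open>\<open>f\<close> is fixed, hence orthogonal to every translate of every
    \<open>\<zeta> n\<close>; since these translates determine vectors of \<open>clspan\<close> up
    to null vectors, the nonzero vector just obtained is zero.\<close>
  have "ip f (e k) = 0" for k
  proof -
    obtain i n where k: "prod_decode k = (i, n)" by fastforce
    have "ip f (U (en i) (\<zeta> n)) = ip (U (inv (en i)) f) (\<zeta> n)"
      using f S.clspan_V en \<zeta>V by (intro ip_U_right) auto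
    also have "\<dots> = 0" using en by (intro \<zeta>perp fixed_normal nor ff) auto
    finally show ?thesis by (simp add: e_def k)
  qed
  then have "sq f = 0" by (rule S.clspan_perp_null[OF f(1)])
  then have "S.J f = S.J 0" using S.J_eq_iff[OF f(1) S.clspan_closures(1)] by simp
  then show False using u(2) f(2) by (simp add: S.J_0) (simp add: S.space_H_def)
qed

end

section \<open>Square-integrable functions\<close>

definition square_integrable :: "'z measure \<Rightarrow> ('z \<Rightarrow> complex) set" where
  "square_integrable N = {f \<in> borel_measurable N. integrable N (\<lambda>z. (cmod (f z))\<^sup>2)}"

definition L2_scale :: "complex \<Rightarrow> ('z \<Rightarrow> complex) \<Rightarrow> 'z \<Rightarrow> complex" where
  "L2_scale c f = (\<lambda>z. c * f z)"

definition L2_ip :: "'z measure \<Rightarrow> ('z \<Rightarrow> complex) \<Rightarrow> ('z \<Rightarrow> complex) \<Rightarrow> complex" where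
  "L2_ip N f g = (\<integral>z. f z * cnj (g z) \<partial>N)"

lemma cmod_mult_le: "cmod (a * cnj b) \<le> (cmod a)\<^sup>2 + (cmod b)\<^sup>2"
proof -
  have "0 \<le> (cmod a - cmod b)\<^sup>2" by simp
  then have "2 * (cmod a * cmod b) \<le> (cmod a)\<^sup>2 + (cmod b)\<^sup>2" by (simp add: power2_diff)
  moreover have "0 \<le> cmod a * cmod b" by simp
  ultimately show ?thesis unfolding norm_mult complex_mod_cnj by linarith
qed

lemma cmod_add_sq_le: "(cmod (a + b))\<^sup>2 \<le> 2 * (cmod a)\<^sup>2 + 2 * (cmod b)\<^sup>2"
proof -
  have "(cmod (a + b))\<^sup>2 \<le> (cmod a + cmod b)\<^sup>2"
    by (intro power_mono norm_triangle_ineq) simp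
  also have "\<dots> \<le> 2 * (cmod a)\<^sup>2 + 2 * (cmod b)\<^sup>2"
    using zero_le_power2[of "cmod a - cmod b"] by (simp add: power2_diff power2_sum)
  finally show ?thesis .
qed

lemma L2_measurable: "f \<in> square_integrable N \<Longrightarrow> f \<in> borel_measurable N"
  by (simp add: square_integrable_def)

lemma square_integrableI:
  assumes "f \<in> borel_measurable N" "(\<integral>\<^sup>+z. ennreal ((cmod (f z))\<^sup>2) \<partial>N) < \<infinity>"
  shows "f \<in> square_integrable N"
  unfolding square_integrable_def using assms by (auto intro!: integrableI_nonneg)

lemma L2_integrable_mult:
  assumes f: "f \<in> square_integrable N" and g: "g \<in> square_integrable N"
  shows "integrable N (\<lambda>z. f z * cnj (g z))"
proof (rule Bochner_Integration.integrable_bound)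
  show "integrable N (\<lambda>z. (cmod (f z))\<^sup>2 + (cmod (g z))\<^sup>2)"
    using f g by (auto simp: square_integrable_def)
  show "(\<lambda>z. f z * cnj (g z)) \<in> borel_measurable N"
  proof -
    have [measurable]: "cnj \<in> borel_measurable borel"
      by (intro borel_measurable_continuous_onI continuous_intros)
    have [measurable]: "f \<in> borel_measurable N" "g \<in> borel_measurable N"
      using f g by (auto simp: square_integrable_def)
    show ?thesis by measurable
  qed
  show "AE z in N. norm (f z * cnj (g z)) \<le> norm ((cmod (f z))\<^sup>2 + (cmod (g z))\<^sup>2)"
    using cmod_mult_le by (intro AE_I2) (auto simp: abs_of_nonneg)
qed

lemma L2_add:
  assumes f: "f \<in> square_integrable N" and g: "g \<in> square_integrable N"
  shows "f + g \<in> square_integrable N"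
proof -
  have [measurable]: "f \<in> borel_measurable N" "g \<in> borel_measurable N"
    using f g by (auto simp: square_integrable_def)
  have "integrable N (\<lambda>z. (cmod (f z + g z))\<^sup>2)"
  proof (rule Bochner_Integration.integrable_bound)
    show "integrable N (\<lambda>z. 2 * (cmod (f z))\<^sup>2 + 2 * (cmod (g z))\<^sup>2)"
      using f g by (auto simp: square_integrable_def)
    show "AE z in N. norm ((cmod (f z + g z))\<^sup>2) \<le> norm (2 * (cmod (f z))\<^sup>2 + 2 * (cmod (g z))\<^sup>2)"
      using cmod_add_sq_le by (intro AE_I2) (auto simp: abs_of_nonneg)
  qed measurable
  moreover have "(\<lambda>z. f z + g z) \<in> borel_measurable N" by measurable
  ultimately show ?thesis by (simp add: square_integrable_def plus_fun_def)
qed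

lemma L2_ip_self: "Re (L2_ip N f f) = (\<integral>z. (cmod (f z))\<^sup>2 \<partial>N)"
proof -
  have "L2_ip N f f = (\<integral>z. complex_of_real ((cmod (f z))\<^sup>2) \<partial>N)"
    unfolding L2_ip_def by (simp only: complex_norm_square)
  also have "\<dots> = complex_of_real (\<integral>z. (cmod (f z))\<^sup>2 \<partial>N)" by (rule integral_complex_of_real)
  finally show ?thesis by simp
qed

lemma L2_nn_integral:
  assumes "f \<in> square_integrable N"
  shows "(\<integral>\<^sup>+z. ennreal ((cmod (f z))\<^sup>2) \<partial>N) = ennreal (Re (L2_ip N f f))"
  unfolding L2_ip_self using assms by (intro nn_integral_eq_integral) (auto simp: square_integrable_def)

text \<open>Pointwise Cauchy--Schwarz against the weights \<open>2 ^ k\<close> replaces Minkowski's inequality here: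
  finiteness of the sum of \<open>2 ^ k * (d k)\<^sup>2\<close> makes the increments \<open>d k\<close> summable.\<close>

lemma summable_of_weighted_squares:
  fixes d :: "nat \<Rightarrow> real"
  assumes d: "\<And>k. 0 \<le> d k" and fin: "(\<Sum>k. ennreal (2 ^ k * (d k)\<^sup>2)) < \<infinity>"
  shows "summable d"
proof -
  have s: "summable (\<lambda>k. 2 ^ k * (d k)\<^sup>2)"
    using fin by (intro summable_suminf_not_top) (auto simp: top.not_eq_extremum)
  have g: "summable (\<lambda>k. (1/2::real) ^ k)" by (intro summable_geometric) simp
  show ?thesis
  proof (rule summable_comparison_test')
    show "summable (\<lambda>k. 2 ^ k * (d k)\<^sup>2 + (1/2) ^ k)" using s g by (rule summable_add)
    fix k :: nat
    have "2 * d k \<le> 2 ^ k * (d k)\<^sup>2 + (1/2) ^ k"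
    proof -
      define r where "r = sqrt (2 ^ k)"
      have r: "r > 0" "r\<^sup>2 = 2 ^ k" by (simp_all add: r_def)
      have "0 \<le> (r * d k - 1 / r)\<^sup>2" by simp
      also have "\<dots> = 2 ^ k * (d k)\<^sup>2 + (1/2) ^ k - 2 * d k"
        using r by (simp add: power2_diff power_mult_distrib power_divide)
      finally show ?thesis by simp
    qed
    then show "norm (d k) \<le> 2 ^ k * (d k)\<^sup>2 + (1/2) ^ k" using d[of k] by simp
  qed
qed

text \<open>Riesz--Fischer: along a subsequence with squared increments at most
  \<open>(1/4) ^ k\<close> the functions converge almost everywhere, and Fatou's lemma turns this
  into convergence of the whole sequence in the seminorm.\<close>

lemma L2_complete:
  fixes u :: "nat \<Rightarrow> 'z \<Rightarrow> complex"
  assumes u: "\<And>n. u n \<in> square_integrable N"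
    and c: "\<And>e. e > 0 \<Longrightarrow> \<exists>K. \<forall>m\<ge>K. \<forall>n\<ge>K. Re (L2_ip N (u m - u n) (u m - u n)) < e"
  shows "\<exists>l\<in>square_integrable N. (\<lambda>n. Re (L2_ip N (u n - l) (u n - l))) \<longlonglongrightarrow> 0"
proof -
  have [measurable]: "u n \<in> borel_measurable N" for n using u by (simp add: square_integrable_def)
  have um: "- u n \<in> square_integrable N" for n
  proof -
    have "(\<lambda>z. - u n z) \<in> borel_measurable N" by measurable
    then show ?thesis using u[of n] by (simp add: square_integrable_def fun_Compl_def)
  qed
  have ud: "u m - u n \<in> square_integrable N" for m n using L2_add[OF u um, of m n] by simp
  define D where "D m n = (\<integral>\<^sup>+z. ennreal ((cmod (u m z - u n z))\<^sup>2) \<partial>N)" for m n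
  have D: "D m n = ennreal (Re (L2_ip N (u m - u n) (u m - u n)))" for m n
    unfolding D_def using L2_nn_integral[OF ud, of m n] by simp
  have "\<exists>K. \<forall>m\<ge>K. \<forall>n\<ge>K. D m n \<le> ennreal ((1/4) ^ k)" for k
  proof -
    obtain K where "\<forall>m\<ge>K. \<forall>n\<ge>K. Re (L2_ip N (u m - u n) (u m - u n)) < (1/4) ^ k"
      using c[of "(1/4) ^ k"] by auto
    then show ?thesis unfolding D by (intro exI[of _ K]) (auto intro!: ennreal_leI less_imp_le)
  qed
  then obtain K where K: "\<And>k m n. m \<ge> K k \<Longrightarrow> n \<ge> K k \<Longrightarrow> D m n \<le> ennreal ((1/4) ^ k)" by metis
  \<comment> \<open>Partial sums make \<open>r j\<close> at least \<open>K k\<close> for all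
    \<open>k \<le> j\<close>, whether or not \<open>K\<close> is monotone.\<close>
  define r where "r = (\<lambda>k. \<Sum>i\<le>k. K i)"
  have r_ge: "K k \<le> r j" if "k \<le> j" for k j
    unfolding r_def using that by (intro member_le_sum) auto
  define d where "d k z = cmod (u (r (Suc k)) z - u (r k) z)" for k z
  have [measurable]: "d k \<in> borel_measurable N" for k unfolding d_def by measurable
  have "(\<integral>\<^sup>+z. (\<Sum>k. ennreal (2 ^ k * (d k z)\<^sup>2)) \<partial>N) = (\<Sum>k. \<integral>\<^sup>+z. ennreal (2 ^ k * (d k z)\<^sup>2) \<partial>N)"
    by (intro nn_integral_suminf) measurable
  also have "\<dots> = (\<Sum>k. ennreal (2 ^ k) * D (r (Suc k)) (r k))"
    unfolding D_def d_def by (simp add: ennreal_mult nn_integral_cmult)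
  also have "\<dots> \<le> (\<Sum>k. ennreal ((1/2) ^ k))"
  proof (intro suminf_le summableI allI)
    fix k
    have "ennreal (2 ^ k) * D (r (Suc k)) (r k) \<le> ennreal (2 ^ k) * ennreal ((1/4) ^ k)"
      by (intro mult_left_mono K r_ge) auto
    also have "\<dots> = ennreal (2 ^ k * (1/4) ^ k)" by (simp add: ennreal_mult)
    also have "(2::real) ^ k * (1/4) ^ k = (1/2) ^ k" by (simp flip: power_mult_distrib)
    finally show "ennreal (2 ^ k) * D (r (Suc k)) (r k) \<le> ennreal ((1/2) ^ k)" .
  qed
  also have "\<dots> = ennreal (\<Sum>k. (1/2) ^ k)"
    by (intro suminf_ennreal2) (auto intro: summable_geometric)
  also have "\<dots> < \<infinity>" by simp
  finally have "(\<integral>\<^sup>+z. (\<Sum>k. ennreal (2 ^ k * (d k z)\<^sup>2)) \<partial>N) \<noteq> \<infinity>" by simp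
  then have "AE z in N. (\<Sum>k. ennreal (2 ^ k * (d k z)\<^sup>2)) \<noteq> \<infinity>"
    by (intro nn_integral_PInf_AE) measurable
  then have conv: "AE z in N. convergent (\<lambda>k. u (r k) z)"
  proof eventually_elim
    case (elim z)
    have "summable (\<lambda>k. d k z)" 
      by (rule summable_of_weighted_squares) (use elim in \<open>auto simp: d_def top.not_eq_extremum\<close>)
    then have "summable (\<lambda>k. u (r (Suc k)) z - u (r k) z)"
      unfolding d_def by (rule summable_norm_cancel)
    then have "convergent (\<lambda>n. (\<Sum>k<n. u (r (Suc k)) z - u (r k) z))"
      by (simp add: summable_iff_convergent)
    then have "convergent (\<lambda>n. u (r n) z - u (r 0) z)"
      by (simp only: sum_lessThan_telescope[of "\<lambda>k. u (r k) z"])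
    then obtain L where "(\<lambda>n. u (r n) z - u (r 0) z) \<longlonglongrightarrow> L" by (auto simp: convergent_def)
    then have "(\<lambda>n. (u (r n) z - u (r 0) z) + u (r 0) z) \<longlonglongrightarrow> L + u (r 0) z"
      by (intro tendsto_intros)
    then show "convergent (\<lambda>k. u (r k) z)" by (auto simp: convergent_def)
  qed
  define l where "l z = lim (\<lambda>k. u (r k) z)" for z
  have [measurable]: "l \<in> borel_measurable N" unfolding l_def by (rule borel_measurable_lim_metric) measurable
  have lim: "AE z in N. (\<lambda>k. u (r k) z) \<longlonglongrightarrow> l z"
    using conv by eventually_elim (simp add: l_def convergent_LIMSEQ_iff)
  \<comment> \<open>Fatou's lemma with \<open>m\<close> fixed, along the subsequence.\<close>
  have bound: "(\<integral>\<^sup>+z. ennreal ((cmod (u m z - l z))\<^sup>2) \<partial>N) \<le> ennreal ((1/4) ^ k)" if m: "m \<ge> K k" for k m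
  proof -
    have "(\<integral>\<^sup>+z. ennreal ((cmod (u m z - l z))\<^sup>2) \<partial>N) 
        = (\<integral>\<^sup>+z. liminf (\<lambda>j. ennreal ((cmod (u m z - u (r j) z))\<^sup>2)) \<partial>N)"
    proof (rule nn_integral_cong_AE, use lim in eventually_elim)
      case (elim z)
      have "(\<lambda>j. ennreal ((cmod (u m z - u (r j) z))\<^sup>2)) \<longlonglongrightarrow> ennreal ((cmod (u m z - l z))\<^sup>2)"
        by (intro tendsto_intros tendsto_ennrealI elim)
      then show ?case by (intro lim_imp_Liminf[symmetric]) auto
    qed
    also have "\<dots> \<le> liminf (\<lambda>j. D m (r j))"
      unfolding D_def by (intro nn_integral_liminf) measurable
    also have "\<dots> \<le> liminf (\<lambda>j. ennreal ((1/4) ^ k))"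
    proof (rule Liminf_mono)
      show "\<forall>\<^sub>F j in sequentially. D m (r j) \<le> ennreal ((1/4) ^ k)"
        unfolding eventually_sequentially
      proof (intro exI[of _ k] allI impI)
        fix j assume j: "k \<le> j"
        show "D m (r j) \<le> ennreal ((1/4) ^ k)" by (intro K m r_ge j)
      qed
    qed
    also have "\<dots> = ennreal ((1/4) ^ k)" by (intro Liminf_const) simp
    finally show ?thesis .
  qed
  have ulL2: "u m - l \<in> square_integrable N" if "m \<ge> K 0" for m
  proof (rule square_integrableI)
    have "(\<lambda>z. u m z - l z) \<in> borel_measurable N" by measurable
    then show "u m - l \<in> borel_measurable N" by (simp add: fun_diff_def)
    show "(\<integral>\<^sup>+z. ennreal ((cmod ((u m - l) z))\<^sup>2) \<partial>N) < \<infinity>"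
      using bound[of 0 m] that by (auto intro: le_less_trans)
  qed
  have lL2: "l \<in> square_integrable N"
  proof -
    have "- (u (K 0) - l) \<in> square_integrable N"
    proof -
      have "(\<lambda>z. - (u (K 0) z - l z)) \<in> borel_measurable N" by measurable
      then show ?thesis using ulL2[of "K 0"] by (simp add: square_integrable_def fun_Compl_def fun_diff_def norm_minus_commute)
    qed
    then have "u (K 0) + (- (u (K 0) - l)) \<in> square_integrable N" by (intro L2_add u)
    then show ?thesis by simp
  qed
  have "(\<lambda>n. Re (L2_ip N (u n - l) (u n - l))) \<longlonglongrightarrow> 0"
  proof (rule LIMSEQ_I)
    fix e :: real assume e: "e > 0"
    obtain k where k: "(1/4::real) ^ k < e" using real_arch_pow_inv[of e "1/4"] e by auto
    show "\<exists>no. \<forall>n\<ge>no. norm (Re (L2_ip N (u n - l) (u n - l)) - 0) < e"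
    proof (intro exI allI impI)
      fix n assume n: "n \<ge> max (K k) (K 0)"
      have "ennreal (Re (L2_ip N (u n - l) (u n - l))) \<le> ennreal ((1/4) ^ k)"
        using L2_nn_integral[OF ulL2, of n] bound[of k n] n by simp
      then have "Re (L2_ip N (u n - l) (u n - l)) \<le> (1/4) ^ k" by (simp add: ennreal_le_iff)
      moreover have "0 \<le> Re (L2_ip N (u n - l) (u n - l))" unfolding L2_ip_self by simp
      ultimately show "norm (Re (L2_ip N (u n - l) (u n - l)) - 0) < e" using k by simp
    qed
  qed
  then show ?thesis using lL2 by blast
qed

lemma semi_hilbert_L2: "semi_hilbert (square_integrable N) L2_scale (L2_ip N)"
proof
  have mult: "f \<in> square_integrable N \<Longrightarrow> L2_scale c f \<in> square_integrable N" for c and f :: "'a \<Rightarrow> complex"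
    by (auto simp: square_integrable_def L2_scale_def norm_mult power_mult_distrib)
  show "0 \<in> square_integrable N" by (simp add: square_integrable_def zero_fun_def)
  show "x + y \<in> square_integrable N" if "x \<in> square_integrable N" "y \<in> square_integrable N" for x y using that by (rule L2_add)
  show "- x \<in> square_integrable N" if "x \<in> square_integrable N" for x
    using mult[OF that, of "-1"] by (simp add: L2_scale_def fun_Compl_def)
  show "L2_scale c x \<in> square_integrable N" if "x \<in> square_integrable N" for x c by (rule mult[OF that])
  show "L2_ip N (x + y) z = L2_ip N x z + L2_ip N y z"
    if "x \<in> square_integrable N" "y \<in> square_integrable N" "z \<in> square_integrable N" for x y z
    using that by (simp add: L2_ip_def distrib_right L2_integrable_mult)
  show "L2_ip N (L2_scale c x) y = c * L2_ip N x y"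
    if "x \<in> square_integrable N" "y \<in> square_integrable N" for x y c
    by (simp add: L2_ip_def L2_scale_def mult.assoc)
  show "L2_ip N x y = cnj (L2_ip N y x)"
    if "x \<in> square_integrable N" "y \<in> square_integrable N" for x y
    unfolding L2_ip_def
    by (subst Bochner_Integration.integral_cnj[symmetric]) (simp add: mult.commute)
  show "0 \<le> Re (L2_ip N x x)" for x by (simp add: L2_ip_self)
  show "\<exists>l\<in>square_integrable N. (\<lambda>n. Re (L2_ip N (u n - l) (u n - l))) \<longlonglongrightarrow> 0"
    if "range u \<subseteq> square_integrable N" 
      "\<And>e. e > 0 \<Longrightarrow> \<exists>K. \<forall>m\<ge>K. \<forall>n\<ge>K. Re (L2_ip N (u m - u n) (u m - u n)) < e" for u
    using that by (intro L2_complete) auto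
qed

section \<open>Profinite actions\<close>

text \<open>Countability makes the product of the two discrete spaces discrete, so every function of
  the pair is measurable.\<close>

lemma measurable_count_space_app2:
  assumes "countable A" "countable B"
    and f: "f \<in> K \<rightarrow>\<^sub>M count_space A" and g: "g \<in> K \<rightarrow>\<^sub>M count_space B"
    and h: "\<And>a b. a \<in> A \<Longrightarrow> b \<in> B \<Longrightarrow> h a b \<in> space N"
  shows "(\<lambda>z. h (f z) (g z)) \<in> K \<rightarrow>\<^sub>M N"
proof -
  have "(\<lambda>z. (f z, g z)) \<in> K \<rightarrow>\<^sub>M count_space A \<Otimes>\<^sub>M count_space B"
    using f g by measurable
  then have "(\<lambda>z. (f z, g z)) \<in> K \<rightarrow>\<^sub>M count_space (A \<times> B)"
    using assms(1,2) by (simp add: pair_measure_countable)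
  moreover have "(\<lambda>(a, b). h a b) \<in> count_space (A \<times> B) \<rightarrow>\<^sub>M N"
    using h by auto
  ultimately show ?thesis by (auto dest: measurable_compose)
qed

lemma pred_countable_bounded:
  assumes "countable X" "\<And>i. i \<in> X \<Longrightarrow> Measurable.pred K (\<lambda>z. P z i)"
  shows "Measurable.pred K (\<lambda>z. \<forall>i\<in>X. P z i)" "Measurable.pred K (\<lambda>z. \<exists>i\<in>X. P z i)"
  using sets.sets_Collect_countable_All'[OF _ assms(1), of K "\<lambda>i z. P z i"]
    sets.sets_Collect_countable_Ex'[OF _ assms(1), of K "\<lambda>i z. P z i"] assms(2)
  unfolding pred_def by blast+

text \<open>If it held, \<open>b - K\<close> would be positive almost everywhere and yet have
  integral zero.\<close>

lemma (in prob_space) not_AE_greater: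
  assumes b [measurable]: "b \<in> borel_measurable M" and le: "(\<integral>\<^sup>+x. b x \<partial>M) \<le> ennreal K"
  shows "\<not> (AE x in M. ennreal K < b x)"
proof
  assume gr: "AE x in M. ennreal K < b x"
  have "(\<integral>\<^sup>+x. b x - ennreal K \<partial>M) = (\<integral>\<^sup>+x. b x \<partial>M) - (\<integral>\<^sup>+x. ennreal K \<partial>M)"
    using gr by (intro nn_integral_diff) (auto simp: emeasure_space_1 elim: eventually_mono less_imp_le)
  also have "\<dots> = 0" using le neq_top_trans[OF _ le]
    by (simp add: emeasure_space_1 diff_eq_0_iff_ennreal less_top)
  finally have "AE x in M. b x - ennreal K = 0" by (subst (asm) nn_integral_0_iff_AE) auto
  with gr have "AE x in M. False"
    by eventually_elim (auto simp: diff_eq_0_iff_ennreal)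
  then show False by simp
qed

text \<open>The inverse system is kept as a sequence of finite partitions, the fibres of
  \<open>r n\<close>, which the group permutes, which refine each other and which generate the
  \<open>\<sigma>\<close>-algebra. Ergodicity is recorded for \<open>N0\<close>, the group under
  which kernels and defects will be invariant.\<close>

locale profinite_action =
  prob_space M + group G for M :: "'x measure" and G :: "('g, 'a) monoid_scheme" (structure) +
  fixes act :: "'g \<Rightarrow> 'x \<Rightarrow> 'x" and r :: "nat \<Rightarrow> 'x \<Rightarrow> 'y" and N0 :: "'g set"
  assumes countable_G: "countable (carrier G)"
    and normal_N0: "normal N0 G"
    and act_measurable: "g \<in> carrier G \<Longrightarrow> act g \<in> M \<rightarrow>\<^sub>M M"
    and distr_act: "g \<in> carrier G \<Longrightarrow> distr M M (act g) = M"
    and act_mult: "g \<in> carrier G \<Longrightarrow> h \<in> carrier G \<Longrightarrow> x \<in> space M \<Longrightarrow> act (g \<otimes> h) x = act g (act h x)"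
    and act_one: "x \<in> space M \<Longrightarrow> act \<one> x = x"
    and r_measurable [measurable]: "r n \<in> M \<rightarrow>\<^sub>M count_space UNIV"
    and r_finite: "finite (r n ` space M)"
    and r_act: "g \<in> carrier G \<Longrightarrow> x \<in> space M \<Longrightarrow> y \<in> space M \<Longrightarrow> r n x = r n y \<Longrightarrow>
      r n (act g x) = r n (act g y)"
    and r_refine: "m \<le> n \<Longrightarrow> x \<in> space M \<Longrightarrow> y \<in> space M \<Longrightarrow> r n x = r n y \<Longrightarrow> r m x = r m y"
    and r_generates: "sets M = sigma_sets (space M) {r n -` {a} \<inter> space M |n a. True}"
    and ergodic_N0: "A \<in> sets M \<Longrightarrow> (\<And>g. g \<in> N0 \<Longrightarrow> act g -` A \<inter> space M = A) \<Longrightarrow>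
      measure M A = 0 \<or> measure M A = 1"
begin

lemma N0_subset: "N0 \<subseteq> carrier G"
  using normal_N0 normal_imp_subgroup subgroup.subset by blast

lemma N0_carrier: "g \<in> N0 \<Longrightarrow> g \<in> carrier G"
  using N0_subset by auto

lemma act_space: "g \<in> carrier G \<Longrightarrow> x \<in> space M \<Longrightarrow> act g x \<in> space M"
  using act_measurable by (rule measurable_space)

lemma act_inv:
  assumes "g \<in> carrier G" "x \<in> space M"
  shows "act (inv g) (act g x) = x" "act g (act (inv g) x) = x"
  using act_mult[of "inv g" g x] act_mult[of g "inv g" x] assms by (simp_all add: act_one)

lemma r_act_iff:
  assumes "g \<in> carrier G" "x \<in> space M" "y \<in> space M"
  shows "r n (act g x) = r n (act g y) \<longleftrightarrow> r n x = r n y"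
proof
  assume "r n (act g x) = r n (act g y)"
  then have "r n (act (inv g) (act g x)) = r n (act (inv g) (act g y))"
    using assms act_space by (intro r_act[OF _ _ _ \<open>r n (act g x) = r n (act g y)\<close>]) auto
  then show "r n x = r n y" by (simp only: act_inv(1)[OF assms(1,2)] act_inv(1)[OF assms(1,3)])
next
  show "r n (act g x) = r n (act g y)" if "r n x = r n y"
    using assms that by (rule r_act)
qed

lemma nn_integral_act:
  assumes "g \<in> carrier G" "f \<in> borel_measurable M"
  shows "(\<integral>\<^sup>+x. f (act g x) \<partial>M) = (\<integral>\<^sup>+x. f x \<partial>M)"
proof -
  have "(\<integral>\<^sup>+x. f x \<partial>M) = (\<integral>\<^sup>+x. f x \<partial>distr M M (act g))" using assms by (simp add: distr_act)
  also have "\<dots> = (\<integral>\<^sup>+x. f (act g x) \<partial>M)"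
    using assms by (intro nn_integral_distr) (auto intro: act_measurable)
  finally show ?thesis by simp
qed

lemma emeasure_act:
  assumes g: "g \<in> carrier G" and [measurable]: "Measurable.pred M Q"
  shows "emeasure M {x \<in> space M. Q (act g x)} = emeasure M {x \<in> space M. Q x}"
proof -
  have [measurable]: "act g \<in> M \<rightarrow>\<^sub>M M" using g by (rule act_measurable)
  have "emeasure M {x \<in> space M. Q x} = emeasure (distr M M (act g)) {x \<in> space M. Q x}"
    using g by (simp add: distr_act)
  also have "\<dots> = emeasure M (act g -` {x \<in> space M. Q x} \<inter> space M)"
    by (intro emeasure_distr) measurable
  also have "act g -` {x \<in> space M. Q x} \<inter> space M = {x \<in> space M. Q (act g x)}"
    using g act_space by auto
  finally show ?thesis by simp
qed

lemma AE_act: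
  assumes "g \<in> carrier G" "AE x in M. P x"
  shows "AE x in M. P (act g x)"
  using assms distr_act[OF assms(1)] act_measurable[OF assms(1)] by (metis AE_distrD)

lemma pred_same_r [measurable (raw)]:
  assumes [measurable]: "f \<in> K \<rightarrow>\<^sub>M M" "h \<in> K \<rightarrow>\<^sub>M M"
  shows "Measurable.pred K (\<lambda>z. r n (f z) = r n (h z))"
proof -
  have "{z \<in> space K. r n (f z) = r n (h z)} =
      (\<Union>a\<in>r n ` space M. {z \<in> space K. r n (f z) = a \<and> r n (h z) = a})"
    using measurable_space[OF assms(2)] by auto
  also have "\<dots> \<in> sets K"
    by (intro sets.finite_UN r_finite) measurable
  finally show ?thesis by (simp add: pred_def)
qed

lemma pred_r_mem: "Measurable.pred M (\<lambda>x. r n x \<in> B)"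
  by (rule measurable_compose[OF r_measurable]) simp

text \<open>Invariance up to null sets becomes exact by asking for \<open>P\<close> at all
  \<open>N0\<close>-translates; since \<open>N0\<close> is countable, the resulting set still agrees
  with \<open>P\<close> almost everywhere.\<close>

lemma ergodic_AE:
  assumes [measurable]: "Measurable.pred M P"
    and inv: "\<And>g. g \<in> N0 \<Longrightarrow> AE x in M. P (act g x) \<longleftrightarrow> P x"
  shows "(AE x in M. P x) \<or> (AE x in M. \<not> P x)"
proof -
  define A where "A = {x \<in> space M. \<forall>g\<in>N0. P (act g x)}"
  have sub: "subgroup N0 G" using normal_N0 by (rule normal_imp_subgroup)
  have cN: "countable N0" using N0_subset countable_G by (rule countable_subset)
  have A: "A \<in> sets M" unfolding A_def
  proof (rule predE, rule pred_countable_bounded(1)[OF cN])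
    fix g assume g: "g \<in> N0"
    have [measurable]: "act g \<in> M \<rightarrow>\<^sub>M M" using g N0_carrier by (intro act_measurable)
    show "Measurable.pred M (\<lambda>x. P (act g x))" by measurable
  qed
  have "act h -` A \<inter> space M = A" if h: "h \<in> N0" for h
  proof -
    have hG: "h \<in> carrier G" using h by (rule N0_carrier)
    have "x \<in> A" if x: "x \<in> space M" "\<forall>g\<in>N0. P (act g (act h x))" for x
      unfolding A_def
    proof (intro CollectI conjI ballI x(1))
      fix g assume g: "g \<in> N0"
      have k: "g \<otimes> inv h \<in> N0" using g h sub by (meson subgroup.m_closed subgroup.m_inv_closed)
      have "act (g \<otimes> inv h) (act h x) = act g x"
        using g h x N0_carrier hG by (simp add: act_mult act_space act_inv)
      then show "P (act g x)" using x(2) k by metis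
    qed
    moreover have "P (act g (act h x))" if "x \<in> A" "g \<in> N0" for x g
    proof -
      have "g \<otimes> h \<in> N0" using that h sub by (meson subgroup.m_closed)
      then have "P (act (g \<otimes> h) x)" using that by (auto simp: A_def)
      then show ?thesis using that hG N0_carrier by (simp add: act_mult A_def)
    qed
    ultimately show ?thesis using hG act_space by (auto simp: A_def)
  qed
  then consider "measure M A = 0" | "measure M A = 1" using ergodic_N0[OF A] by blast
  moreover have "AE x in M. \<forall>g\<in>N0. P (act g x) \<longleftrightarrow> P x"
    using inv by (subst AE_ball_countable[OF cN]) auto
  then have eq: "AE x in M. x \<in> A \<longleftrightarrow> P x"
  proof (rule AE_mp, intro AE_I2 impI)
    fix x assume "x \<in> space M" "\<forall>g\<in>N0. P (act g x) \<longleftrightarrow> P x"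
    then show "x \<in> A \<longleftrightarrow> P x" using subgroup.one_closed[OF sub] by (auto simp: A_def)
  qed
  ultimately show ?thesis
  proof cases
    case 1
    then have "AE x in M. x \<notin> A" using A prob_eq_0 by blast
    with eq have "AE x in M. \<not> P x" by eventually_elim simp
    then show ?thesis ..
  next
    case 2
    then have "AE x in M. x \<in> A" using A prob_eq_1 by blast
    with eq have "AE x in M. P x" by eventually_elim simp
    then show ?thesis ..
  qed
qed

text \<open>The passage from an average to almost every point: the set where \<open>b\<close> is at
  most \<open>K\<close> is invariant, hence null or conull, and a function cannot exceed its mean
  almost everywhere.\<close>

lemma invariant_le:
  assumes [measurable]: "b \<in> borel_measurable M"
    and inv: "\<And>g. g \<in> N0 \<Longrightarrow> AE x in M. b (act g x) = b x"
    and le: "(\<integral>\<^sup>+x. b x \<partial>M) \<le> ennreal K"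
  shows "AE x in M. b x \<le> ennreal K"
proof -
  have "(AE x in M. b x \<le> ennreal K) \<or> (AE x in M. \<not> b x \<le> ennreal K)"
  proof (rule ergodic_AE)
    fix g assume "g \<in> N0"
    from inv[OF this] show "AE x in M. b (act g x) \<le> ennreal K \<longleftrightarrow> b x \<le> ennreal K"
      by eventually_elim simp
  qed measurable
  then show ?thesis using not_AE_greater[OF _ le] by (auto simp: not_le)
qed

text \<open>The measure of the atom of \<open>x\<close> is an invariant function of
  \<open>x\<close>. One of the finitely many atoms has positive measure \<open>c\<close>, so the
  level set at \<open>c\<close> is not null and ergodicity makes it conull.\<close>

lemma atom_size_exists:
  "\<exists>c>0. AE x in M. emeasure M {y \<in> space M. r n y = r n x} = ennreal c"
proof -
  have "\<exists>x0\<in>space M. emeasure M {y \<in> space M. r n y = r n x0} \<noteq> 0"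
  proof (rule ccontr)
    assume "\<not> ?thesis"
    then have z: "emeasure M {y \<in> space M. r n y = r n x} = 0" if "x \<in> space M" for x
      using that by auto
    have "space M = (\<Union>a\<in>r n ` space M. {y \<in> space M. r n y = a})" by auto
    then have "emeasure M (space M) = emeasure M (\<Union>a\<in>r n ` space M. {y \<in> space M. r n y = a})"
      by simp
    also have "\<dots> \<le> (\<Sum>a\<in>r n ` space M. emeasure M {y \<in> space M. r n y = a})"
      by (intro emeasure_subadditive_finite r_finite) auto
    also have "\<dots> = 0" using z by (intro sum.neutral) auto
    finally show False by (simp add: emeasure_space_1)
  qed
  then obtain x0 where x0: "x0 \<in> space M" "emeasure M {y \<in> space M. r n y = r n x0} \<noteq> 0" by blast
  define c where "c = measure M {y \<in> space M. r n y = r n x0}"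
  have c: "emeasure M {y \<in> space M. r n y = r n x0} = ennreal c"
    unfolding c_def by (rule emeasure_eq_measure)
  have c0: "c > 0" using x0(2) c by (simp add: c_def zero_less_measure_iff)
  define P where "P x \<longleftrightarrow> emeasure M {y \<in> space M. r n y = r n x} = ennreal c" for x
  have [measurable]: "Measurable.pred M P" unfolding P_def by measurable
  have "(AE x in M. P x) \<or> (AE x in M. \<not> P x)"
  proof (rule ergodic_AE)
    fix g assume "g \<in> N0"
    then have g: "g \<in> carrier G" by (rule N0_carrier)
    have "emeasure M {y \<in> space M. r n y = r n (act g x)} = emeasure M {y \<in> space M. r n y = r n x}"
      if x: "x \<in> space M" for x
    proof -
      have gx: "act g x \<in> space M" using g x by (rule act_space)
      have "emeasure M {y \<in> space M. r n y = r n (act g x)} = emeasure M {y \<in> space M. r n (act g y) = r n (act g x)}"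
        using g gx by (intro emeasure_act[symmetric]) auto
      also have "{y \<in> space M. r n (act g y) = r n (act g x)} = {y \<in> space M. r n y = r n x}"
        using g x by (auto simp: r_act_iff)
      finally show ?thesis .
    qed
    then show "AE x in M. P (act g x) \<longleftrightarrow> P x" by (intro AE_I2) (simp add: P_def)
  qed measurable
  moreover have "\<not> (AE x in M. \<not> P x)"
  proof
    assume "AE x in M. \<not> P x"
    then have "AE x in M. \<not> r n x = r n x0" by eventually_elim (auto simp: P_def c)
    then have "emeasure M {y \<in> space M. r n y = r n x0} = 0"
      by (subst (asm) AE_iff_measurable[OF _ refl]) auto
    then show False using x0 by simp
  qed
  ultimately show ?thesis using c0 unfolding P_def by blast
qed

definition atom_size :: "nat \<Rightarrow> real" where
  "atom_size n = (SOME c. c > 0 \<and> (AE x in M. emeasure M {y \<in> space M. r n y = r n x} = ennreal c))"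

lemma atom_size:
  shows atom_size_pos: "atom_size n > 0"
    and AE_atom_size: "AE x in M. emeasure M {y \<in> space M. r n y = r n x} = ennreal (atom_size n)"
proof -
  have "\<exists>c. c > 0 \<and> (AE x in M. emeasure M {y \<in> space M. r n y = r n x} = ennreal c)"
    using atom_size_exists[of n] by blast
  from someI_ex[OF this] show "atom_size n > 0"
    and "AE x in M. emeasure M {y \<in> space M. r n y = r n x} = ennreal (atom_size n)"
    unfolding atom_size_def by blast+
qed

section \<open>Integrals over pairs of points in one atom\<close>

lemma nn_integral_same_fst:
  assumes [measurable]: "Measurable.pred M D"
  shows "(\<integral>\<^sup>+x. emeasure M {y \<in> space M. r n y = r n x \<and> D x} \<partial>M) = ennreal (atom_size n) * emeasure M {x \<in> space M. D x}"
proof -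
  have "(\<integral>\<^sup>+x. emeasure M {y \<in> space M. r n y = r n x \<and> D x} \<partial>M) =
      (\<integral>\<^sup>+x. ennreal (atom_size n) * indicator {x \<in> space M. D x} x \<partial>M)"
    using AE_atom_size[of n] AE_space
    by (intro nn_integral_cong_AE, eventually_elim) (auto simp: indicator_def)
  also have "\<dots> = ennreal (atom_size n) * emeasure M {x \<in> space M. D x}"
    by (intro nn_integral_cmult_indicator) measurable
  finally show ?thesis .
qed

lemma emeasure_pair_swap:
  assumes [measurable]: "Measurable.pred (M \<Otimes>\<^sub>M M) (\<lambda>z. Q (fst z) (snd z))"
  shows "(\<integral>\<^sup>+x. emeasure M {y \<in> space M. Q x y} \<partial>M) = (\<integral>\<^sup>+y. emeasure M {x \<in> space M. Q x y} \<partial>M)"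
proof -
  interpret P: pair_prob_space M M ..
  define X where "X = {z \<in> space (M \<Otimes>\<^sub>M M). Q (fst z) (snd z)}"
  have X: "X \<in> sets (M \<Otimes>\<^sub>M M)" unfolding X_def by measurable
  have "(\<integral>\<^sup>+x. emeasure M {y \<in> space M. Q x y} \<partial>M) = (\<integral>\<^sup>+x. emeasure M (Pair x -` X) \<partial>M)"
    by (intro nn_integral_cong arg_cong[where f = "emeasure M"]) (auto simp: X_def space_pair_measure)
  also have "\<dots> = emeasure (M \<Otimes>\<^sub>M M) X" using X by (rule emeasure_pair_measure_alt[symmetric])
  also have "\<dots> = (\<integral>\<^sup>+y. emeasure M ((\<lambda>x. (x, y)) -` X) \<partial>M)" using X by (rule P.emeasure_pair_measure_alt2)
  also have "\<dots> = (\<integral>\<^sup>+y. emeasure M {x \<in> space M. Q x y} \<partial>M)"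
    by (intro nn_integral_cong arg_cong[where f = "emeasure M"]) (auto simp: X_def space_pair_measure)
  finally show ?thesis .
qed

lemma nn_integral_same_snd:
  assumes [measurable]: "Measurable.pred M D"
  shows "(\<integral>\<^sup>+x. emeasure M {y \<in> space M. r n y = r n x \<and> D y} \<partial>M) = ennreal (atom_size n) * emeasure M {x \<in> space M. D x}"
proof -
  have "(\<integral>\<^sup>+x. emeasure M {y \<in> space M. r n y = r n x \<and> D y} \<partial>M) =
      (\<integral>\<^sup>+y. emeasure M {x \<in> space M. r n x = r n y \<and> D y} \<partial>M)"
    by (subst emeasure_pair_swap) (auto intro!: nn_integral_cong arg_cong[where f = "emeasure M"])
  then show ?thesis by (simp add: nn_integral_same_fst)
qed

section \<open>Approximation by functions of a finite level\<close>

definition level_approx :: "nat \<Rightarrow> real \<Rightarrow> 'x set \<Rightarrow> bool" where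
  "level_approx n e A \<longleftrightarrow> (\<exists>B. measure M {x \<in> space M. (x \<in> A) \<noteq> (r n x \<in> B)} < e)"

text \<open>The same union of atoms, relabelled at the finer level.\<close>

lemma level_approx_mono:
  assumes "level_approx m e A" "m \<le> n"
  shows "level_approx n e A"
proof -
  obtain B where B: "measure M {x \<in> space M. (x \<in> A) \<noteq> (r m x \<in> B)} < e"
    using assms(1) by (auto simp: level_approx_def)
  define B' where "B' = {r n x |x. x \<in> space M \<and> r m x \<in> B}"
  have "r n x \<in> B' \<longleftrightarrow> r m x \<in> B" if x: "x \<in> space M" for x
  proof
    assume "r n x \<in> B'"
    then obtain z where z: "r n x = r n z" "z \<in> space M" "r m z \<in> B" by (auto simp: B'_def)
    then show "r m x \<in> B" using r_refine[OF assms(2) x z(2,1)] by simp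
  next
    assume "r m x \<in> B"
    then show "r n x \<in> B'" using x by (auto simp: B'_def)
  qed
  then have "{x \<in> space M. (x \<in> A) \<noteq> (r n x \<in> B')} = {x \<in> space M. (x \<in> A) \<noteq> (r m x \<in> B)}"
    by auto
  then show ?thesis using B unfolding level_approx_def by (intro exI[of _ B']) (simp only:)
qed

text \<open>Sets approximable to every accuracy form a \<open>\<sigma>\<close>-algebra containing
  the atoms. The induction quantifies over all \<open>e\<close> because in a union the accuracy is
  shared among the members.\<close>

lemma level_approx_exists:
  assumes "A \<in> sets M" "e > 0"
  shows "\<exists>n. level_approx n e A"
proof -
  have "A \<in> sigma_sets (space M) {r n -` {a} \<inter> space M |n a. True}"
    using assms(1) by (subst (asm) r_generates)
  then have "A \<in> sets M \<and> (\<forall>e>0. \<exists>n. level_approx n e A)"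
  proof (induction A rule: sigma_sets.induct)
    case (Basic A)
    then obtain n a where A: "A = r n -` {a} \<inter> space M" by auto
    have "{x \<in> space M. (x \<in> A) \<noteq> (r n x \<in> {a})} = {}" using A by auto
    then have "level_approx n e A" if "e > 0" for e
      unfolding level_approx_def using that by (intro exI[of _ "{a}"]) (simp only: measure_empty)
    moreover have "A \<in> sets M" unfolding A by measurable
    ultimately show ?case by blast
  next
    case Empty
    have "level_approx 0 e {}" if "e > 0" for e
      unfolding level_approx_def using that by (intro exI[of _ "{}"]) simp
    then show ?case by auto
  next
    case (Compl A)
    have "level_approx n e (space M - A)" if l: "level_approx n e A" for n e
    proof -
      obtain B where B: "measure M {x \<in> space M. (x \<in> A) \<noteq> (r n x \<in> B)} < e"
        using l by (auto simp: level_approx_def)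
      have "{x \<in> space M. (x \<in> space M - A) \<noteq> (r n x \<in> - B)} = {x \<in> space M. (x \<in> A) \<noteq> (r n x \<in> B)}"
        by auto
      then show ?thesis unfolding level_approx_def using B by (intro exI[of _ "- B"]) (simp only:)
    qed
    then show ?case using Compl.IH by blast
  next
    case (Union A)
    have [measurable]: "A i \<in> sets M" for i using Union.IH by blast
    have "\<exists>n. level_approx n e (\<Union>i. A i)" if e: "e > 0" for e
    proof -
      have "(\<lambda>k. measure M (\<Union>i<k. A i)) \<longlonglongrightarrow> measure M (\<Union>k. \<Union>i<k. A i)"
        by (intro finite_Lim_measure_incseq incseq_SucI) (auto simp: lessThan_Suc)
      also have "(\<Union>k. \<Union>i<k. A i) = (\<Union>i. A i)" by auto
      finally have "\<forall>\<^sub>F k in sequentially. measure M (\<Union>i. A i) - e / 2 < measure M (\<Union>i<k. A i)"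
        using e by (intro order_tendstoD) auto
      then obtain k where k: "measure M (\<Union>i. A i) - e / 2 < measure M (\<Union>i<k. A i)"
        by (auto dest: eventually_happens)
      \<comment> \<open>Half of \<open>e\<close> pays for the tail of the union, the other half is
        shared by the \<open>k\<close> members kept; the \<open>+ 1\<close> covers
        \<open>k = 0\<close>.\<close>
      define d where "d = e / (2 * (real k + 1))"
      have d: "d > 0" using e by (simp add: d_def)
      have "\<forall>i. \<exists>n. level_approx n d (A i)" using Union.IH d by blast
      then have "\<exists>nn. \<forall>i. level_approx (nn i) d (A i)" by (rule choice)
      then obtain nn where nn: "\<And>i. level_approx (nn i) d (A i)" by blast
      define n where "n = Max (nn ` {..k})"
      have "level_approx n d (A i)" if "i < k" for i
        using nn[of i] that by (elim level_approx_mono) (auto simp: n_def)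
      then have "\<exists>B. i < k \<longrightarrow> measure M {x \<in> space M. (x \<in> A i) \<noteq> (r n x \<in> B)} < d" for i
        by (auto simp: level_approx_def)
      then obtain B where B: "\<And>i. i < k \<Longrightarrow> measure M {x \<in> space M. (x \<in> A i) \<noteq> (r n x \<in> B i)} < d"
        by metis
      define C where "C = (\<Union>i<k. B i)"
      have [measurable]: "Measurable.pred M (\<lambda>x. r n x \<in> B i)" for i by (rule pred_r_mem)
      have [measurable]: "{x \<in> space M. (x \<in> A i) \<noteq> (r n x \<in> B i)} \<in> sets M" for i by measurable
      have "measure M {x \<in> space M. (x \<in> (\<Union>i. A i)) \<noteq> (r n x \<in> C)}
          \<le> measure M (((\<Union>i. A i) - (\<Union>i<k. A i)) \<union> (\<Union>i<k. {x \<in> space M. (x \<in> A i) \<noteq> (r n x \<in> B i)}))"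
      proof (rule finite_measure_mono)
        show "((\<Union>i. A i) - (\<Union>i<k. A i)) \<union> (\<Union>i<k. {x \<in> space M. (x \<in> A i) \<noteq> (r n x \<in> B i)}) \<in> sets M"
          by measurable
      qed (auto simp: C_def)
      also have "\<dots> \<le> measure M ((\<Union>i. A i) - (\<Union>i<k. A i)) + measure M (\<Union>i<k. {x \<in> space M. (x \<in> A i) \<noteq> (r n x \<in> B i)})"
        by (intro measure_Un_le) measurable
      also have "measure M ((\<Union>i. A i) - (\<Union>i<k. A i)) = measure M (\<Union>i. A i) - measure M (\<Union>i<k. A i)"
        by (intro finite_measure_Diff) auto
      also have "measure M (\<Union>i<k. {x \<in> space M. (x \<in> A i) \<noteq> (r n x \<in> B i)}) \<le>
          (\<Sum>i<k. measure M {x \<in> space M. (x \<in> A i) \<noteq> (r n x \<in> B i)})"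
        by (intro measure_UNION_le) measurable
      also have "\<dots> \<le> (\<Sum>i<k. d)" using B by (intro sum_mono) (auto intro: less_imp_le)
      also have "\<dots> \<le> e / 2" using e by (simp add: d_def field_simps)
      finally have "measure M {x \<in> space M. (x \<in> (\<Union>i. A i)) \<noteq> (r n x \<in> C)} < e"
        using k by simp
      then show ?thesis by (auto simp: level_approx_def)
    qed
    then show ?case by auto
  qed
  then show ?thesis using assms(2) by blast
qed

text \<open>Up to small measure \<open>F\<close> takes finitely many values, and each of these level
  sets is close to a union of atoms. \<open>D\<close> collects the remaining values and the points
  where an approximation errs; off \<open>D\<close> the label \<open>r n x\<close> decides
  \<open>F x\<close>.\<close>

lemma countable_valued_approx:
  assumes L: "countable L" and F [measurable]: "F \<in> M \<rightarrow>\<^sub>M count_space L" and e: "e > 0"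
  shows "\<exists>n0. \<forall>n\<ge>n0. \<exists>D. Measurable.pred M D \<and> measure M {x \<in> space M. D x} < e \<and>
    (\<forall>x\<in>space M. \<forall>y\<in>space M. r n x = r n y \<longrightarrow> \<not> D x \<longrightarrow> \<not> D y \<longrightarrow> F x = F y)"
proof -
  have FL: "F x \<in> L" if "x \<in> space M" for x using measurable_space[OF F that] by simp
  have [measurable]: "Measurable.pred M (\<lambda>x. Q (F x))" for Q
    by (rule measurable_compose[OF F]) simp
  have ne: "L \<noteq> {}" using FL not_empty by auto
  define T where "T k = from_nat_into L ` {..<k}" for k :: nat
  have "(\<lambda>k. measure M {x \<in> space M. F x \<in> T k}) \<longlonglongrightarrow> measure M (\<Union>k. {x \<in> space M. F x \<in> T k})"
    by (intro finite_Lim_measure_incseq incseq_SucI) (auto simp: T_def lessThan_Suc)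
  also have "(\<Union>k. {x \<in> space M. F x \<in> T k}) = space M"
  proof -
    have "\<exists>k. F x \<in> T k" if x: "x \<in> space M" for x
    proof -
      obtain i where "from_nat_into L i = F x" using from_nat_into_surj[OF L FL[OF x]] by blast
      then have "F x \<in> T (Suc i)" unfolding T_def by (intro image_eqI[of _ _ i]) auto
      then show ?thesis ..
    qed
    then show ?thesis by auto
  qed
  finally have "\<forall>\<^sub>F k in sequentially. 1 - e / 2 < measure M {x \<in> space M. F x \<in> T k}"
    using e by (intro order_tendstoD) (auto simp: prob_space)
  then obtain k where k: "1 - e / 2 < measure M {x \<in> space M. F x \<in> T k}"
    by (auto dest: eventually_happens)
  define S where "S = T k"
  have S: "finite S" "S \<subseteq> L" using from_nat_into[OF ne] by (auto simp: S_def T_def)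
  have notS: "measure M {x \<in> space M. F x \<notin> S} < e / 2"
  proof -
    have "{x \<in> space M. F x \<notin> S} = space M - {x \<in> space M. F x \<in> S}" by auto
    then have "measure M {x \<in> space M. F x \<notin> S} = 1 - measure M {x \<in> space M. F x \<in> S}"
      by (simp add: prob_compl)
    then show ?thesis using k by (simp add: S_def)
  qed
  define d where "d = e / (2 * (real (card S) + 1))"
  have d: "d > 0" using e by (simp add: d_def)
  have "\<exists>n. level_approx n d {x \<in> space M. F x = t}" for t
    using d by (intro level_approx_exists) measurable
  then obtain nn where nn: "\<And>t. level_approx (nn t) d {x \<in> space M. F x = t}" by metis
  show ?thesis
  proof (intro exI[of _ "Max (insert 0 (nn ` S))"] allI impI)
    fix n assume n: "Max (insert 0 (nn ` S)) \<le> n"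
    have "level_approx n d {x \<in> space M. F x = t}" if "t \<in> S" for t
      using nn[of t] by (elim level_approx_mono) (use that n S in auto)
    then have "\<exists>B. t \<in> S \<longrightarrow> measure M {x \<in> space M. (x \<in> {x \<in> space M. F x = t}) \<noteq> (r n x \<in> B)} < d" for t
      by (auto simp: level_approx_def)
    then have "\<exists>B. \<forall>t. t \<in> S \<longrightarrow>
        measure M {x \<in> space M. (x \<in> {x \<in> space M. F x = t}) \<noteq> (r n x \<in> B t)} < d"
      by (intro choice allI)
    then obtain B where B: "\<And>t. t \<in> S \<Longrightarrow>
        measure M {x \<in> space M. (x \<in> {x \<in> space M. F x = t}) \<noteq> (r n x \<in> B t)} < d"
      by blast
    have B': "{x \<in> space M. (x \<in> {x \<in> space M. F x = t}) \<noteq> (r n x \<in> B t)} = {x \<in> space M. (F x = t) \<noteq> (r n x \<in> B t)}" for t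
      by auto
    define D where "D x \<longleftrightarrow> F x \<notin> S \<or> (\<exists>t\<in>S. (F x = t) \<noteq> (r n x \<in> B t))" for x
    have [measurable]: "Measurable.pred M (\<lambda>x. r n x \<in> B t)" for t by (rule pred_r_mem)
    have [measurable]: "{x \<in> space M. (F x = t) \<noteq> (r n x \<in> B t)} \<in> sets M" for t by measurable
    have D [measurable]: "Measurable.pred M D"
      unfolding D_def by (intro pred_intros_logic pred_intros_finite S) measurable
    have "{x \<in> space M. D x} = {x \<in> space M. F x \<notin> S} \<union> (\<Union>t\<in>S. {x \<in> space M. (F x = t) \<noteq> (r n x \<in> B t)})"
      by (auto simp: D_def)
    then have "measure M {x \<in> space M. D x} \<le> measure M {x \<in> space M. F x \<notin> S} + measure M (\<Union>t\<in>S. {x \<in> space M. (F x = t) \<noteq> (r n x \<in> B t)})"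
      using S by (simp only:) (intro measure_Un_le sets.finite_UN, measurable)
    also have "measure M (\<Union>t\<in>S. {x \<in> space M. (F x = t) \<noteq> (r n x \<in> B t)}) \<le>
        (\<Sum>t\<in>S. measure M {x \<in> space M. (F x = t) \<noteq> (r n x \<in> B t)})"
      using S by (intro measure_UNION_le) measurable
    also have "\<dots> \<le> (\<Sum>t\<in>S. d)"
      using B unfolding B' by (intro sum_mono) (auto intro: less_imp_le)
    also have "\<dots> \<le> e / 2" using e by (simp add: d_def field_simps)
    finally have "measure M {x \<in> space M. D x} < e" using notS by simp
    moreover have "F x = F y" if "x \<in> space M" "y \<in> space M" "r n x = r n y" "\<not> D x" "\<not> D y" for x y
      using that by (auto simp: D_def)
    ultimately show "\<exists>D. Measurable.pred M D \<and> measure M {x \<in> space M. D x} < e \<and>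
      (\<forall>x\<in>space M. \<forall>y\<in>space M. r n x = r n y \<longrightarrow> \<not> D x \<longrightarrow> \<not> D y \<longrightarrow> F x = F y)"
      using D by blast
  qed
qed

text \<open>Points of one atom can disagree only if one of them lies in \<open>D\<close>, and either
  case contributes \<open>atom_size n\<close> times the measure of \<open>D\<close>. The factor
  \<open>atom_size n\<close> in the bound is the one that the normalisation of
  \<open>diagonal_vector\<close> divides by.\<close>

lemma nn_integral_disagree_le:
  assumes L: "countable L" and F [measurable]: "F \<in> M \<rightarrow>\<^sub>M count_space L" and e: "e > 0"
  shows "\<exists>n0. \<forall>n\<ge>n0. (\<integral>\<^sup>+x. emeasure M {y \<in> space M. r n y = r n x \<and> F y \<noteq> F x} \<partial>M)
    \<le> ennreal (e * atom_size n)"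
proof -
  obtain n0 where n0: "\<And>n. n \<ge> n0 \<Longrightarrow> \<exists>D. Measurable.pred M D \<and> measure M {x \<in> space M. D x} < e / 2 \<and>
    (\<forall>x\<in>space M. \<forall>y\<in>space M. r n x = r n y \<longrightarrow> \<not> D x \<longrightarrow> \<not> D y \<longrightarrow> F x = F y)"
    using countable_valued_approx[OF L F, of "e / 2"] e by auto
  have "(\<integral>\<^sup>+x. emeasure M {y \<in> space M. r n y = r n x \<and> F y \<noteq> F x} \<partial>M) \<le> ennreal (e * atom_size n)"
    if n: "n \<ge> n0" for n
  proof -
    obtain D where D [measurable]: "Measurable.pred M D" and mD: "measure M {x \<in> space M. D x} < e / 2"
      and DF: "\<And>x y. x \<in> space M \<Longrightarrow> y \<in> space M \<Longrightarrow> r n x = r n y \<Longrightarrow> \<not> D x \<Longrightarrow> \<not> D y \<Longrightarrow> F x = F y"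
      using n0[OF n] by blast
    have "(\<integral>\<^sup>+x. emeasure M {y \<in> space M. r n y = r n x \<and> F y \<noteq> F x} \<partial>M) \<le>
      (\<integral>\<^sup>+x. emeasure M {y \<in> space M. r n y = r n x \<and> D x} + emeasure M {y \<in> space M. r n y = r n x \<and> D y} \<partial>M)"
    proof (rule nn_integral_mono)
      fix x assume x: "x \<in> space M"
      have "emeasure M {y \<in> space M. r n y = r n x \<and> F y \<noteq> F x} \<le> 
        emeasure M ({y \<in> space M. r n y = r n x \<and> D x} \<union> {y \<in> space M. r n y = r n x \<and> D y})"
      proof (rule emeasure_mono, rule subsetI)
        fix y assume "y \<in> {y \<in> space M. r n y = r n x \<and> F y \<noteq> F x}"
        then show "y \<in> {y \<in> space M. r n y = r n x \<and> D x} \<union> {y \<in> space M. r n y = r n x \<and> D y}"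
          using DF[OF x, of y] by (cases "D x"; cases "D y") auto
      qed (use x in measurable)
      also have "\<dots> \<le> emeasure M {y \<in> space M. r n y = r n x \<and> D x} + emeasure M {y \<in> space M. r n y = r n x \<and> D y}"
        using x by (intro emeasure_subadditive) auto
      finally show "emeasure M {y \<in> space M. r n y = r n x \<and> F y \<noteq> F x} \<le> \<dots>" .
    qed
    also have "\<dots> = ennreal (atom_size n) * emeasure M {x \<in> space M. D x} + ennreal (atom_size n) * emeasure M {x \<in> space M. D x}"
      by (subst nn_integral_add) (auto simp: nn_integral_same_fst nn_integral_same_snd)
    also have "\<dots> = ennreal (atom_size n * measure M {x \<in> space M. D x} * 2)"
      using atom_size_pos[of n]
      by (simp add: emeasure_eq_measure ennreal_mult[symmetric] ennreal_plus[symmetric] del: ennreal_plus)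
    also have "\<dots> \<le> ennreal (e * atom_size n)"
      using mD atom_size_pos[of n] by (intro ennreal_leI) (simp add: mult.commute)
    finally show ?thesis .
  qed
  then show ?thesis by blast
qed

end

section \<open>Strict cocycles\<close>

lemma (in group) inv_mult_cancel:
  assumes "x \<in> carrier G" "y \<in> carrier G"
  shows "inv x \<otimes> (x \<otimes> y) = y" "x \<otimes> (inv x \<otimes> y) = y"
  using assms by (simp_all add: m_assoc[symmetric])

context profinite_action
begin

text \<open>\<open>h\<close> reads \<open>F\<close> off a chosen point of the atom that satisfies
  \<open>Q\<close>.\<close>

lemma AE_factor_through_r:
  assumes "\<And>x y. x \<in> space M \<Longrightarrow> y \<in> space M \<Longrightarrow> Q x \<Longrightarrow> Q y \<Longrightarrow> r n x = r n y \<Longrightarrow> F x = F y"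
    and Q: "AE x in M. Q x"
  shows "\<exists>h. AE x in M. F x = h (r n x)"
proof -
  define h where "h a = F (SOME z. z \<in> space M \<and> Q z \<and> r n z = a)" for a
  have "AE x in M. F x = h (r n x)"
    using Q AE_space
  proof eventually_elim
    case (elim x)
    let ?z = "SOME z. z \<in> space M \<and> Q z \<and> r n z = r n x"
    have "?z \<in> space M \<and> Q ?z \<and> r n ?z = r n x"
      using elim by (intro someI[of "\<lambda>z. z \<in> space M \<and> Q z \<and> r n z = r n x" x]) simp
    then show ?case using elim assms(1)[of x ?z] by (simp add: h_def)
  qed
  then show ?thesis by (intro exI[of _ h])
qed

text \<open>The majority principle: two exceptional sets that together do not fill an atom, plus a
  null set, leave a point of the atom outside all three. The comparisons of majority values rest on
  it.\<close>

lemma atom_intersect: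
  assumes A: "emeasure M {y \<in> space M. r n y = a} = ennreal (atom_size n)"
    and B: "{y \<in> space M. r n y = a \<and> \<not> P y} \<in> sets M" "emeasure M {y \<in> space M. r n y = a \<and> \<not> P y} \<le> ennreal b"
    and C: "{y \<in> space M. r n y = a \<and> \<not> Q y} \<in> sets M" "emeasure M {y \<in> space M. r n y = a \<and> \<not> Q y} \<le> ennreal c"
    and bc: "0 \<le> b" "0 \<le> c" "b + c < atom_size n"
    and S: "AE y in M. S y"
  shows "\<exists>y\<in>space M. r n y = a \<and> P y \<and> Q y \<and> S y"
proof (rule ccontr)
  assume "\<not> ?thesis"
  then have no: "\<not> (r n y = a \<and> P y \<and> Q y)" if "S y" "y \<in> space M" for y
    using that by blast
  have "AE y in M. y \<in> {y \<in> space M. r n y = a} \<longrightarrow>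
      y \<in> {y \<in> space M. r n y = a \<and> \<not> P y} \<union> {y \<in> space M. r n y = a \<and> \<not> Q y}"
    using S AE_space by eventually_elim (use no in blast)
  then have "ennreal (atom_size n) \<le> emeasure M ({y \<in> space M. r n y = a \<and> \<not> P y} \<union> {y \<in> space M. r n y = a \<and> \<not> Q y})"
    unfolding A[symmetric] using B C by (intro emeasure_mono_AE) auto
  also have "\<dots> \<le> emeasure M {y \<in> space M. r n y = a \<and> \<not> P y} + emeasure M {y \<in> space M. r n y = a \<and> \<not> Q y}"
    using B C by (intro emeasure_subadditive)
  also have "\<dots> \<le> ennreal b + ennreal c" using B C by (intro add_mono)
  also have "\<dots> = ennreal (b + c)" using bc by simp
  also have "\<dots> < ennreal (atom_size n)" using bc atom_size_pos[of n] by (intro ennreal_lessI) auto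
  finally show False by simp
qed

end

text \<open>The identity is required at every point, so that it gives a genuine action on
  \<open>X \<times> X \<times> \<Lambda>\<close>; \<open>strict_cocycle_of_cocycle\<close> supplies
  such a version of a given cocycle.\<close>

locale strict_cocycle = profinite_action M G act r N0 + L: group L
  for M :: "'x measure" and G :: "('g, 'a) monoid_scheme" (structure)
    and act and r :: "nat \<Rightarrow> 'x \<Rightarrow> 'y" and N0 and L :: "('l, 'b) monoid_scheme" +
  fixes v :: "'g \<Rightarrow> 'x \<Rightarrow> 'l"
  assumes countable_L: "countable (carrier L)"
    and v_measurable: "g \<in> carrier G \<Longrightarrow> v g \<in> M \<rightarrow>\<^sub>M count_space (carrier L)"
    and v_mult: "g \<in> carrier G \<Longrightarrow> h \<in> carrier G \<Longrightarrow> x \<in> space M \<Longrightarrow>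
      v (g \<otimes> h) x = v g (act h x) \<otimes>\<^bsub>L\<^esub> v h x"
begin

abbreviation L_mult (infixl "\<cdot>" 70) where "a \<cdot> b \<equiv> a \<otimes>\<^bsub>L\<^esub> b"
abbreviation "space_L \<equiv> count_space (carrier L)"

lemma v_carrier: "g \<in> carrier G \<Longrightarrow> x \<in> space M \<Longrightarrow> v g x \<in> carrier L"
  using measurable_space[OF v_measurable] by simp

lemma v_one:
  assumes "x \<in> space M" shows "v \<one> x = \<one>\<^bsub>L\<^esub>"
proof -
  have "v \<one> x \<cdot> v \<one> x = v \<one> x" using v_mult[of \<one> \<one> x] assms by (simp add: act_one)
  then show ?thesis using v_carrier[OF one_closed assms] by (simp add: L.l_cancel_one)
qed

lemma v_inv:
  assumes "g \<in> carrier G" "x \<in> space M"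
  shows "v (inv g) (act g x) = inv\<^bsub>L\<^esub> (v g x)"
proof -
  have "v (inv g) (act g x) \<cdot> v g x = \<one>\<^bsub>L\<^esub>"
    using v_mult[of "inv g" g x] assms by (simp add: v_one)
  then show ?thesis using assms by (intro L.inv_equality[symmetric] v_carrier act_space inv_closed)
qed

definition factors :: "nat \<Rightarrow> 'g \<Rightarrow> bool" where
  "factors n g \<longleftrightarrow> (\<exists>h. AE x in M. v g x = h (r n x))"

lemma factors_r_act:
  assumes "g \<in> carrier G" shows "\<exists>h. \<forall>x\<in>space M. r n (act g x) = h (r n x)"
proof (intro exI[of _ "\<lambda>a. r n (act g (SOME x. x \<in> space M \<and> r n x = a))"] ballI)
  fix x assume x: "x \<in> space M"
  have "(SOME z. z \<in> space M \<and> r n z = r n x) \<in> space M \<and> r n (SOME z. z \<in> space M \<and> r n z = r n x) = r n x"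
    using x by (intro someI[of "\<lambda>z. z \<in> space M \<and> r n z = r n x"]) auto
  then show "r n (act g x) = r n (act g (SOME z. z \<in> space M \<and> r n z = r n x))"
    using assms x by (intro r_act) auto
qed

lemma factors_mono:
  assumes "factors m g" "m \<le> n" shows "factors n g"
proof -
  obtain h where h: "AE x in M. v g x = h (r m x)" using assms(1) by (auto simp: factors_def)
  define k where "k a = r m (SOME x. x \<in> space M \<and> r n x = a)" for a
  have k: "k (r n x) = r m x" if x: "x \<in> space M" for x
  proof -
    have "(SOME z. z \<in> space M \<and> r n z = r n x) \<in> space M \<and> r n (SOME z. z \<in> space M \<and> r n z = r n x) = r n x"
      using x by (intro someI[of "\<lambda>z. z \<in> space M \<and> r n z = r n x"]) auto
    then show ?thesis using x unfolding k_def by (intro r_refine[OF assms(2)]) auto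
  qed
  have "AE x in M. v g x = h (k (r n x))" using h AE_space by eventually_elim (simp add: k)
  then show ?thesis unfolding factors_def by (intro exI[of _ "\<lambda>a. h (k a)"])
qed

lemma factors_mult:
  assumes g: "g \<in> carrier G" and k: "k \<in> carrier G" and "factors n g" "factors n k"
  shows "factors n (g \<otimes> k)"
proof -
  obtain a where a: "AE x in M. v g x = a (r n x)" using assms by (auto simp: factors_def)
  obtain b where b: "AE x in M. v k x = b (r n x)" using assms by (auto simp: factors_def)
  obtain c where c: "\<forall>x\<in>space M. r n (act k x) = c (r n x)" using factors_r_act[OF k] by blast
  have "AE x in M. v (g \<otimes> k) x = a (c (r n x)) \<cdot> b (r n x)"
    using AE_act[OF k a] b AE_space
  proof eventually_elim
    case (elim x)
    then show ?case using c g k by (simp add: v_mult)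
  qed
  then show ?thesis unfolding factors_def by (intro exI[of _ "\<lambda>t. a (c t) \<cdot> b t"])
qed

lemma factors_inv:
  assumes g: "g \<in> carrier G" and "factors n g"
  shows "factors n (inv g)"
proof -
  obtain a where a: "AE x in M. v g x = a (r n x)" using assms by (auto simp: factors_def)
  have gi: "inv g \<in> carrier G" using g by simp
  obtain c where c: "\<forall>x\<in>space M. r n (act (inv g) x) = c (r n x)" using factors_r_act[OF gi] by blast
  have "AE x in M. v (inv g) x = inv\<^bsub>L\<^esub> (a (c (r n x)))"
    using AE_act[OF gi a] AE_space
  proof eventually_elim
    case (elim x)
    then show ?case using c g gi v_inv[OF g act_space[OF gi], of x] by (simp add: act_inv)
  qed
  then show ?thesis unfolding factors_def by (intro exI[of _ "\<lambda>t. inv\<^bsub>L\<^esub> (a (c t))"])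
qed

text \<open>Write \<open>\<gamma> g = g' \<gamma>\<close> with \<open>g'\<close> in
  \<open>N0\<close>. Then \<open>v \<gamma> (act g x)\<close> is \<open>v \<gamma> x\<close>
  multiplied on both sides by elements which, almost everywhere, depend only on the atom of
  \<open>x\<close>. So agreement of \<open>v \<gamma>\<close> at two points of an atom is invariant
  under \<open>N0\<close>, and the disagreement \<open>b\<close> is small at almost every point, not
  just on average.\<close>

lemma factors_of_factors_N0:
  assumes N: "\<And>g. g \<in> N0 \<Longrightarrow> factors n g" and \<gamma>: "\<gamma> \<in> carrier G"
  shows "\<exists>m. factors m \<gamma>"
proof -
  have F: "v \<gamma> \<in> M \<rightarrow>\<^sub>M space_L" using \<gamma> by (rule v_measurable)
  have [measurable]: "Measurable.pred (M \<Otimes>\<^sub>M M) (\<lambda>z. v \<gamma> (snd z) = v \<gamma> (fst z))"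
    using measurable_count_space_app2[OF countable_L countable_L
        measurable_compose[OF measurable_snd F] measurable_compose[OF measurable_fst F],
        of "(=)" "count_space UNIV"] by simp
  \<comment> \<open>A fraction below one half is what counts: two points of an atom must share a
    third with which both agree.\<close>
  obtain n0 where n0: "\<And>m. m \<ge> n0 \<Longrightarrow> (\<integral>\<^sup>+x. emeasure M {y \<in> space M. r m y = r m x \<and> v \<gamma> y \<noteq> v \<gamma> x} \<partial>M)
      \<le> ennreal (1/4 * atom_size m)"
    using nn_integral_disagree_le[OF countable_L F, of "1/4"] by auto
  \<comment> \<open>Level \<open>n\<close> makes the cocycle factor on \<open>N0\<close>, level
    \<open>n0\<close> makes the disagreement small.\<close>
  define m where "m = max n n0"
  define b where "b x = emeasure M {y \<in> space M. r m y = r m x \<and> v \<gamma> y \<noteq> v \<gamma> x}" for x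
  have b_meas [measurable]: "b \<in> borel_measurable M"
    unfolding b_def by measurable
  have "AE x in M. b x \<le> ennreal (1/4 * atom_size m)"
  proof (rule invariant_le)
    show "(\<integral>\<^sup>+x. b x \<partial>M) \<le> ennreal (1/4 * atom_size m)"
      unfolding b_def by (intro n0) (simp add: m_def)
    fix g assume g: "g \<in> N0"
    have gG: "g \<in> carrier G" using g by (rule N0_carrier)
    define g' where "g' = \<gamma> \<otimes> g \<otimes> inv \<gamma>"
    have g': "g' \<in> N0" unfolding g'_def using normal.inv_op_closed2[OF normal_N0 \<gamma> g] .
    then have g'G: "g' \<in> carrier G" by (rule N0_carrier)
    have comm: "\<gamma> \<otimes> g = g' \<otimes> \<gamma>" unfolding g'_def using \<gamma> gG by (simp add: m_assoc)
    obtain h where h: "AE x in M. v g x = h (r m x)"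
      using factors_mono[OF N[OF g], of m] by (auto simp: factors_def m_def)
    obtain h' where h': "AE x in M. v g' x = h' (r m x)"
      using factors_mono[OF N[OF g'], of m] by (auto simp: factors_def m_def)
    have gen: "AE x in M. v g x = h (r m x) \<and> v g' (act \<gamma> x) = h' (r m (act \<gamma> x))"
      using h AE_act[OF \<gamma> h'] by eventually_elim simp
    have eq: "v \<gamma> (act g x) = v g' (act \<gamma> x) \<cdot> v \<gamma> x \<cdot> inv\<^bsub>L\<^esub> (v g x)" if x: "x \<in> space M" for x
    proof -
      have "v \<gamma> (act g x) \<cdot> v g x = v g' (act \<gamma> x) \<cdot> v \<gamma> x"
        using v_mult[OF \<gamma> gG x] v_mult[OF g'G \<gamma> x] comm by simp
      then show ?thesis using x \<gamma> gG g'G by (subst L.inv_solve_right) (simp_all add: v_carrier act_space)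
    qed
    show "AE x in M. b (act g x) = b x"
      using gen AE_space
    proof eventually_elim
      case (elim x)
      then have x: "x \<in> space M" "v g x = h (r m x)" "v g' (act \<gamma> x) = h' (r m (act \<gamma> x))" by auto
      have gx: "act g x \<in> space M" using gG x by (intro act_space)
      have [measurable]: "act g \<in> M \<rightarrow>\<^sub>M M" using gG by (rule act_measurable)
      have "b (act g x) = emeasure M {y \<in> space M. r m (act g y) = r m (act g x) \<and> v \<gamma> (act g y) \<noteq> v \<gamma> (act g x)}"
        unfolding b_def 
      proof (rule emeasure_act[OF gG, symmetric])
        have "v \<gamma> (act g x) \<in> carrier L" using \<gamma> gx by (rule v_carrier)
        then show "Measurable.pred M (\<lambda>y. r m y = r m (act g x) \<and> v \<gamma> y \<noteq> v \<gamma> (act g x))"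
          using F gx by measurable
      qed
      also have "\<dots> = b x" unfolding b_def
      proof (rule emeasure_eq_AE)
        show "AE y in M. y \<in> {y \<in> space M. r m (act g y) = r m (act g x) \<and> v \<gamma> (act g y) \<noteq> v \<gamma> (act g x)} \<longleftrightarrow>
            y \<in> {y \<in> space M. r m y = r m x \<and> v \<gamma> y \<noteq> v \<gamma> x}"
          using gen AE_space
        proof eventually_elim
          case (elim y)
          have "v \<gamma> (act g y) = v \<gamma> (act g x) \<longleftrightarrow> v \<gamma> y = v \<gamma> x" if s: "r m y = r m x"
          proof -
            have 1: "v g y = v g x" using elim x s by simp
            have 2: "v g' (act \<gamma> y) = v g' (act \<gamma> x)" using elim x s r_act_iff[OF \<gamma>, of y x m] by simp
            have c: "v g' (act \<gamma> x) \<in> carrier L" "inv\<^bsub>L\<^esub> (v g x) \<in> carrier L" "v \<gamma> y \<in> carrier L" "v \<gamma> x \<in> carrier L"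
              using x(1) elim(2) gG g'G \<gamma> by (simp_all add: v_carrier act_space)
            show ?thesis unfolding eq[OF x(1)] eq[OF elim(2)] 1 2 using c by simp
          qed
          then show ?case using elim x gG by (auto simp: r_act_iff)
        qed
        have "v \<gamma> (act g x) \<in> carrier L" using \<gamma> gx by (rule v_carrier)
        moreover have "(\<lambda>y. v \<gamma> (act g y)) \<in> M \<rightarrow>\<^sub>M space_L"
          by (rule measurable_compose[OF act_measurable[OF gG] F])
        ultimately show "{y \<in> space M. r m (act g y) = r m (act g x) \<and> v \<gamma> (act g y) \<noteq> v \<gamma> (act g x)} \<in> sets M"
          using gx by measurable
        have "v \<gamma> x \<in> carrier L" using \<gamma> x(1) by (rule v_carrier)
        then show "{y \<in> space M. r m y = r m x \<and> v \<gamma> y \<noteq> v \<gamma> x} \<in> sets M"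
          using x(1) F by measurable
      qed
      finally show ?case .
    qed
  qed measurable
  then have gen: "AE x in M. b x \<le> ennreal (1/4 * atom_size m) \<and>
      emeasure M {y \<in> space M. r m y = r m x} = ennreal (atom_size m)"
    using AE_atom_size by eventually_elim simp
  have "factors m \<gamma>" unfolding factors_def
  proof (rule AE_factor_through_r[OF _ gen])
    fix x z assume xz: "x \<in> space M" "z \<in> space M" "r m x = r m z"
      and gx: "b x \<le> ennreal (1/4 * atom_size m) \<and> emeasure M {y \<in> space M. r m y = r m x} = ennreal (atom_size m)"
      and gz: "b z \<le> ennreal (1/4 * atom_size m) \<and> emeasure M {y \<in> space M. r m y = r m z} = ennreal (atom_size m)"
    have meas: "{y \<in> space M. r m y = r m u \<and> v \<gamma> y \<noteq> v \<gamma> u} \<in> sets M" if "u \<in> space M" for u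
    proof -
      have "v \<gamma> u \<in> carrier L" using \<gamma> that by (rule v_carrier)
      then show ?thesis using that F by measurable
    qed
    have "\<exists>y\<in>space M. r m y = r m x \<and> v \<gamma> y = v \<gamma> x \<and> v \<gamma> y = v \<gamma> z \<and> True"
      using gx gz xz meas[of x] meas[of z] atom_size_pos[of m]
      by (intro atom_intersect[of m "r m x" _ "1/4 * atom_size m" _ "1/4 * atom_size m"]) (auto simp: b_def)
    then show "v \<gamma> x = v \<gamma> z" by auto
  qed
  then show ?thesis ..
qed

text \<open>Elements that factor at a given level are closed under products and inverses. A level
  that serves \<open>N0\<close> and lifts of finitely many generators of the quotient therefore
  serves every coset, by induction on the generated subgroup.\<close>

lemma factors_all:
  assumes N: "\<And>g. g \<in> N0 \<Longrightarrow> factors n g" and fg: "finitely_generated_group (G Mod N0)"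
  shows "\<exists>m. \<forall>g\<in>carrier G. factors m g"
proof -
  interpret N: normal N0 G by (rule normal_N0)
  obtain S where S: "finite S" "S \<subseteq> carrier (G Mod N0)" "generate (G Mod N0) S = carrier (G Mod N0)"
    using fg by (auto simp: finitely_generated_group_def)
  have "\<exists>\<gamma>. \<gamma> \<in> carrier G \<and> C = N0 #> \<gamma>" if "C \<in> S" for C
    using S(2) that by (auto simp: FactGroup_def RCOSETS_def)
  then obtain s where s: "\<And>C. C \<in> S \<Longrightarrow> s C \<in> carrier G" "\<And>C. C \<in> S \<Longrightarrow> C = N0 #> s C" by metis
  have "\<exists>m. factors m (s C)" if "C \<in> S" for C using factors_of_factors_N0[OF N s(1)[OF that]] by blast
  then obtain mm where mm: "\<And>C. C \<in> S \<Longrightarrow> factors (mm C) (s C)" by metis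
  define m where "m = Max (insert n (mm ` S))"
  have mN: "factors m g" if "g \<in> N0" for g
    using N[OF that] by (rule factors_mono) (use S(1) in \<open>auto simp: m_def\<close>)
  have mS: "factors m (s C)" if "C \<in> S" for C
    using mm[OF that] by (rule factors_mono) (use S(1) that in \<open>auto simp: m_def\<close>)
  define Hm where "Hm = {g \<in> carrier G. factors m g}"
  have sC: "C \<subseteq> Hm" if C: "C \<in> S" for C
  proof
    fix g assume "g \<in> C"
    then have "g \<in> N0 #> s C" using s(2)[OF C] by simp
    then obtain k where "k \<in> N0" "g = k \<otimes> s C" by (auto simp: r_coset_def)
    then show "g \<in> Hm" using mN mS[OF C] s(1)[OF C] N0_carrier by (auto simp: Hm_def intro: factors_mult)
  qed
  have "C \<subseteq> Hm" if "C \<in> generate (G Mod N0) S" for C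
    using that
  proof induction
    case one
    then show ?case using mN N0_carrier by (auto simp: Hm_def)
  next
    case (incl C)
    then show ?case by (rule sC)
  next
    case (inv C)
    have "inv\<^bsub>G Mod N0\<^esub> C = set_inv C" using inv S(2) by (intro N.inv_FactGroup) auto
    then show ?case using sC[OF inv] by (auto simp: SET_INV_def Hm_def intro!: factors_inv)
  next
    case (eng C1 C2)
    then show ?case by (fastforce simp: set_mult_def Hm_def intro!: factors_mult)
  qed
  then have all: "C \<subseteq> Hm" if "C \<in> carrier (G Mod N0)" for C using that S(3) by auto
  have "factors m g" if g: "g \<in> carrier G" for g
  proof -
    have "N0 #> g \<in> carrier (G Mod N0)" using g by (auto simp: FactGroup_def RCOSETS_def)
    moreover have "g \<in> N0 #> g" using g by (rule rcos_self[OF _ normal_imp_subgroup[OF normal_N0]])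
    ultimately show ?thesis using all by (auto simp: Hm_def)
  qed
  then show ?thesis by blast
qed

end

section \<open>Invariant kernels\<close>

text \<open>\<open>P x y t\<close> says that a partially defined \<open>\<Lambda>\<close>-valued kernel takes the value \<open>t\<close> at \<open>(x, y)\<close>.
  It is kept as a relation, so that it can be undefined. The bound \<open>1 / 100\<close> leaves room for the
  majority arguments below, where the exceptional sets add up to \<open>28 / 100\<close> of an atom.\<close>

locale invariant_kernel = strict_cocycle M G act r N0 L v
  for M :: "'x measure" and G :: "('g, 'a) monoid_scheme" (structure)
    and act and r :: "nat \<Rightarrow> 'x \<Rightarrow> 'y" and N0 and L :: "('l, 'b) monoid_scheme" and v +
  fixes n :: nat and P :: "'x \<Rightarrow> 'x \<Rightarrow> 'l \<Rightarrow> bool"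
  assumes P_measurable: "t \<in> carrier L \<Longrightarrow> Measurable.pred (M \<Otimes>\<^sub>M M) (\<lambda>z. P (fst z) (snd z) t)"
    and P_functional: "P x y s \<Longrightarrow> P x y t \<Longrightarrow> s = t"
    and P_carrier: "P x y t \<Longrightarrow> t \<in> carrier L"
    and P_invariant: "g \<in> N0 \<Longrightarrow> AE x in M. AE y in M. \<forall>t\<in>carrier L.
      P (act g x) (act g y) (v g x \<cdot> t \<cdot> inv\<^bsub>L\<^esub> (v g y)) \<longleftrightarrow> P x y t"
    and P_small: "(\<integral>\<^sup>+x. emeasure M {y \<in> space M. r n y = r n x \<and> \<not> P x y \<one>\<^bsub>L\<^esub>} \<partial>M)
      \<le> ennreal (1/100 * atom_size n)"
begin

abbreviation "c \<equiv> atom_size n"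

lemma P_pred:
  assumes "p \<in> K \<rightarrow>\<^sub>M M" "h \<in> K \<rightarrow>\<^sub>M M" "t \<in> carrier L"
  shows "Measurable.pred K (\<lambda>z. P (p z) (h z) t)"
  using measurable_compose[OF measurable_Pair[OF assms(1,2)] P_measurable[OF assms(3)]] by simp

text \<open>The existential form demands that all three values of the kernel are defined.\<close>

definition multiplicative :: "'x \<Rightarrow> 'x \<Rightarrow> 'x \<Rightarrow> bool" where
  "multiplicative x y y' \<longleftrightarrow> (\<exists>s\<in>carrier L. \<exists>t\<in>carrier L. P x y s \<and> P y y' t \<and> P x y' (s \<cdot> t))"

lemma multiplicative_pred [measurable (raw)]:
  assumes "p \<in> K \<rightarrow>\<^sub>M M" "h \<in> K \<rightarrow>\<^sub>M M" "k \<in> K \<rightarrow>\<^sub>M M"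
  shows "Measurable.pred K (\<lambda>z. multiplicative (p z) (h z) (k z))"
  unfolding multiplicative_def
  by (intro pred_countable_bounded(2) countable_L pred_intros_logic P_pred assms L.m_closed)

definition equivariant :: "'g \<Rightarrow> 'x \<Rightarrow> 'x \<Rightarrow> bool" where
  "equivariant g x y \<longleftrightarrow> (\<forall>t\<in>carrier L.
      P (act g x) (act g y) (v g x \<cdot> t \<cdot> inv\<^bsub>L\<^esub> (v g y)) \<longleftrightarrow> P x y t)"

lemma equivariant_iff:
  assumes "g \<in> carrier G" "x \<in> space M" "y \<in> space M" "equivariant g x y"
  shows "P (act g x) (act g y) s' \<longleftrightarrow> (\<exists>s\<in>carrier L. s' = v g x \<cdot> s \<cdot> inv\<^bsub>L\<^esub> (v g y) \<and> P x y s)"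
proof
  assume p: "P (act g x) (act g y) s'"
  then have s': "s' \<in> carrier L" by (rule P_carrier)
  have vv: "v g x \<in> carrier L" "v g y \<in> carrier L" using assms by (auto intro: v_carrier)
  define s where "s = inv\<^bsub>L\<^esub> (v g x) \<cdot> s' \<cdot> v g y"
  have s: "s \<in> carrier L" unfolding s_def using s' vv by simp
  have "s' = v g x \<cdot> s \<cdot> inv\<^bsub>L\<^esub> (v g y)"
    unfolding s_def using s' vv by (simp add: L.m_assoc L.inv_mult_cancel)
  then show "\<exists>s\<in>carrier L. s' = v g x \<cdot> s \<cdot> inv\<^bsub>L\<^esub> (v g y) \<and> P x y s"
    using p s assms(4) by (auto simp: equivariant_def)
next
  assume "\<exists>s\<in>carrier L. s' = v g x \<cdot> s \<cdot> inv\<^bsub>L\<^esub> (v g y) \<and> P x y s"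
  then show "P (act g x) (act g y) s'" using assms(4) by (auto simp: equivariant_def)
qed

text \<open>The two inner factors \<open>v g y\<close> cancel in the product of the transformed
  values.\<close>

lemma multiplicative_act:
  assumes g: "g \<in> carrier G" and x: "x \<in> space M" and y: "y \<in> space M" and z: "z \<in> space M"
    and xy: "equivariant g x y" and yz: "equivariant g y z" and xz: "equivariant g x z"
  shows "multiplicative (act g x) (act g y) (act g z) \<longleftrightarrow> multiplicative x y z"
proof -
  have vv: "v g x \<in> carrier L" "v g y \<in> carrier L" "v g z \<in> carrier L"
    using g x y z by (auto intro: v_carrier)
  have mult: "(v g x \<cdot> s \<cdot> inv\<^bsub>L\<^esub> (v g y)) \<cdot> (v g y \<cdot> t \<cdot> inv\<^bsub>L\<^esub> (v g z)) =
      v g x \<cdot> (s \<cdot> t) \<cdot> inv\<^bsub>L\<^esub> (v g z)" if st: "s \<in> carrier L" "t \<in> carrier L" for s t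
    using vv st by (simp add: L.m_assoc L.inv_mult_cancel)
  show ?thesis
  proof
    assume "multiplicative x y z"
    then obtain s t where st: "s \<in> carrier L" "t \<in> carrier L" "P x y s" "P y z t" "P x z (s \<cdot> t)"
      by (auto simp: multiplicative_def)
    have "P (act g x) (act g y) (v g x \<cdot> s \<cdot> inv\<^bsub>L\<^esub> (v g y))"
      "P (act g y) (act g z) (v g y \<cdot> t \<cdot> inv\<^bsub>L\<^esub> (v g z))"
      "P (act g x) (act g z) (v g x \<cdot> (s \<cdot> t) \<cdot> inv\<^bsub>L\<^esub> (v g z))"
      using st xy yz xz unfolding equivariant_def by auto
    then show "multiplicative (act g x) (act g y) (act g z)"
      unfolding multiplicative_def using mult[OF st(1,2)] P_carrier by metis
  next
    assume "multiplicative (act g x) (act g y) (act g z)"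
    then obtain s' t' where st': "P (act g x) (act g y) s'" "P (act g y) (act g z) t'"
      "P (act g x) (act g z) (s' \<cdot> t')"
      by (auto simp: multiplicative_def)
    obtain s where s: "s \<in> carrier L" "s' = v g x \<cdot> s \<cdot> inv\<^bsub>L\<^esub> (v g y)" "P x y s"
      using st'(1) equivariant_iff[OF g x y xy] by auto
    obtain t where t: "t \<in> carrier L" "t' = v g y \<cdot> t \<cdot> inv\<^bsub>L\<^esub> (v g z)" "P y z t"
      using st'(2) equivariant_iff[OF g y z yz] by auto
    have "P (act g x) (act g z) (v g x \<cdot> (s \<cdot> t) \<cdot> inv\<^bsub>L\<^esub> (v g z))"
      using st'(3) mult[OF s(1) t(1)] s(2) t(2) by simp
    then have "P x z (s \<cdot> t)" using xz s t by (auto simp: equivariant_def)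
    then show "multiplicative x y z" unfolding multiplicative_def using s t by blast
  qed
qed

section \<open>The defect of multiplicativity\<close>

definition fibre_defect :: "'x \<Rightarrow> 'x \<Rightarrow> ennreal" where
  "fibre_defect x y = emeasure M {z \<in> space M. r n y = r n x \<and> r n z = r n x \<and> \<not> multiplicative x y z}"

text \<open>\<open>fibre_defect x y\<close> vanishes for \<open>y\<close> outside the atom of
  \<open>x\<close>, so this is the measure of the bad pairs in the square of that atom, to be
  compared with \<open>c * c\<close>.\<close>

definition defect :: "'x \<Rightarrow> ennreal" where "defect x = (\<integral>\<^sup>+y. fibre_defect x y \<partial>M)"

definition unit_defect :: "'x \<Rightarrow> ennreal" where
  "unit_defect x = emeasure M {y \<in> space M. r n y = r n x \<and> \<not> P x y \<one>\<^bsub>L\<^esub>}"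

lemma fibre_defect_measurable [measurable]: "(\<lambda>z. fibre_defect (fst z) (snd z)) \<in> borel_measurable (M \<Otimes>\<^sub>M M)"
  unfolding fibre_defect_def by measurable

lemma fibre_defect_measurable2: "x \<in> space M \<Longrightarrow> fibre_defect x \<in> borel_measurable M"
  using measurable_compose_Pair1[OF _ fibre_defect_measurable, of x] by simp

lemma defect_measurable [measurable]: "defect \<in> borel_measurable M"
proof -
  have "(\<lambda>x. \<integral>\<^sup>+y. fibre_defect (fst (x, y)) (snd (x, y)) \<partial>M) \<in> borel_measurable M"
    by (rule borel_measurable_nn_integral_fst[OF fibre_defect_measurable])
  then show ?thesis unfolding defect_def by simp
qed

lemma P_one_measurable [measurable (raw)]:
  assumes "p \<in> K \<rightarrow>\<^sub>M M" "h \<in> K \<rightarrow>\<^sub>M M"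
  shows "Measurable.pred K (\<lambda>z. P (p z) (h z) \<one>\<^bsub>L\<^esub>)"
  using assms by (rule P_pred) simp

lemma unit_defect_measurable [measurable]: "unit_defect \<in> borel_measurable M"
  unfolding unit_defect_def by measurable

text \<open>As \<open>1 = 1 * 1\<close>, multiplicativity at \<open>x, y, z\<close> can fail only if
  one of the three pairs does not carry the value one. Each pair contributes \<open>c\<close> times
  the bound in \<open>P_small\<close>.\<close>

lemma defect_integral: "(\<integral>\<^sup>+x. defect x \<partial>M) \<le> ennreal (3/100 * c * c)"
proof -
  interpret PP: pair_prob_space M M ..
  define i :: "'x \<Rightarrow> 'x \<Rightarrow> ennreal" where "i x y = (if r n y = r n x then 1 else 0)" for x y
  have i_meas [measurable]: "(\<lambda>z. i (fst z) (snd z)) \<in> borel_measurable (M \<Otimes>\<^sub>M M)"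
    unfolding i_def by measurable
  have i_meas2 [measurable]: "i x \<in> borel_measurable M" if "x \<in> space M" for x
    using measurable_compose_Pair1[OF that i_meas] by simp
  have i_int: "(\<integral>\<^sup>+y. i x y \<partial>M) = emeasure M {y \<in> space M. r n y = r n x}" if "x \<in> space M" for x
  proof -
    have "(\<integral>\<^sup>+y. i x y \<partial>M) = (\<integral>\<^sup>+y. indicator {y \<in> space M. r n y = r n x} y \<partial>M)"
      by (intro nn_integral_cong) (auto simp: i_def)
    then show ?thesis using that by simp
  qed
  \<comment> \<open>The contribution of the pair \<open>(y, z)\<close>. Its mean is found by
    integrating over \<open>x\<close> first, which yields the atom size \<open>c\<close>.\<close>
  define q where "q x = (\<integral>\<^sup>+y. i x y * unit_defect y \<partial>M)" for x
  have q_meas [measurable]: "q \<in> borel_measurable M"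
  proof -
    have "(\<lambda>x. \<integral>\<^sup>+y. (\<lambda>z. i (fst z) (snd z) * unit_defect (snd z)) (x, y) \<partial>M) \<in> borel_measurable M"
      by (rule borel_measurable_nn_integral_fst) measurable
    then show ?thesis unfolding q_def by simp
  qed
  have "AE x in M. defect x \<le> 2 * (ennreal c * unit_defect x) + q x"
    using AE_atom_size[of n] AE_space
  proof eventually_elim
    case (elim x)
    have x: "x \<in> space M" using elim by simp
    define j :: "'x \<Rightarrow> ennreal" where "j y = indicator {y \<in> space M. r n y = r n x \<and> \<not> P x y \<one>\<^bsub>L\<^esub>} y" for y
    have j_meas [measurable]: "j \<in> borel_measurable M" unfolding j_def using x by measurable
    have "fibre_defect x y \<le> ennreal c * j y + i x y * unit_defect y + unit_defect x * i x y" if y: "y \<in> space M" for y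
    proof (cases "r n y = r n x")
      case False
      then show ?thesis by (simp add: fibre_defect_def)
    next
      case True
      have "fibre_defect x y \<le> emeasure M ({z \<in> space M. r n z = r n x \<and> \<not> P x y \<one>\<^bsub>L\<^esub>} \<union>
          ({z \<in> space M. r n z = r n y \<and> \<not> P y z \<one>\<^bsub>L\<^esub>} \<union> {z \<in> space M. r n z = r n x \<and> \<not> P x z \<one>\<^bsub>L\<^esub>}))"
        unfolding fibre_defect_def
      proof (rule emeasure_mono)
        show "{z \<in> space M. r n y = r n x \<and> r n z = r n x \<and> \<not> multiplicative x y z} \<subseteq>
          {z \<in> space M. r n z = r n x \<and> \<not> P x y \<one>\<^bsub>L\<^esub>} \<union>
          ({z \<in> space M. r n z = r n y \<and> \<not> P y z \<one>\<^bsub>L\<^esub>} \<union> {z \<in> space M. r n z = r n x \<and> \<not> P x z \<one>\<^bsub>L\<^esub>})"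
          using True unfolding multiplicative_def by (auto; metis L.one_closed L.l_one)
      qed (use x y in measurable)
      also have "\<dots> \<le> emeasure M {z \<in> space M. r n z = r n x \<and> \<not> P x y \<one>\<^bsub>L\<^esub>} + (unit_defect y + unit_defect x)"
        unfolding unit_defect_def using x y
        by (intro emeasure_subadditive[THEN order_trans] add_left_mono emeasure_subadditive) measurable
      also have "emeasure M {z \<in> space M. r n z = r n x \<and> \<not> P x y \<one>\<^bsub>L\<^esub>} = ennreal c * j y"
        using elim y True by (auto simp: j_def indicator_def)
      finally show ?thesis using True by (simp add: i_def add.assoc)
    qed
    then have "defect x \<le> (\<integral>\<^sup>+y. ennreal c * j y + i x y * unit_defect y + unit_defect x * i x y \<partial>M)"
      unfolding defect_def by (intro nn_integral_mono)
    also have "\<dots> = ennreal c * (\<integral>\<^sup>+y. j y \<partial>M) + q x + unit_defect x * (\<integral>\<^sup>+y. i x y \<partial>M)"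
      using x by (simp add: nn_integral_add nn_integral_cmult q_def)
    also have "(\<integral>\<^sup>+y. j y \<partial>M) = unit_defect x" unfolding j_def unit_defect_def using x by (intro nn_integral_indicator) measurable
    also have "(\<integral>\<^sup>+y. i x y \<partial>M) = ennreal c" using i_int[OF x] elim by simp
    also have "ennreal c * unit_defect x + q x + unit_defect x * ennreal c = 2 * (ennreal c * unit_defect x) + q x"
      by (simp add: mult.commute mult_2 ac_simps)
    finally show ?case .
  qed
  then have "(\<integral>\<^sup>+x. defect x \<partial>M) \<le> (\<integral>\<^sup>+x. 2 * (ennreal c * unit_defect x) + q x \<partial>M)" by (rule nn_integral_mono_AE)
  also have "\<dots> = 2 * (ennreal c * (\<integral>\<^sup>+x. unit_defect x \<partial>M)) + (\<integral>\<^sup>+x. q x \<partial>M)"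
    by (simp add: nn_integral_add nn_integral_cmult)
  also have "(\<integral>\<^sup>+x. q x \<partial>M) = ennreal c * (\<integral>\<^sup>+x. unit_defect x \<partial>M)"
  proof -
    have "(\<integral>\<^sup>+x. q x \<partial>M) = (\<integral>\<^sup>+y. \<integral>\<^sup>+x. (\<lambda>z. i (fst z) (snd z) * unit_defect (snd z)) (x, y) \<partial>M \<partial>M)"
      unfolding q_def by (subst PP.Fubini') (simp_all add: case_prod_beta')
    also have "\<dots> = (\<integral>\<^sup>+y. ennreal c * unit_defect y \<partial>M)"
    proof (rule nn_integral_cong_AE, use AE_atom_size[of n] AE_space in eventually_elim)
      case (elim y)
      have "(\<integral>\<^sup>+x. i x y * unit_defect y \<partial>M) = (\<integral>\<^sup>+x. unit_defect y * i y x \<partial>M)"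
        by (intro nn_integral_cong) (auto simp: i_def)
      also have "\<dots> = unit_defect y * (\<integral>\<^sup>+x. i y x \<partial>M)" using elim by (intro nn_integral_cmult) simp
      finally show ?case using i_int[of y] elim by (simp add: mult.commute)
    qed
    finally show ?thesis by (simp add: nn_integral_cmult)
  qed
  also have "2 * (ennreal c * (\<integral>\<^sup>+x. unit_defect x \<partial>M)) + ennreal c * (\<integral>\<^sup>+x. unit_defect x \<partial>M) \<le>
      2 * (ennreal c * ennreal (1/100 * c)) + ennreal c * ennreal (1/100 * c)"
    using P_small unfolding unit_defect_def by (intro add_mono mult_left_mono) auto
  also have "\<dots> = ennreal (3/100 * c * c)"
  proof -
    have c: "0 \<le> c" using atom_size_pos[of n] by simp
    have "ennreal c * ennreal (1/100 * c) = ennreal (c * (1/100 * c))" using c by (intro ennreal_mult[symmetric]) auto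
    moreover have "2 * ennreal (c * (1/100 * c)) = ennreal (2 * (c * (1/100 * c)))"
      by (subst ennreal_mult') auto
    ultimately show ?thesis using c by (simp add: ennreal_plus[symmetric] del: ennreal_plus)
  qed
  finally show ?thesis .
qed

text \<open>Both \<open>y\<close> and \<open>z\<close> are replaced by their translates, which
  preserves the measure; \<open>multiplicative_act\<close> then identifies the sets up to null
  sets.\<close>

lemma defect_invariant:
  assumes g: "g \<in> N0" shows "AE x in M. defect (act g x) = defect x"
proof -
  have gG: "g \<in> carrier G" using g by (rule N0_carrier)
  have [measurable]: "act g \<in> M \<rightarrow>\<^sub>M M" using gG by (rule act_measurable)
  have I: "AE x in M. AE y in M. equivariant g x y" using P_invariant[OF g] unfolding equivariant_def .
  show ?thesis using I AE_space
  proof eventually_elim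
    case (elim x)
    then have x: "x \<in> space M" and Ix: "AE y in M. equivariant g x y" by auto
    have gx: "act g x \<in> space M" using gG x by (rule act_space)
    have "defect (act g x) = (\<integral>\<^sup>+y. fibre_defect (act g x) (act g y) \<partial>M)"
      unfolding defect_def using gG fibre_defect_measurable2[OF gx] by (rule nn_integral_act[symmetric])
    also have "\<dots> = defect x" unfolding defect_def
    proof (rule nn_integral_cong_AE, use I Ix AE_space in eventually_elim)
      case (elim y)
      then have y: "y \<in> space M" "equivariant g x y" and Iy: "AE z in M. equivariant g y z" by auto
      have gy: "act g y \<in> space M" using gG y by (intro act_space)
      have "fibre_defect (act g x) (act g y) = emeasure M {z \<in> space M. r n (act g y) = r n (act g x) \<and>
          r n (act g z) = r n (act g x) \<and> \<not> multiplicative (act g x) (act g y) (act g z)}"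
        unfolding fibre_defect_def by (rule emeasure_act[OF gG, symmetric]) (use gx gy in measurable)
      also have "\<dots> = fibre_defect x y" unfolding fibre_defect_def
      proof (rule emeasure_eq_AE)
        show "AE z in M. z \<in> {z \<in> space M. r n (act g y) = r n (act g x) \<and>
            r n (act g z) = r n (act g x) \<and> \<not> multiplicative (act g x) (act g y) (act g z)} \<longleftrightarrow>
          z \<in> {z \<in> space M. r n y = r n x \<and> r n z = r n x \<and> \<not> multiplicative x y z}"
          using Ix Iy AE_space
        proof eventually_elim
          case (elim z)
          then show ?case using multiplicative_act[OF gG x y(1) _ y(2), of z] x y gG by (simp add: r_act_iff)
        qed
      qed (use x y gx gy in measurable)
      finally show "fibre_defect (act g x) (act g y) = fibre_defect x y" .
    qed
    finally show ?case .
  qed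
qed

definition generic :: "'x \<Rightarrow> bool" where
  "generic x \<longleftrightarrow> defect x \<le> ennreal (3/100 * c * c) \<and> emeasure M {y \<in> space M. r n y = r n x} = ennreal c"

lemma generic_measurable [measurable]: "Measurable.pred M generic"
  unfolding generic_def by measurable

text \<open>Ergodicity of \<open>N0\<close> turns the mean bound on the invariant function
  \<open>defect\<close> into a bound at almost every point.\<close>

lemma AE_generic: "AE x in M. generic x"
proof -
  have "AE x in M. defect x \<le> ennreal (3/100 * c * c)"
    by (rule invariant_le[OF defect_measurable defect_invariant defect_integral])
  then show ?thesis using AE_atom_size[of n] unfolding generic_def by eventually_elim simp
qed

section \<open>Comparing the points of one atom: the gauge\<close>

definition proportional :: "'x \<Rightarrow> 'x \<Rightarrow> 'l \<Rightarrow> 'x \<Rightarrow> bool" where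
  "proportional x z u y \<longleftrightarrow> (\<exists>t\<in>carrier L. P z y t \<and> P x y (u \<cdot> t))"

lemma proportional_pred [measurable (raw)]:
  assumes "p \<in> K \<rightarrow>\<^sub>M M" "h \<in> K \<rightarrow>\<^sub>M M" "k \<in> K \<rightarrow>\<^sub>M M" "u \<in> carrier L"
  shows "Measurable.pred K (\<lambda>w. proportional (p w) (h w) u (k w))"
  unfolding proportional_def
  by (intro pred_countable_bounded(2) countable_L pred_intros_logic P_pred assms L.m_closed)

text \<open>Let \<open>y\<close> be good for both points and let \<open>u\<close> be the value at
  \<open>(x, y)\<close> times the inverse of the value at \<open>(z, y)\<close>. For any
  \<open>w\<close> multiplicative with both, the values at \<open>(x, w)\<close> and
  \<open>(z, w)\<close> arise from those at \<open>y\<close> by the same right factor, the value at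
  \<open>(y, w)\<close>, so their ratio is again \<open>u\<close>.\<close>

lemma proportional_exists:
  assumes x: "x \<in> space M" "generic x" and z: "z \<in> space M" "generic z" and xz: "r n x = r n z"
  shows "\<exists>u\<in>carrier L. emeasure M {y \<in> space M. r n y = r n x \<and> \<not> proportional x z u y} \<le> ennreal (7/100 * c)"
proof -
  have c: "c > 0" by (rule atom_size_pos)
  have A: "emeasure M {y \<in> space M. r n y = r n x} = ennreal c" using x by (simp add: generic_def)
  \<comment> \<open>The two defects add up to at most \<open>6/100 * c * c\<close> over an atom of
    size \<open>c\<close>, so the fibre defects cannot exceed \<open>7/100 * c\<close> at every
    \<open>y\<close>.\<close>
  have "\<exists>y\<in>space M. r n y = r n x \<and> fibre_defect x y + fibre_defect z y \<le> ennreal (7/100 * c)"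
  proof (rule ccontr)
    assume "\<not> ?thesis"
    then have "ennreal (7/100 * c) * indicator {y \<in> space M. r n y = r n x} y \<le> fibre_defect x y + fibre_defect z y" if "y \<in> space M" for y
      using that by (auto simp: indicator_def not_le intro: less_imp_le)
    then have "(\<integral>\<^sup>+y. ennreal (7/100 * c) * indicator {y \<in> space M. r n y = r n x} y \<partial>M) \<le> (\<integral>\<^sup>+y. fibre_defect x y + fibre_defect z y \<partial>M)"
      by (rule nn_integral_mono)
    also have "\<dots> = defect x + defect z" unfolding defect_def using x z by (intro nn_integral_add fibre_defect_measurable2)
    also have "\<dots> \<le> ennreal (3/100 * c * c) + ennreal (3/100 * c * c)"
      using x z by (intro add_mono) (auto simp: generic_def)
    also have "\<dots> = ennreal (6/100 * c * c)" using c by (simp add: ennreal_plus[symmetric] del: ennreal_plus)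
    also have "(\<integral>\<^sup>+y. ennreal (7/100 * c) * indicator {y \<in> space M. r n y = r n x} y \<partial>M) = ennreal (7/100 * c) * ennreal c"
      using x by (subst nn_integral_cmult_indicator) (auto simp: A)
    also have "\<dots> = ennreal (7/100 * c * c)" using c by (intro ennreal_mult[symmetric]) auto
    finally have "7/100 * c * c \<le> 6/100 * c * c" using c by (subst (asm) ennreal_le_iff) auto
    then show False using c by simp
  qed
  then obtain y where y: "y \<in> space M" "r n y = r n x" and fy: "fibre_defect x y + fibre_defect z y \<le> ennreal (7/100 * c)" by blast
  have fx: "fibre_defect x y = emeasure M {w \<in> space M. r n w = r n x \<and> \<not> multiplicative x y w}"
    and fz: "fibre_defect z y = emeasure M {w \<in> space M. r n w = r n x \<and> \<not> multiplicative z y w}"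
    unfolding fibre_defect_def using y xz by auto
  have mx: "{w \<in> space M. r n w = r n x \<and> \<not> multiplicative x y w} \<in> sets M" using x y by measurable
  have mz: "{w \<in> space M. r n w = r n x \<and> \<not> multiplicative z y w} \<in> sets M" using x z y by measurable
  have le: "fibre_defect x y \<le> ennreal (7/100 * c)" "fibre_defect z y \<le> ennreal (7/100 * c)"
    by (rule order_trans[OF _ fy], simp)+
  have "\<exists>w\<in>space M. r n w = r n x \<and> multiplicative x y w \<and> multiplicative z y w \<and> True"
    using mx mz le c unfolding fx fz by (intro atom_intersect[OF A, of _ "7/100 * c" _ "7/100 * c"]) auto
  then obtain s t where s: "s \<in> carrier L" "P x y s" and t: "t \<in> carrier L" "P z y t"
    by (auto simp: multiplicative_def)
  define u where "u = s \<cdot> inv\<^bsub>L\<^esub> t"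
  have u: "u \<in> carrier L" using s t by (simp add: u_def)
  have good: "proportional x z u w" if dx: "multiplicative x y w" and dz: "multiplicative z y w" for w
  proof -
    obtain s' a where 1: "P x y s'" "P y w a" "P x w (s' \<cdot> a)" and a: "a \<in> carrier L" using dx by (auto simp: multiplicative_def)
    obtain t' a' where 2: "P z y t'" "P y w a'" "P z w (t' \<cdot> a')" using dz by (auto simp: multiplicative_def)
    have eqs: "s' = s" "t' = t" "a' = a" using 1 2 s t P_functional by blast+
    have "u \<cdot> (t \<cdot> a) = s \<cdot> a"
      unfolding u_def using s t a by (simp add: L.m_assoc L.inv_mult_cancel)
    then show ?thesis unfolding proportional_def using 1 2 t a by (intro bexI[of _ "t \<cdot> a"]) (auto simp: eqs)
  qed
  have "emeasure M {w \<in> space M. r n w = r n x \<and> \<not> proportional x z u w} \<le>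
      emeasure M ({w \<in> space M. r n w = r n x \<and> \<not> multiplicative x y w} \<union> {w \<in> space M. r n w = r n x \<and> \<not> multiplicative z y w})"
    using good mx mz by (intro emeasure_mono) auto
  also have "\<dots> \<le> fibre_defect x y + fibre_defect z y" unfolding fx fz using mx mz by (rule emeasure_subadditive)
  also have "\<dots> \<le> ennreal (7/100 * c)" by (rule fy)
  finally show ?thesis using u by blast
qed

text \<open>The comparison needs a generic base point. On labels without one, the fallback to an
  arbitrary point keeps \<open>base\<close> inside the space.\<close>

definition base :: "'y \<Rightarrow> 'x" where
  "base a = (if \<exists>z\<in>space M. generic z \<and> r n z = a then SOME z. z \<in> space M \<and> generic z \<and> r n z = a
     else SOME z. z \<in> space M)"

lemma base_space: "base a \<in> space M"
proof (cases "\<exists>z\<in>space M. generic z \<and> r n z = a")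
  case True
  then have "\<exists>z. z \<in> space M \<and> generic z \<and> r n z = a" by blast
  from someI_ex[OF this] show ?thesis using True by (simp add: base_def)
next
  case False
  then show ?thesis using someI_ex[of "\<lambda>z. z \<in> space M"] not_empty by (auto simp: base_def)
qed

lemma base_generic:
  assumes "x \<in> space M" "generic x" shows "generic (base (r n x))" "r n (base (r n x)) = r n x"
proof -
  have ex: "\<exists>z\<in>space M. generic z \<and> r n z = r n x" using assms by blast
  then have "\<exists>z. z \<in> space M \<and> generic z \<and> r n z = r n x" by blast
  from someI_ex[OF this] show "generic (base (r n x))" "r n (base (r n x)) = r n x"
    using ex by (simp_all add: base_def)
qed

definition is_gauge :: "'x \<Rightarrow> 'l \<Rightarrow> bool" where
  "is_gauge x u \<longleftrightarrow> u \<in> carrier L \<and> generic x \<and>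
     emeasure M {y \<in> space M. r n y = r n x \<and> \<not> proportional x (base (r n x)) u y} \<le> ennreal (7/100 * c)"

text \<open>The default value one is taken on a null set and keeps the function carrier valued
  everywhere.\<close>

definition gauge :: "'x \<Rightarrow> 'l" where
  "gauge x = (if \<exists>u. is_gauge x u then THE u. is_gauge x u else \<one>\<^bsub>L\<^esub>)"

lemma base_measurable [measurable]: "(\<lambda>x. base (r n x)) \<in> M \<rightarrow>\<^sub>M M"
proof (rule measurableI)
  show "base (r n x) \<in> space M" for x by (rule base_space)
  show "(\<lambda>x. base (r n x)) -` A \<inter> space M \<in> sets M" for A
  proof -
    have "(\<lambda>x. base (r n x)) -` A \<inter> space M = {x \<in> space M. r n x \<in> base -` A}" by auto
    then show ?thesis using predE[OF pred_r_mem[of n "base -` A"]] by simp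
  qed
qed

lemma is_gauge_measurable: "u \<in> carrier L \<Longrightarrow> {x \<in> space M. is_gauge x u} \<in> sets M"
  unfolding is_gauge_def by measurable

text \<open>The exceptional sets fill at most \<open>14/100\<close> of the atom, so some
  \<open>y\<close> sees both ratios; cancelling the common value at the base point and
  \<open>y\<close> gives equality.\<close>

lemma is_gauge_unique:
  assumes x: "x \<in> space M" and u: "is_gauge x u" and u': "is_gauge x u'"
  shows "u = u'"
proof -
  have c: "c > 0" by (rule atom_size_pos)
  have A: "emeasure M {y \<in> space M. r n y = r n x} = ennreal c" using u by (simp add: is_gauge_def generic_def)
  have uL: "u \<in> carrier L" "u' \<in> carrier L" using u u' by (auto simp: is_gauge_def)
  have m: "{y \<in> space M. r n y = r n x \<and> \<not> proportional x (base (r n x)) w y} \<in> sets M" if "w \<in> carrier L" for w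
    using x that base_space[of "r n x"] by measurable
  have "\<exists>y\<in>space M. r n y = r n x \<and> proportional x (base (r n x)) u y \<and> proportional x (base (r n x)) u' y \<and> True"
    using u u' c m[OF uL(1)] m[OF uL(2)]
    by (intro atom_intersect[OF A, of _ "7/100 * c" _ "7/100 * c"]) (auto simp: is_gauge_def)
  then obtain y t t' where t: "t \<in> carrier L" "P (base (r n x)) y t" "P x y (u \<cdot> t)"
    and t': "P (base (r n x)) y t'" "P x y (u' \<cdot> t')" unfolding proportional_def by blast
  have "t' = t" using t t' P_functional by blast
  then have "u \<cdot> t = u' \<cdot> t" using t t' P_functional by blast
  then show ?thesis using t uL by simp
qed

lemma gauge_is_gauge:
  assumes "x \<in> space M" "generic x" shows "is_gauge x (gauge x)"
proof -
  obtain u where u: "is_gauge x u"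
    using proportional_exists[OF assms base_space base_generic(1)[OF assms] base_generic(2)[OF assms, symmetric]] assms
    by (auto simp: is_gauge_def)
  have "is_gauge x (THE u. is_gauge x u)" using u is_gauge_unique[OF assms(1) _ u] by (rule theI)
  then show ?thesis using u by (auto simp: gauge_def)
qed

text \<open>There are countably many values, each with a measurable set of points; the default adds
  the complement of their union to the level set of one.\<close>

lemma gauge_measurable: "gauge \<in> M \<rightarrow>\<^sub>M space_L"
  unfolding measurable_count_space_eq_countable[OF countable_L]
proof (intro conjI ballI funcsetI)
  have the: "(THE u. is_gauge x u) = u" if "x \<in> space M" "is_gauge x u" for x u
    using that is_gauge_unique by (intro the_equality) auto
  fix x assume "x \<in> space M"
  then show "gauge x \<in> carrier L" using the by (auto simp: gauge_def is_gauge_def)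
next
  have the: "(THE u. is_gauge x u) = u" if "x \<in> space M" "is_gauge x u" for x u
    using that is_gauge_unique by (intro the_equality) auto
  fix u assume u: "u \<in> carrier L"
  have "gauge -` {u} \<inter> space M = {x \<in> space M. is_gauge x u} \<union>
      (if u = \<one>\<^bsub>L\<^esub> then space M - (\<Union>u\<in>carrier L. {x \<in> space M. is_gauge x u}) else {})"
  proof -
    have "gauge x = u \<longleftrightarrow> is_gauge x u \<or> (u = \<one>\<^bsub>L\<^esub> \<and> \<not> (\<exists>u'\<in>carrier L. is_gauge x u'))" if x: "x \<in> space M" for x
    proof (cases "\<exists>u'. is_gauge x u'")
      case True
      then obtain u0 where u0: "is_gauge x u0" by blast
      then have "gauge x = u0" "u0 \<in> carrier L" using the[OF x u0] by (auto simp: gauge_def is_gauge_def)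
      then show ?thesis using u0 is_gauge_unique[OF x u0, of u] by blast
    next
      case False
      then show ?thesis by (auto simp: gauge_def)
    qed
    then show ?thesis by auto
  qed
  also have "\<dots> \<in> sets M" using is_gauge_measurable u countable_L
    by (auto intro!: sets.Un sets.Diff sets.countable_UN')
  finally show "gauge -` {u} \<inter> space M \<in> sets M" .
qed

text \<open>For most \<open>y\<close> the gauge turns the values at \<open>(x, y)\<close> and at the
  translated pair into values at base points. Equivariance then expresses the twisted cocycle as
  \<open>t' * v g y * inv t\<close>, where \<open>t\<close> is the value at \<open>y\<close> and the
  base point of \<open>x\<close>, and \<open>t'\<close> the value at \<open>act g y\<close> and the
  base point of \<open>act g x\<close>. This expression sees \<open>x\<close> only through its
  atom.\<close>

lemma twisted_factors:
  assumes g: "g \<in> N0"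
  shows "\<exists>h. AE x in M. inv\<^bsub>L\<^esub> (gauge (act g x)) \<cdot> v g x \<cdot> gauge x = h (r n x)"
proof (rule AE_factor_through_r[where Q = "\<lambda>x. generic x \<and> generic (act g x) \<and> (AE y in M. equivariant g x y)"])
  have c: "c > 0" by (rule atom_size_pos)
  have gG: "g \<in> carrier G" using g by (rule N0_carrier)
  have [measurable]: "act g \<in> M \<rightarrow>\<^sub>M M" using gG by (rule act_measurable)
  have I: "AE x in M. AE y in M. equivariant g x y" using P_invariant[OF g] unfolding equivariant_def .
  show "AE x in M. generic x \<and> generic (act g x) \<and> (AE y in M. equivariant g x y)"
    using AE_generic AE_act[OF gG AE_generic] I by eventually_elim simp
  define T where "T x y \<longleftrightarrow> proportional x (base (r n x)) (gauge x) y" for x y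
  define S where "S x y \<longleftrightarrow> T x y \<and> T (act g x) (act g y)" for x y
  have S: "{y \<in> space M. r n y = r n x \<and> \<not> S x y} \<in> sets M"
      "emeasure M {y \<in> space M. r n y = r n x \<and> \<not> S x y} \<le> ennreal (14/100 * c)"
    if x: "x \<in> space M" "generic x" "generic (act g x)" for x
  proof -
    have gx: "act g x \<in> space M" using gG x by (intro act_space)
    have w: "is_gauge x (gauge x)" "is_gauge (act g x) (gauge (act g x))" using x gx by (auto intro: gauge_is_gauge)
    have gL: "gauge x \<in> carrier L" "gauge (act g x) \<in> carrier L" using w by (auto simp: is_gauge_def)
    have m1: "{y \<in> space M. r n y = r n x \<and> \<not> T x y} \<in> sets M"
      unfolding T_def using x gL base_space[of "r n x"] by measurable
    have p2: "Measurable.pred M (\<lambda>y. r n y = r n (act g x) \<and> \<not> T (act g x) y)"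
      unfolding T_def using gx gL base_space[of "r n (act g x)"] by measurable
    \<comment> \<open>\<open>g\<close> carries the atom of \<open>x\<close> to the atom of
      \<open>act g x\<close>, so the exceptional set at \<open>act g x\<close> is pulled back
      without change of measure.\<close>
    have eq: "{y \<in> space M. r n (act g y) = r n (act g x) \<and> \<not> T (act g x) (act g y)} =
      {y \<in> space M. r n y = r n x \<and> \<not> T (act g x) (act g y)}"
      using x gG by (auto simp: r_act_iff)
    have m2: "{y \<in> space M. r n y = r n x \<and> \<not> T (act g x) (act g y)} \<in> sets M"
      unfolding eq[symmetric] using measurable_compose[OF act_measurable[OF gG] p2] by (simp add: pred_def)
    have un: "{y \<in> space M. r n y = r n x \<and> \<not> S x y} = {y \<in> space M. r n y = r n x \<and> \<not> T x y} \<union>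
      {y \<in> space M. r n y = r n x \<and> \<not> T (act g x) (act g y)}"
      by (auto simp: S_def)
    show "{y \<in> space M. r n y = r n x \<and> \<not> S x y} \<in> sets M" unfolding un using m1 m2 by (rule sets.Un)
    have "emeasure M {y \<in> space M. r n y = r n x \<and> \<not> S x y} \<le> 
      emeasure M {y \<in> space M. r n y = r n x \<and> \<not> T x y} +
      emeasure M {y \<in> space M. r n y = r n x \<and> \<not> T (act g x) (act g y)}"
      unfolding un using m1 m2 by (rule emeasure_subadditive)
    also have "\<dots> \<le> ennreal (7/100 * c) + ennreal (7/100 * c)"
    proof (rule add_mono)
      show "emeasure M {y \<in> space M. r n y = r n x \<and> \<not> T x y} \<le> ennreal (7/100 * c)"
        using w by (simp add: is_gauge_def T_def)
      show "emeasure M {y \<in> space M. r n y = r n x \<and> \<not> T (act g x) (act g y)} \<le> ennreal (7/100 * c)"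
        unfolding eq[symmetric] emeasure_act[OF gG p2] using w by (simp add: is_gauge_def T_def)
    qed
    also have "\<dots> = ennreal (14/100 * c)" using c by (simp add: ennreal_plus[symmetric] del: ennreal_plus)
    finally show "emeasure M {y \<in> space M. r n y = r n x \<and> \<not> S x y} \<le> ennreal (14/100 * c)" .
  qed
  fix x z assume x: "x \<in> space M" and z: "z \<in> space M" and xz: "r n x = r n z"
    and qx: "generic x \<and> generic (act g x) \<and> (AE y in M. equivariant g x y)"
    and qz: "generic z \<and> generic (act g z) \<and> (AE y in M. equivariant g z y)"
  have gxz: "r n (act g x) = r n (act g z)" using r_act[OF gG x z xz] .
  have A: "emeasure M {y \<in> space M. r n y = r n x} = ennreal c" using qx by (simp add: generic_def)
  have ae: "AE y in M. equivariant g x y \<and> equivariant g z y" using qx qz by auto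
  have Sx: "{y \<in> space M. r n y = r n x \<and> \<not> S x y} \<in> sets M"
      "emeasure M {y \<in> space M. r n y = r n x \<and> \<not> S x y} \<le> ennreal (14/100 * c)" using S[OF x] qx by auto
  have Sz: "{y \<in> space M. r n y = r n x \<and> \<not> S z y} \<in> sets M"
      "emeasure M {y \<in> space M. r n y = r n x \<and> \<not> S z y} \<le> ennreal (14/100 * c)" using S[OF z] qz xz by auto
  \<comment> \<open>Four exceptional sets of relative size \<open>7/100\<close>, two for
    \<open>x\<close> and two for \<open>z\<close>, leave a common \<open>y\<close>.\<close>
  have "\<exists>y\<in>space M. r n y = r n x \<and> S x y \<and> S z y \<and> (equivariant g x y \<and> equivariant g z y)"
    using c by (intro atom_intersect[OF A Sx Sz _ _ _ ae]) auto
  then obtain y where y: "y \<in> space M" "S x y" "S z y" "equivariant g x y" "equivariant g z y" by blast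
  have key: "inv\<^bsub>L\<^esub> (gauge (act g w)) \<cdot> v g w \<cdot> gauge w = t' \<cdot> v g y \<cdot> inv\<^bsub>L\<^esub> t"
    if w: "w \<in> space M" "S w y" "equivariant g w y" and bt: "P (base (r n w)) y t" "P (base (r n (act g w))) (act g y) t'"
      and Gw: "generic w" "generic (act g w)" for w t t'
  proof -
    have gw: "act g w \<in> space M" using gG w by (intro act_space)
    have gL: "gauge w \<in> carrier L" "gauge (act g w) \<in> carrier L" using Gw w gw gauge_is_gauge by (auto simp: is_gauge_def)
    have tL: "t \<in> carrier L" "t' \<in> carrier L" using bt P_carrier by auto
    have vL: "v g w \<in> carrier L" "v g y \<in> carrier L" using gG w y by (auto intro: v_carrier)
    have "P w y (gauge w \<cdot> t)" using w(2) bt(1) P_functional unfolding S_def T_def proportional_def by metis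
    then have 1: "P (act g w) (act g y) (v g w \<cdot> (gauge w \<cdot> t) \<cdot> inv\<^bsub>L\<^esub> (v g y))"
      using w(3) gL tL by (auto simp: equivariant_def)
    have 2: "P (act g w) (act g y) (gauge (act g w) \<cdot> t')" using w(2) bt(2) P_functional unfolding S_def T_def proportional_def by metis
    have eq: "v g w \<cdot> (gauge w \<cdot> t) \<cdot> inv\<^bsub>L\<^esub> (v g y) = gauge (act g w) \<cdot> t'"
      by (rule P_functional[OF 1 2])
    have "v g w \<cdot> gauge w \<cdot> t = gauge (act g w) \<cdot> t' \<cdot> v g y"
      unfolding eq[symmetric] using gL tL vL by (simp add: L.m_assoc)
    then have "v g w \<cdot> gauge w = gauge (act g w) \<cdot> t' \<cdot> v g y \<cdot> inv\<^bsub>L\<^esub> t"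
      using gL tL vL by (simp add: L.inv_solve_right)
    then have "inv\<^bsub>L\<^esub> (gauge (act g w)) \<cdot> (v g w \<cdot> gauge w) = t' \<cdot> v g y \<cdot> inv\<^bsub>L\<^esub> t"
      using gL tL vL by (simp add: L.m_assoc L.inv_mult_cancel)
    then show ?thesis using gL tL vL by (simp add: L.m_assoc)
  qed
  obtain t where t: "P (base (r n x)) y t" using y(2) unfolding S_def T_def proportional_def by blast
  obtain t' where t': "P (base (r n (act g x))) (act g y) t'" using y(2) unfolding S_def T_def proportional_def by blast
  show "inv\<^bsub>L\<^esub> (gauge (act g x)) \<cdot> v g x \<cdot> gauge x = inv\<^bsub>L\<^esub> (gauge (act g z)) \<cdot> v g z \<cdot> gauge z"
    using key[OF x y(2,4) t t'] key[OF z y(3,5), of t t'] t t' qx qz xz gxz by simp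
qed

end

section \<open>The Koopman representation on pairs\<close>

context strict_cocycle
begin

definition triple :: "(('x \<times> 'x) \<times> 'l) measure" where
  "triple = (M \<Otimes>\<^sub>M M) \<Otimes>\<^sub>M space_L"

text \<open>Extended by the identity outside the space, so that the group law holds at every
  argument: the representation identities are equalities of functions, not merely almost
  everywhere.\<close>

definition move :: "'g \<Rightarrow> ('x \<times> 'x) \<times> 'l \<Rightarrow> ('x \<times> 'x) \<times> 'l" where
  "move g z = (if z \<in> space triple then case z of ((x, y), t) \<Rightarrow>
     ((act g x, act g y), v g x \<cdot> t \<cdot> inv\<^bsub>L\<^esub> (v g y)) else z)"

definition koopman :: "'g \<Rightarrow> (('x \<times> 'x) \<times> 'l \<Rightarrow> complex) \<Rightarrow> ('x \<times> 'x) \<times> 'l \<Rightarrow> complex" where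
  "koopman g f = (\<lambda>z. f (move (inv g) z))"

lemma space_triple: "((x, y), t) \<in> space triple \<longleftrightarrow> x \<in> space M \<and> y \<in> space M \<and> t \<in> carrier L"
  by (simp add: triple_def space_pair_measure)

lemma move_eq:
  assumes "x \<in> space M" "y \<in> space M" "t \<in> carrier L"
  shows "move g ((x, y), t) = ((act g x, act g y), v g x \<cdot> t \<cdot> inv\<^bsub>L\<^esub> (v g y))"
  using assms by (simp add: move_def space_triple)

lemma triple_cases:
  assumes "z \<in> space triple"
  obtains x y t where "z = ((x, y), t)" "x \<in> space M" "y \<in> space M" "t \<in> carrier L"
  using assms by (cases z; cases "fst z") (auto simp: space_triple)

lemma move_one: "move \<one> z = z"
proof (cases "z \<in> space triple")
  case True
  then show ?thesis by (cases rule: triple_cases) (simp add: move_eq act_one v_one)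
qed (simp add: move_def)

lemma move_mult:
  assumes g: "g \<in> carrier G" and h: "h \<in> carrier G"
  shows "move (g \<otimes> h) z = move g (move h z)"
proof (cases "z \<in> space triple")
  case True
  then show ?thesis
  proof (cases rule: triple_cases)
    case (1 x y t)
    have c: "v h x \<in> carrier L" "v h y \<in> carrier L" "v g (act h x) \<in> carrier L" "v g (act h y) \<in> carrier L"
      using 1 g h by (simp_all add: v_carrier act_space)
    then show ?thesis using 1 g h
      by (simp add: move_eq act_mult v_mult act_space L.inv_mult_group L.m_assoc)
  qed
next
  case False
  then show ?thesis by (simp add: move_def)
qed

lemma triple_measurable_coords [measurable]:
  "(\<lambda>z. fst (fst z)) \<in> triple \<rightarrow>\<^sub>M M" "(\<lambda>z. snd (fst z)) \<in> triple \<rightarrow>\<^sub>M M"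
  "snd \<in> triple \<rightarrow>\<^sub>M space_L"
  unfolding triple_def by measurable

lemma move_measurable:
  assumes g: "g \<in> carrier G"
  shows "move g \<in> triple \<rightarrow>\<^sub>M triple"
proof -
  have [measurable]: "act g \<in> M \<rightarrow>\<^sub>M M" "v g \<in> M \<rightarrow>\<^sub>M space_L"
    using g by (auto intro: act_measurable v_measurable)
  have v1: "(\<lambda>z. v g (fst (fst z))) \<in> triple \<rightarrow>\<^sub>M space_L"
    and v2: "(\<lambda>z. v g (snd (fst z))) \<in> triple \<rightarrow>\<^sub>M space_L" by measurable
  have m: "(\<lambda>z. v g (fst (fst z)) \<cdot> snd z) \<in> triple \<rightarrow>\<^sub>M space_L"
    by (rule measurable_count_space_app2[OF countable_L countable_L v1 triple_measurable_coords(3)]) simp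
  have [measurable]: "(\<lambda>z. v g (fst (fst z)) \<cdot> snd z \<cdot> inv\<^bsub>L\<^esub> (v g (snd (fst z)))) \<in> triple \<rightarrow>\<^sub>M space_L"
    by (rule measurable_count_space_app2[OF countable_L countable_L m v2,
          where h = "\<lambda>a b. a \<cdot> inv\<^bsub>L\<^esub> b"]) simp
  have "(\<lambda>z. ((act g (fst (fst z)), act g (snd (fst z))),
      v g (fst (fst z)) \<cdot> snd z \<cdot> inv\<^bsub>L\<^esub> (v g (snd (fst z))))) \<in> triple \<rightarrow>\<^sub>M (M \<Otimes>\<^sub>M M) \<Otimes>\<^sub>M space_L"
    by measurable
  then show ?thesis
    by (subst measurable_cong) (auto simp: move_def triple_def split: prod.split)
qed

lemma nn_integral_triple:
  assumes F: "F \<in> borel_measurable triple"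
  shows "(\<integral>\<^sup>+z. F z \<partial>triple) = (\<integral>\<^sup>+x. \<integral>\<^sup>+y. \<integral>\<^sup>+t. F ((x, y), t) \<partial>space_L \<partial>M \<partial>M)"
proof -
  interpret C: sigma_finite_measure "space_L"
    by (rule sigma_finite_measure_count_space_countable[OF countable_L])
  have F': "F \<in> borel_measurable ((M \<Otimes>\<^sub>M M) \<Otimes>\<^sub>M space_L)" using F by (simp add: triple_def)
  have "(\<integral>\<^sup>+z. F z \<partial>triple) = (\<integral>\<^sup>+p. \<integral>\<^sup>+t. F (p, t) \<partial>space_L \<partial>(M \<Otimes>\<^sub>M M))"
    unfolding triple_def by (rule C.nn_integral_fst[OF F', symmetric])
  also have "\<dots> = (\<integral>\<^sup>+x. \<integral>\<^sup>+y. \<integral>\<^sup>+t. F ((x, y), t) \<partial>space_L \<partial>M \<partial>M)"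
    by (rule nn_integral_fst[OF C.borel_measurable_nn_integral_fst[OF F'], symmetric])
  finally show ?thesis .
qed

lemma nn_integral_triple_measurable:
  assumes F: "F \<in> borel_measurable triple"
  shows "(\<lambda>p. \<integral>\<^sup>+t. F (p, t) \<partial>space_L) \<in> borel_measurable (M \<Otimes>\<^sub>M M)"
proof -
  interpret C: sigma_finite_measure "space_L"
    by (rule sigma_finite_measure_count_space_countable[OF countable_L])
  show ?thesis using F unfolding triple_def by (rule C.borel_measurable_nn_integral_fst)
qed

text \<open>For fixed \<open>(x, y)\<close> the map on the third coordinate is a bijection of a
  counting space; what remains is invariance of \<open>M\<close> in the other two coordinates, one
  at a time.\<close>

lemma nn_integral_move:
  assumes g: "g \<in> carrier G" and F: "F \<in> borel_measurable triple"
  shows "(\<integral>\<^sup>+z. F (move g z) \<partial>triple) = (\<integral>\<^sup>+z. F z \<partial>triple)"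
proof -
  define H where "H p = (\<integral>\<^sup>+t. F (p, t) \<partial>space_L)" for p
  have H: "H \<in> borel_measurable (M \<Otimes>\<^sub>M M)" unfolding H_def by (rule nn_integral_triple_measurable[OF F])
  have inner: "(\<integral>\<^sup>+t. F (move g ((x, y), t)) \<partial>space_L) = H (act g x, act g y)"
    if x: "x \<in> space M" and y: "y \<in> space M" for x y
  proof -
    have vv: "v g x \<in> carrier L" "v g y \<in> carrier L" using g x y by (auto intro: v_carrier)
    have bij: "bij_betw (\<lambda>t. v g x \<cdot> t \<cdot> inv\<^bsub>L\<^esub> (v g y)) (carrier L) (carrier L)"
      by (rule bij_betw_byWitness[where f' = "\<lambda>t. inv\<^bsub>L\<^esub> (v g x) \<cdot> t \<cdot> v g y"])
        (use vv in \<open>auto simp: L.m_assoc L.inv_mult_cancel\<close>)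
    have "(\<integral>\<^sup>+t. F (move g ((x, y), t)) \<partial>space_L) =
        (\<integral>\<^sup>+t. F ((act g x, act g y), v g x \<cdot> t \<cdot> inv\<^bsub>L\<^esub> (v g y)) \<partial>space_L)"
      using x y by (intro nn_integral_cong) (simp add: move_eq)
    also have "\<dots> = H (act g x, act g y)" unfolding H_def
      by (rule nn_integral_bij_count_space[OF bij, of "\<lambda>t. F ((act g x, act g y), t)"])
    finally show ?thesis .
  qed
  have "(\<integral>\<^sup>+z. F (move g z) \<partial>triple) = (\<integral>\<^sup>+x. \<integral>\<^sup>+y. H (act g x, act g y) \<partial>M \<partial>M)"
    by (subst nn_integral_triple[OF measurable_compose[OF move_measurable[OF g] F]])
      (intro nn_integral_cong, simp add: inner)
  also have "\<dots> = (\<integral>\<^sup>+x. \<integral>\<^sup>+y. H (act g x, y) \<partial>M \<partial>M)"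
  proof (rule nn_integral_cong)
    fix x assume "x \<in> space M"
    then have "(\<lambda>y. H (act g x, y)) \<in> borel_measurable M"
      by (intro measurable_compose_Pair1[OF _ H] act_space g)
    then show "(\<integral>\<^sup>+y. H (act g x, act g y) \<partial>M) = (\<integral>\<^sup>+y. H (act g x, y) \<partial>M)"
      by (rule nn_integral_act[OF g])
  qed
  also have "\<dots> = (\<integral>\<^sup>+x. \<integral>\<^sup>+y. H (x, y) \<partial>M \<partial>M)"
    by (rule nn_integral_act[OF g borel_measurable_nn_integral_fst[OF H]])
  also have "\<dots> = (\<integral>\<^sup>+z. F z \<partial>triple)" unfolding H_def by (rule nn_integral_triple[OF F, symmetric])
  finally show ?thesis .
qed

lemma distr_move:
  assumes g: "g \<in> carrier G" shows "distr triple triple (move g) = triple"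
proof (rule measure_eqI)
  fix A assume "A \<in> sets (distr triple triple (move g))"
  then have A: "A \<in> sets triple" by simp
  have "emeasure (distr triple triple (move g)) A = (\<integral>\<^sup>+z. indicator A z \<partial>distr triple triple (move g))"
    using A by simp
  also have "\<dots> = (\<integral>\<^sup>+z. indicator A (move g z) \<partial>triple)"
    using A by (intro nn_integral_distr move_measurable g) auto
  also have "\<dots> = (\<integral>\<^sup>+z. indicator A z \<partial>triple)" using A by (intro nn_integral_move g) auto
  finally show "emeasure (distr triple triple (move g)) A = emeasure triple A" using A by simp
qed simp

lemma koopman_square_integrable:
  assumes g: "g \<in> carrier G" and f: "f \<in> square_integrable triple"
  shows "koopman g f \<in> square_integrable triple"
proof (rule square_integrableI)
  have gi: "inv g \<in> carrier G" using g by simp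
  have [measurable]: "f \<in> borel_measurable triple" using f by (rule L2_measurable)
  show "koopman g f \<in> borel_measurable triple"
    unfolding koopman_def by (rule measurable_compose[OF move_measurable[OF gi]]) measurable
  have "(\<integral>\<^sup>+z. ennreal ((cmod (koopman g f z))\<^sup>2) \<partial>triple) = (\<integral>\<^sup>+z. ennreal ((cmod (f z))\<^sup>2) \<partial>triple)"
    unfolding koopman_def by (rule nn_integral_move[OF gi]) measurable
  also have "\<dots> < \<infinity>" unfolding L2_nn_integral[OF f] by simp
  finally show "(\<integral>\<^sup>+z. ennreal ((cmod (koopman g f z))\<^sup>2) \<partial>triple) < \<infinity>" .
qed

lemma koopman_ip:
  assumes g: "g \<in> carrier G" and f: "f \<in> square_integrable triple" and h: "h \<in> square_integrable triple"
  shows "L2_ip triple (koopman g f) (koopman g h) = L2_ip triple f h"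
proof -
  have gi: "inv g \<in> carrier G" using g by simp
  have m: "(\<lambda>z. f z * cnj (h z)) \<in> borel_measurable triple"
    using L2_integrable_mult[OF f h] by (rule borel_measurable_integrable)
  have "L2_ip triple (koopman g f) (koopman g h) = (\<integral>z. f z * cnj (h z) \<partial>distr triple triple (move (inv g)))"
    unfolding L2_ip_def koopman_def by (rule integral_distr[OF move_measurable[OF gi] m, symmetric])
  then show ?thesis by (simp add: L2_ip_def distr_move[OF gi])
qed

lemma semi_hilbert_rep_koopman:
  "semi_hilbert_rep (square_integrable triple) L2_scale (L2_ip triple) G koopman"
proof (intro semi_hilbert_rep.intro semi_hilbert_L2 semi_hilbert_rep_axioms.intro is_group)
  fix g h assume g: "g \<in> carrier G" and h: "h \<in> carrier G"
  show "koopman (g \<otimes> h) f = koopman g (koopman h f)" for f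
    unfolding koopman_def using g h by (simp add: inv_mult_group move_mult)
qed (simp_all add: koopman_square_integrable koopman_ip,
    simp_all add: koopman_def plus_fun_def L2_scale_def move_one)

text \<open>The atom of almost every point has measure \<open>atom_size n\<close>, so these are unit
  vectors and distances from them are relative errors.\<close>

definition diagonal_vector :: "nat \<Rightarrow> ('x \<times> 'x) \<times> 'l \<Rightarrow> complex" where
  "diagonal_vector n z = (if z \<in> space triple \<and> r n (snd (fst z)) = r n (fst (fst z)) \<and> snd z = \<one>\<^bsub>L\<^esub>
     then complex_of_real (1 / sqrt (atom_size n)) else 0)"

lemma diagonal_vector_eq:
  assumes "x \<in> space M" "y \<in> space M" "t \<in> carrier L"
  shows "diagonal_vector n ((x, y), t) =
    (if r n y = r n x \<and> t = \<one>\<^bsub>L\<^esub> then complex_of_real (1 / sqrt (atom_size n)) else 0)"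
  using assms by (simp add: diagonal_vector_def space_triple)

lemma diagonal_vector_measurable [measurable]: "diagonal_vector n \<in> borel_measurable triple"
proof -
  have [measurable]: "Measurable.pred triple (\<lambda>z. snd z = \<one>\<^bsub>L\<^esub>)"
    by (rule measurable_compose[OF triple_measurable_coords(3)]) simp
  have [measurable]: "Measurable.pred triple (\<lambda>z. r n (snd (fst z)) = r n (fst (fst z)))"
    by (rule pred_same_r) measurable
  show ?thesis unfolding diagonal_vector_def by measurable
qed

lemma nn_integral_count_space_single:
  assumes "a \<in> A" shows "(\<integral>\<^sup>+t. (if t = a then b else 0) \<partial>count_space A) = (b :: ennreal)"
  using assms by (subst nn_integral_count_space'[of "{a}"]) auto

lemma diagonal_vector_square_integrable: "diagonal_vector n \<in> square_integrable triple"
proof (rule square_integrableI)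
  let ?c = "atom_size n"
  have "(\<integral>\<^sup>+z. ennreal ((cmod (diagonal_vector n z))\<^sup>2) \<partial>triple) =
    (\<integral>\<^sup>+x. \<integral>\<^sup>+y. \<integral>\<^sup>+t. ennreal ((cmod (diagonal_vector n ((x, y), t)))\<^sup>2) \<partial>space_L \<partial>M \<partial>M)"
    by (rule nn_integral_triple) measurable
  also have "\<dots> \<le> (\<integral>\<^sup>+x. \<integral>\<^sup>+y. ennreal (1 / ?c) \<partial>M \<partial>M)"
  proof (intro nn_integral_mono)
    fix x y assume xy: "x \<in> space M" "y \<in> space M"
    have "(\<integral>\<^sup>+t. ennreal ((cmod (diagonal_vector n ((x, y), t)))\<^sup>2) \<partial>space_L)
        \<le> (\<integral>\<^sup>+t. (if t = \<one>\<^bsub>L\<^esub> then ennreal (1 / ?c) else 0) \<partial>space_L)"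
      using xy atom_size_pos[of n]
      by (intro nn_integral_mono) (auto simp: diagonal_vector_eq power_divide norm_divide)
    then show "(\<integral>\<^sup>+t. ennreal ((cmod (diagonal_vector n ((x, y), t)))\<^sup>2) \<partial>space_L) \<le> ennreal (1 / ?c)"
      by (simp add: nn_integral_count_space_single)
  qed
  also have "\<dots> < \<infinity>" by (simp add: emeasure_space_1)
  finally show "(\<integral>\<^sup>+z. ennreal ((cmod (diagonal_vector n z))\<^sup>2) \<partial>triple) < \<infinity>" .
qed measurable

text \<open>Over a pair in one atom, translation moves the mass from one to \<open>t0\<close>, and
  \<open>t0\<close> is one as soon as \<open>v (inv g)\<close> agrees at \<open>x\<close> and
  \<open>y\<close>. On the other pairs two entries at different places remain, each of squared
  modulus \<open>1 / atom_size n\<close>.\<close>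

lemma diagonal_vector_almost_invariant:
  assumes g: "g \<in> carrier G"
  shows "(\<integral>\<^sup>+z. ennreal ((cmod (koopman g (diagonal_vector n) z - diagonal_vector n z))\<^sup>2) \<partial>triple)
    \<le> ennreal (2 / atom_size n) * (\<integral>\<^sup>+x. emeasure M {y \<in> space M. r n y = r n x \<and> v (inv g) y \<noteq> v (inv g) x} \<partial>M)"
proof -
  let ?c = "atom_size n" and ?\<xi> = "diagonal_vector n" and ?h = "inv g"
  have h: "?h \<in> carrier G" using g by simp
  have c: "?c > 0" by (rule atom_size_pos)
  have [measurable]: "koopman g ?\<xi> \<in> borel_measurable triple"
    by (rule L2_measurable[OF koopman_square_integrable[OF g diagonal_vector_square_integrable]])
  have pos: "0 \<le> 1 / ?c" using c by simp
  have pred [measurable]: "Measurable.pred (M \<Otimes>\<^sub>M M) (\<lambda>z. v ?h (snd z) \<noteq> v ?h (fst z))"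
    using measurable_count_space_app2[OF countable_L countable_L
        measurable_compose[OF measurable_snd v_measurable[OF h]] measurable_compose[OF measurable_fst v_measurable[OF h]],
        of "(\<noteq>)" "count_space UNIV"] by simp
  have "(\<integral>\<^sup>+z. ennreal ((cmod (koopman g ?\<xi> z - ?\<xi> z))\<^sup>2) \<partial>triple) =
    (\<integral>\<^sup>+x. \<integral>\<^sup>+y. \<integral>\<^sup>+t. ennreal ((cmod (koopman g ?\<xi> ((x, y), t) - ?\<xi> ((x, y), t)))\<^sup>2) \<partial>space_L \<partial>M \<partial>M)"
    by (rule nn_integral_triple) measurable
  also have "\<dots> \<le> (\<integral>\<^sup>+x. \<integral>\<^sup>+y. ennreal (2 / ?c) * indicator {y \<in> space M. r n y = r n x \<and> v ?h y \<noteq> v ?h x} y \<partial>M \<partial>M)"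
  proof (intro nn_integral_mono)
    fix x y assume xy: "x \<in> space M" "y \<in> space M"
    have vv: "v ?h x \<in> carrier L" "v ?h y \<in> carrier L" using h xy by (auto intro: v_carrier)
    define t0 where "t0 = inv\<^bsub>L\<^esub> (v ?h x) \<cdot> v ?h y"
    have t0: "t0 \<in> carrier L" using vv by (simp add: t0_def)
    have t0_iff: "v ?h x \<cdot> t \<cdot> inv\<^bsub>L\<^esub> (v ?h y) = \<one>\<^bsub>L\<^esub> \<longleftrightarrow> t = t0" if t: "t \<in> carrier L" for t
    proof
      assume "v ?h x \<cdot> t \<cdot> inv\<^bsub>L\<^esub> (v ?h y) = \<one>\<^bsub>L\<^esub>"
      then have "inv\<^bsub>L\<^esub> (v ?h x) \<cdot> (v ?h x \<cdot> t \<cdot> inv\<^bsub>L\<^esub> (v ?h y)) \<cdot> v ?h y = t0"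
        using vv by (simp add: t0_def)
      then show "t = t0" using vv t by (simp add: L.m_assoc L.inv_mult_cancel)
    next
      assume "t = t0"
      then show "v ?h x \<cdot> t \<cdot> inv\<^bsub>L\<^esub> (v ?h y) = \<one>\<^bsub>L\<^esub>"
        using vv by (simp add: t0_def L.m_assoc L.inv_mult_cancel)
    qed
    have k: "koopman g ?\<xi> ((x, y), t) = (if r n y = r n x \<and> t = t0 then complex_of_real (1 / sqrt ?c) else 0)"
      if t: "t \<in> carrier L" for t
      unfolding koopman_def move_eq[OF xy t] using t xy h vv
      by (subst diagonal_vector_eq) (auto simp: t0_iff r_act_iff act_space)
    have t01: "t0 = \<one>\<^bsub>L\<^esub>" if "v ?h y = v ?h x" using that vv by (simp add: t0_def)
    have s: "(cmod (complex_of_real (1 / sqrt ?c)))\<^sup>2 = 1 / ?c"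
      using c by (simp add: power_divide norm_divide)
    show "(\<integral>\<^sup>+t. ennreal ((cmod (koopman g ?\<xi> ((x, y), t) - ?\<xi> ((x, y), t)))\<^sup>2) \<partial>space_L) \<le>
        ennreal (2 / ?c) * indicator {y \<in> space M. r n y = r n x \<and> v ?h y \<noteq> v ?h x} y"
    proof (cases "r n y = r n x \<and> v ?h y \<noteq> v ?h x")
      case False
      have "koopman g ?\<xi> ((x, y), t) = ?\<xi> ((x, y), t)" if "t \<in> carrier L" for t
        using that xy False t01 by (auto simp: k diagonal_vector_eq)
      then have "(\<integral>\<^sup>+t. ennreal ((cmod (koopman g ?\<xi> ((x, y), t) - ?\<xi> ((x, y), t)))\<^sup>2) \<partial>space_L) =
          (\<integral>\<^sup>+t. 0 \<partial>space_L)"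
        by (intro nn_integral_cong) simp
      then show ?thesis by simp
    next
      case True
      have "(\<integral>\<^sup>+t. ennreal ((cmod (koopman g ?\<xi> ((x, y), t) - ?\<xi> ((x, y), t)))\<^sup>2) \<partial>space_L) \<le>
          (\<integral>\<^sup>+t. (if t = t0 then ennreal (1 / ?c) else 0) + (if t = \<one>\<^bsub>L\<^esub> then ennreal (1 / ?c) else 0) \<partial>space_L)"
        using True xy s by (intro nn_integral_mono) (auto simp: k diagonal_vector_eq)
      also have "\<dots> = ennreal (1 / ?c) + ennreal (1 / ?c)"
        by (subst nn_integral_add) (auto simp: nn_integral_count_space_single t0)
      also have "\<dots> = ennreal (2 / ?c)" using pos by (simp add: ennreal_plus[symmetric] del: ennreal_plus)
      finally show ?thesis using True xy by simp
    qed
  qed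
  also have "\<dots> = (\<integral>\<^sup>+x. ennreal (2 / ?c) * emeasure M {y \<in> space M. r n y = r n x \<and> v ?h y \<noteq> v ?h x} \<partial>M)"
  proof (intro nn_integral_cong nn_integral_cmult_indicator)
    fix x assume x: "x \<in> space M"
    have "v ?h x \<in> carrier L" using h x by (rule v_carrier)
    then show "{y \<in> space M. r n y = r n x \<and> v ?h y \<noteq> v ?h x} \<in> sets M"
      using x v_measurable[OF h] by measurable
  qed
  also have "\<dots> = ennreal (2 / ?c) * (\<integral>\<^sup>+x. emeasure M {y \<in> space M. r n y = r n x \<and> v ?h y \<noteq> v ?h x} \<partial>M)"
    by (rule nn_integral_cmult) measurable
  finally show ?thesis .
qed

lemma invariant_kernel_exists:
  assumes T: "relative_property_T G N0"
  shows "\<exists>n P. invariant_kernel M G act r N0 L v n P"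
proof -
  interpret S: semi_hilbert_rep "square_integrable triple" L2_scale "L2_ip triple" G koopman
    by (rule semi_hilbert_rep_koopman)
  have sq: "ennreal (S.sq (f - h)) = (\<integral>\<^sup>+z. ennreal ((cmod (f z - h z))\<^sup>2) \<partial>triple)"
    if "f - h \<in> square_integrable triple" for f h
    using L2_nn_integral[OF that] by (simp add: S.sq_def)
  have lim: "(\<lambda>n. S.sq (koopman g (diagonal_vector n) - diagonal_vector n)) \<longlonglongrightarrow> 0" if g: "g \<in> carrier G" for g
  proof (rule LIMSEQ_I)
    fix e :: real assume e: "e > 0"
    have gi: "inv g \<in> carrier G" using g by simp
    obtain n0 where n0: "\<And>n. n \<ge> n0 \<Longrightarrow> (\<integral>\<^sup>+x. emeasure M {y \<in> space M. r n y = r n x \<and> v (inv g) y \<noteq> v (inv g) x} \<partial>M)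
        \<le> ennreal (e / 4 * atom_size n)"
      using nn_integral_disagree_le[OF countable_L v_measurable[OF gi], of "e / 4"] e by auto
    show "\<exists>no. \<forall>n\<ge>no. norm (S.sq (koopman g (diagonal_vector n) - diagonal_vector n) - 0) < e"
    proof (intro exI allI impI)
      fix n assume n: "n \<ge> n0"
      have c: "atom_size n > 0" by (rule atom_size_pos)
      have mem: "koopman g (diagonal_vector n) - diagonal_vector n \<in> square_integrable triple"
        by (intro S.diff_mem S.U_mem g diagonal_vector_square_integrable)
      have "ennreal (S.sq (koopman g (diagonal_vector n) - diagonal_vector n)) \<le>
          ennreal (2 / atom_size n) * ennreal (e / 4 * atom_size n)"
        unfolding sq[OF mem]
        by (rule order_trans[OF diagonal_vector_almost_invariant[OF g] mult_left_mono[OF n0[OF n]]]) simp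
      also have "\<dots> = ennreal (2 / atom_size n * (e / 4 * atom_size n))"
        using c e by (intro ennreal_mult[symmetric]) auto
      also have "2 / atom_size n * (e / 4 * atom_size n) = e / 2" using c by simp
      finally have "S.sq (koopman g (diagonal_vector n) - diagonal_vector n) \<le> e / 2"
        using e by (simp add: ennreal_le_iff fun_diff_def)
      then show "norm (S.sq (koopman g (diagonal_vector n) - diagonal_vector n) - 0) < e"
        using S.sq_nonneg[OF mem] e by simp
    qed
  qed
  \<comment> \<open>An entry of \<open>\<eta>\<close> on the wrong side of the threshold
    \<open>1/2\<close> in \<open>big\<close> costs at least \<open>1 / (4 * c)\<close>, so
    \<open>1/400\<close> leads to the \<open>1/100 * c\<close> of \<open>P_small\<close>.\<close>
  obtain n \<eta> where \<eta>: "\<eta> \<in> S.fixed N0" and near: "S.sq (diagonal_vector n - \<eta>) < 1/400"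
    using S.relative_property_T_near_fixed[OF T normal_N0 countable_G diagonal_vector_square_integrable lim, of "1/400"]
    by auto
  have \<eta>L: "\<eta> \<in> square_integrable triple" using \<eta> by (simp add: S.fixed_def)
  have \<eta>m [measurable]: "\<eta> \<in> borel_measurable triple" using \<eta>L by (rule L2_measurable)
  define c where "c = atom_size n"
  have c: "c > 0" unfolding c_def by (rule atom_size_pos)
  define big where "big p t \<longleftrightarrow> t \<in> carrier L \<and> 1/2 < sqrt c * cmod (\<eta> (p, t))" for p t
  \<comment> \<open>Uniqueness of the large entry makes the kernel functional; where no entry or
    several entries are large, it is undefined.\<close>
  define P where "P x y t \<longleftrightarrow> big (x, y) t \<and> (\<forall>s\<in>carrier L. big (x, y) s \<longrightarrow> s = t)" for x y t
  have big_meas: "Measurable.pred (M \<Otimes>\<^sub>M M) (\<lambda>p. big p t)" for t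
  proof (cases "t \<in> carrier L")
    case True
    have "(\<lambda>p. (p, t)) \<in> M \<Otimes>\<^sub>M M \<rightarrow>\<^sub>M triple"
      unfolding triple_def using True by (intro measurable_Pair2') simp
    from measurable_compose[OF this \<eta>m] have [measurable]: "(\<lambda>p. \<eta> (p, t)) \<in> borel_measurable (M \<Otimes>\<^sub>M M)" .
    show ?thesis unfolding big_def by measurable
  qed (simp add: big_def)
  have P_meas: "Measurable.pred (M \<Otimes>\<^sub>M M) (\<lambda>z. P (fst z) (snd z) t)" for t
    unfolding P_def prod.collapse
    by (intro pred_intros_logic pred_countable_bounded(1) countable_L big_meas) simp
  have small: "(\<integral>\<^sup>+x. emeasure M {y \<in> space M. r n y = r n x \<and> \<not> P x y \<one>\<^bsub>L\<^esub>} \<partial>M) \<le> ennreal (1/100 * c)"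
  proof -
    have mem: "diagonal_vector n - \<eta> \<in> square_integrable triple"
      by (intro S.diff_mem \<eta>L diagonal_vector_square_integrable)
    have [measurable]: "(\<lambda>z. diagonal_vector n z - \<eta> z) \<in> borel_measurable triple" by measurable
    let ?d = "\<lambda>z. ennreal (4 * c * (cmod (diagonal_vector n z - \<eta> z))\<^sup>2)"
    have "(\<integral>\<^sup>+x. emeasure M {y \<in> space M. r n y = r n x \<and> \<not> P x y \<one>\<^bsub>L\<^esub>} \<partial>M) \<le>
        (\<integral>\<^sup>+x. \<integral>\<^sup>+y. \<integral>\<^sup>+t. ?d ((x, y), t) \<partial>space_L \<partial>M \<partial>M)"
    proof (rule nn_integral_mono)
      fix x assume x: "x \<in> space M"
      have Px: "Measurable.pred M (\<lambda>y. P x y \<one>\<^bsub>L\<^esub>)" using measurable_compose_Pair1[OF x P_meas] by simp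
      have "emeasure M {y \<in> space M. r n y = r n x \<and> \<not> P x y \<one>\<^bsub>L\<^esub>} =
          (\<integral>\<^sup>+y. indicator {y \<in> space M. r n y = r n x \<and> \<not> P x y \<one>\<^bsub>L\<^esub>} y \<partial>M)"
        using x Px by (intro nn_integral_indicator[symmetric]) measurable
      also have "\<dots> \<le> (\<integral>\<^sup>+y. \<integral>\<^sup>+t. ?d ((x, y), t) \<partial>space_L \<partial>M)"
      proof (rule nn_integral_mono)
        fix y assume y: "y \<in> space M"
        show "indicator {y \<in> space M. r n y = r n x \<and> \<not> P x y \<one>\<^bsub>L\<^esub>} y \<le> (\<integral>\<^sup>+t. ?d ((x, y), t) \<partial>space_L)"
        proof (cases "r n y = r n x \<and> \<not> P x y \<one>\<^bsub>L\<^esub>")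
          case True
          \<comment> \<open>The value can fail to be one in two ways: the entry at one is too small,
            or another entry is large although \<open>diagonal_vector\<close> vanishes
            there.\<close>
          have "\<exists>t\<in>carrier L. 1 / 2 \<le> sqrt c * cmod (diagonal_vector n ((x, y), t) - \<eta> ((x, y), t))"
          proof (cases "big (x, y) \<one>\<^bsub>L\<^esub>")
            case False
            have "sqrt c * cmod (diagonal_vector n ((x, y), \<one>\<^bsub>L\<^esub>)) = 1"
              using c True x y by (simp add: diagonal_vector_eq norm_divide c_def[symmetric])
            moreover have "sqrt c * cmod (\<eta> ((x, y), \<one>\<^bsub>L\<^esub>)) \<le> 1/2" using False by (simp add: big_def)
            moreover have "sqrt c * cmod (diagonal_vector n ((x, y), \<one>\<^bsub>L\<^esub>)) \<le>
              sqrt c * (cmod (\<eta> ((x, y), \<one>\<^bsub>L\<^esub>)) + cmod (diagonal_vector n ((x, y), \<one>\<^bsub>L\<^esub>) - \<eta> ((x, y), \<one>\<^bsub>L\<^esub>)))"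
              using c by (intro mult_left_mono norm_triangle_sub) auto
            ultimately have "1 / 2 \<le> sqrt c * cmod (diagonal_vector n ((x, y), \<one>\<^bsub>L\<^esub>) - \<eta> ((x, y), \<one>\<^bsub>L\<^esub>))"
              by (simp add: distrib_left)
            then show ?thesis by blast
          next
            case big1: True
            then obtain s where s: "s \<in> carrier L" "big (x, y) s" "s \<noteq> \<one>\<^bsub>L\<^esub>" using True by (auto simp: P_def)
            then have "1 / 2 \<le> sqrt c * cmod (diagonal_vector n ((x, y), s) - \<eta> ((x, y), s))"
              using x y by (simp add: diagonal_vector_eq big_def)
            then show ?thesis using s by blast
          qed
          then obtain t where t: "t \<in> carrier L"
            "1 / 2 \<le> sqrt c * cmod (diagonal_vector n ((x, y), t) - \<eta> ((x, y), t))" by blast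
          have "(1 / 2)\<^sup>2 \<le> (sqrt c * cmod (diagonal_vector n ((x, y), t) - \<eta> ((x, y), t)))\<^sup>2"
            using t(2) by (intro power_mono) auto
          then have "1 \<le> 4 * c * (cmod (diagonal_vector n ((x, y), t) - \<eta> ((x, y), t)))\<^sup>2"
            using c by (simp add: power_mult_distrib power2_eq_square[of "1/2"])
          then have "1 \<le> ?d ((x, y), t)" by simp
          also have "\<dots> \<le> (\<integral>\<^sup>+t. ?d ((x, y), t) \<partial>space_L)" using t(1) by (rule nn_integral_ge_point)
          finally show ?thesis by (auto simp: indicator_def)
        qed simp
      qed
      finally show "emeasure M {y \<in> space M. r n y = r n x \<and> \<not> P x y \<one>\<^bsub>L\<^esub>} \<le> \<dots>" .
    qed
    also have "\<dots> = (\<integral>\<^sup>+z. ?d z \<partial>triple)" by (rule nn_integral_triple[symmetric]) measurable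
    also have "\<dots> = (\<integral>\<^sup>+z. ennreal (4 * c) * ennreal ((cmod (diagonal_vector n z - \<eta> z))\<^sup>2) \<partial>triple)"
      using c by (intro nn_integral_cong ennreal_mult) auto
    also have "\<dots> = ennreal (4 * c) * (\<integral>\<^sup>+z. ennreal ((cmod (diagonal_vector n z - \<eta> z))\<^sup>2) \<partial>triple)"
      by (rule nn_integral_cmult) measurable
    also have "\<dots> = ennreal (4 * c) * ennreal (S.sq (diagonal_vector n - \<eta>))"
      unfolding sq[OF mem] ..
    also have "\<dots> \<le> ennreal (4 * c) * ennreal (1/400)" using near by (intro mult_left_mono ennreal_leI) auto
    also have "\<dots> = ennreal (4 * c * (1/400))" using c by (intro ennreal_mult[symmetric]) auto
    also have "4 * c * (1/400) = 1/100 * c" by simp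
    finally show ?thesis .
  qed
  have inv: "AE x in M. AE y in M. \<forall>t\<in>carrier L.
      P (act g x) (act g y) (v g x \<cdot> t \<cdot> inv\<^bsub>L\<^esub> (v g y)) \<longleftrightarrow> P x y t" if g: "g \<in> N0" for g
  proof -
    have gG: "g \<in> carrier G" using g by (rule N0_carrier)
    \<comment> \<open>\<open>koopman (inv g)\<close> is composition with \<open>move g\<close>, so
      the invariance of \<open>\<eta>\<close> is used at the inverse.\<close>
    have gi: "inv g \<in> N0" using g normal_N0 by (meson normal_imp_subgroup subgroup.m_inv_closed)
    have mem: "koopman (inv g) \<eta> - \<eta> \<in> square_integrable triple"
      using gG by (intro S.diff_mem S.U_mem \<eta>L) simp
    have [measurable]: "koopman (inv g) \<eta> \<in> borel_measurable triple"
      using gG by (intro L2_measurable S.U_mem \<eta>L) simp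
    have "S.sq (koopman (inv g) \<eta> - \<eta>) = 0" using \<eta> gi by (simp add: S.fixed_def)
    then have "(\<integral>\<^sup>+z. ennreal ((cmod (koopman (inv g) \<eta> z - \<eta> z))\<^sup>2) \<partial>triple) = 0"
      using sq[OF mem] by simp
    then have "AE z in triple. ennreal ((cmod (koopman (inv g) \<eta> z - \<eta> z))\<^sup>2) = 0"
      by (subst (asm) nn_integral_0_iff_AE) measurable
    then have ae: "AE z in (M \<Otimes>\<^sub>M M) \<Otimes>\<^sub>M space_L. \<eta> (move g z) = \<eta> z"
      unfolding triple_def by eventually_elim (use gG in \<open>simp add: koopman_def\<close>)
    interpret PP: pair_prob_space M M ..
    interpret C: pair_sigma_finite "M \<Otimes>\<^sub>M M" "space_L"
      by (intro pair_sigma_finite.intro sigma_finite_measure_count_space_countable countable_L PP.sigma_finite_measure_axioms)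
    \<comment> \<open>Fubini for null sets; on the counting space almost everywhere means
      everywhere.\<close>
    have "AE p in M \<Otimes>\<^sub>M M. AE t in space_L. \<eta> (move g (p, t)) = \<eta> (p, t)"
      by (rule C.AE_pair[OF ae])
    then have "AE x in M. AE y in M. AE t in space_L. \<eta> (move g ((x, y), t)) = \<eta> ((x, y), t)"
      by (rule PP.AE_pair)
    then have ae2: "AE x in M. AE y in M. \<forall>t\<in>carrier L. \<eta> (move g ((x, y), t)) = \<eta> ((x, y), t)"
      by (simp add: AE_count_space)
    show ?thesis using ae2 AE_space
    proof eventually_elim
      case (elim x)
      then have x: "x \<in> space M" and "AE y in M. \<forall>t\<in>carrier L. \<eta> (move g ((x, y), t)) = \<eta> ((x, y), t)" by auto
      from this(2) AE_space show ?case
      proof eventually_elim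
        case (elim y)
        then have y: "y \<in> space M" by simp
        have vv: "v g x \<in> carrier L" "v g y \<in> carrier L" using gG x y by (auto intro: v_carrier)
        let ?m = "\<lambda>t. v g x \<cdot> t \<cdot> inv\<^bsub>L\<^esub> (v g y)"
        have bg: "big (act g x, act g y) (?m t) \<longleftrightarrow> big (x, y) t" if t: "t \<in> carrier L" for t
          using bspec[OF elim(1) t] t vv unfolding move_eq[OF x y t] by (simp add: big_def)
        have surj: "\<exists>t\<in>carrier L. s = ?m t" if "s \<in> carrier L" for s
          using that vv by (intro bexI[of _ "inv\<^bsub>L\<^esub> (v g x) \<cdot> s \<cdot> v g y"]) (auto simp: L.m_assoc L.inv_mult_cancel)
        have inj: "?m s = ?m t \<longleftrightarrow> s = t" if "s \<in> carrier L" "t \<in> carrier L" for s t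
          using that vv by simp
        have mc: "?m t \<in> carrier L" if "t \<in> carrier L" for t using that vv by simp
        show ?case
        proof
          fix t assume t: "t \<in> carrier L"
          \<comment> \<open>The transformation of \<open>t\<close> is a bijection of the carrier, so
            the uniqueness clause can be reindexed.\<close>
          have "(\<forall>s\<in>carrier L. big (act g x, act g y) s \<longrightarrow> s = ?m t) \<longleftrightarrow>
              (\<forall>s\<in>carrier L. big (act g x, act g y) (?m s) \<longrightarrow> ?m s = ?m t)"
            using surj mc by metis
          also have "\<dots> \<longleftrightarrow> (\<forall>s\<in>carrier L. big (x, y) s \<longrightarrow> s = t)"
            using bg inj t by (intro ball_cong) auto
          finally show "P (act g x) (act g y) (?m t) \<longleftrightarrow> P x y t"
            unfolding P_def bg[OF t] by simp
        qed
      qed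
    qed
  qed
  have "invariant_kernel M G act r N0 L v n P"
  proof (intro invariant_kernel.intro invariant_kernel_axioms.intro strict_cocycle_axioms)
    show "P x y s \<Longrightarrow> P x y t \<Longrightarrow> s = t" for x y s t by (auto simp: P_def big_def)
    show "P x y t \<Longrightarrow> t \<in> carrier L" for x y t by (auto simp: P_def big_def)
  qed (use P_meas inv small in \<open>auto simp: c_def\<close>)
  then show ?thesis by blast
qed

end

section \<open>Untwisting the cocycle\<close>

context strict_cocycle
begin

lemma twist_strict_cocycle:
  assumes \<psi>: "\<psi> \<in> M \<rightarrow>\<^sub>M space_L"
  shows "strict_cocycle M G act r N0 L (\<lambda>g x. inv\<^bsub>L\<^esub> (\<psi> (act g x)) \<cdot> v g x \<cdot> \<psi> x)"
proof (intro strict_cocycle.intro strict_cocycle_axioms.intro profinite_action_axioms L.is_group countable_L)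
  have \<psi>L: "\<psi> x \<in> carrier L" if "x \<in> space M" for x using measurable_space[OF \<psi> that] by simp
  fix g assume g: "g \<in> carrier G"
  have m1: "(\<lambda>x. \<psi> (act g x)) \<in> M \<rightarrow>\<^sub>M space_L"
    by (rule measurable_compose[OF act_measurable[OF g] \<psi>])
  have "(\<lambda>x. inv\<^bsub>L\<^esub> (\<psi> (act g x)) \<cdot> v g x) \<in> M \<rightarrow>\<^sub>M space_L"
    by (rule measurable_count_space_app2[OF countable_L countable_L m1 v_measurable[OF g],
          where h = "\<lambda>a b. inv\<^bsub>L\<^esub> a \<cdot> b"]) simp
  then show "(\<lambda>x. inv\<^bsub>L\<^esub> (\<psi> (act g x)) \<cdot> v g x \<cdot> \<psi> x) \<in> M \<rightarrow>\<^sub>M space_L"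
    by (rule measurable_count_space_app2[OF countable_L countable_L _ \<psi>]) simp
  fix h x assume h: "h \<in> carrier G" and x: "x \<in> space M"
  then show "inv\<^bsub>L\<^esub> (\<psi> (act (g \<otimes> h) x)) \<cdot> v (g \<otimes> h) x \<cdot> \<psi> x =
      (inv\<^bsub>L\<^esub> (\<psi> (act g (act h x))) \<cdot> v g (act h x) \<cdot> \<psi> (act h x)) \<otimes>\<^bsub>L\<^esub>
      (inv\<^bsub>L\<^esub> (\<psi> (act h x)) \<cdot> v h x \<cdot> \<psi> x)"
    using g by (simp add: act_mult v_mult L.m_assoc L.inv_mult_cancel \<psi>L v_carrier act_space)
qed

text \<open>The gauge makes the cocycle factor on \<open>N0\<close>. The twisted cocycle is again
  strict, so \<open>factors_all\<close> applies to it and reaches all of \<open>G\<close>.\<close>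

lemma untwisting_exists:
  assumes T: "relative_property_T G N0" and fg: "finitely_generated_group (G Mod N0)"
  shows "\<exists>m. \<exists>\<psi>\<in>M \<rightarrow>\<^sub>M space_L. \<forall>g\<in>carrier G. \<exists>h. AE x in M.
    inv\<^bsub>L\<^esub> (\<psi> (act g x)) \<cdot> v g x \<cdot> \<psi> x = h (r m x)"
proof -
  obtain n P where "invariant_kernel M G act r N0 L v n P" using invariant_kernel_exists[OF T] by blast
  then interpret K: invariant_kernel M G act r N0 L v n P .
  interpret W: strict_cocycle M G act r N0 L
    "\<lambda>g x. inv\<^bsub>L\<^esub> (K.gauge (act g x)) \<cdot> v g x \<cdot> K.gauge x"
    by (rule twist_strict_cocycle[OF K.gauge_measurable])
  have "\<exists>m. \<forall>g\<in>carrier G. W.factors m g"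
    using K.twisted_factors by (intro W.factors_all[OF _ fg, of n]) (simp add: W.factors_def)
  then show ?thesis unfolding W.factors_def using K.gauge_measurable by blast
qed

end

section \<open>Replacing a cocycle by a strict one\<close>

context profinite_action
begin

text \<open>The cocycle is kept on the set \<open>X\<close> of points whose whole orbit satisfies
  the identity and made trivial elsewhere. \<open>X\<close> is conull because the group is
  countable, and its invariance keeps the two definitions from meeting on one orbit.\<close>

lemma strict_cocycle_of_cocycle:
  assumes L: "group L" "countable (carrier L)" and w: "cocycle G M act L w"
  shows "\<exists>v. strict_cocycle M G act r N0 L v \<and> (\<forall>g\<in>carrier G. AE x in M. v g x = w (g, x))"
proof -
  interpret L: group L by fact
  have wm: "(\<lambda>x. w (g, x)) \<in> M \<rightarrow>\<^sub>M count_space (carrier L)" if "g \<in> carrier G" for g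
    by (rule measurable_compose_Pair1[of g "count_space (carrier G)"]) (use w that in \<open>auto simp: cocycle_def\<close>)
  have wL: "w (g, x) \<in> carrier L" if "g \<in> carrier G" "x \<in> space M" for g x
    using measurable_space[OF wm[OF that(1)] that(2)] by simp
  define Q where "Q g h x \<longleftrightarrow> w (g \<otimes> h, x) = w (g, act h x) \<otimes>\<^bsub>L\<^esub> w (h, x)" for g h x
  define X where "X x \<longleftrightarrow> (\<forall>k\<in>carrier G. \<forall>g\<in>carrier G. \<forall>h\<in>carrier G. Q g h (act k x))" for x
  have Q: "AE x in M. Q g h x" if "g \<in> carrier G" "h \<in> carrier G" for g h
    using w that by (simp add: cocycle_def Q_def)
  have Qm: "Measurable.pred M (Q g h)" if gh: "g \<in> carrier G" "h \<in> carrier G" for g h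
  proof -
    have "(\<lambda>x. w (g, act h x) \<otimes>\<^bsub>L\<^esub> w (h, x)) \<in> M \<rightarrow>\<^sub>M count_space (carrier L)"
      by (rule measurable_count_space_app2[OF L(2) L(2) measurable_compose[OF act_measurable[OF gh(2)] wm[OF gh(1)]] wm[OF gh(2)]]) simp
    from measurable_count_space_app2[OF L(2) L(2) wm[OF m_closed[OF gh]] this, of "(=)" "count_space UNIV"]
    show ?thesis unfolding Q_def by simp
  qed
  have Xm [measurable]: "Measurable.pred M X" unfolding X_def
    by (intro pred_countable_bounded(1) countable_G) (rule measurable_compose[OF act_measurable Qm])
  have AX: "AE x in M. X x" unfolding X_def
    using Q AE_act by (intro AE_ball_countable[OF countable_G, THEN iffD2] ballI) blast
  have X_act: "X (act k x) \<longleftrightarrow> X x" if k: "k \<in> carrier G" and x: "x \<in> space M" for k x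
  proof
    assume "X x"
    then show "X (act k x)" unfolding X_def using k x by (metis act_mult m_closed)
  next
    assume X: "X (act k x)"
    have "Q g h (act j x)" if j: "j \<in> carrier G" and gh: "g \<in> carrier G" "h \<in> carrier G" for j g h
    proof -
      have "act (j \<otimes> inv k) (act k x) = act j x" using j k x by (simp add: act_mult act_space act_inv)
      moreover have "Q g h (act (j \<otimes> inv k) (act k x))" using X j k gh unfolding X_def by simp
      ultimately show ?thesis by simp
    qed
    then show "X x" by (simp add: X_def)
  qed
  define v where "v g x = (if X x then w (g, x) else \<one>\<^bsub>L\<^esub>)" for g x
  have "strict_cocycle M G act r N0 L v"
  proof (intro strict_cocycle.intro strict_cocycle_axioms.intro profinite_action_axioms L)
    fix g assume g: "g \<in> carrier G"
    show "v g \<in> M \<rightarrow>\<^sub>M count_space (carrier L)"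
      unfolding v_def by (intro measurable_If wm g) (use Xm in \<open>auto simp: pred_def\<close>)
    fix h x assume h: "h \<in> carrier G" and x: "x \<in> space M"
    have "Q g h x" if "X x" using that g h x act_one[OF x] unfolding X_def by (metis one_closed)
    then show "v (g \<otimes> h) x = v g (act h x) \<otimes>\<^bsub>L\<^esub> v h x"
      using X_act[OF h x] by (simp add: v_def Q_def)
  qed
  moreover have "AE x in M. v g x = w (g, x)" for g using AX by eventually_elim (simp add: v_def)
  ultimately show ?thesis by blast
qed

end

text \<open>The partitions are those into fibres of the coordinates: compatibility under
  \<open>q\<close> makes them refine each other, and the coordinatewise action makes them
  equivariant.\<close>

lemma profinite_action_of_inverse_limit:
  assumes G: "group G" "countable (carrier G)" and N: "normal N G"
    and mp: "mp_action G M act" and lim: "inverse_limit_action G MX \<alpha>X q M act"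
    and erg: "ergodic_action (G\<lparr>carrier := N\<rparr>) M act"
  shows "profinite_action M G act coord N"
proof -
  have fin: "finite_probability_space (MX n)" for n
    using lim by (simp add: inverse_limit_action_def inverse_system_def)
  have sM: "space M = inverse_limit_set MX q" using lim by (simp add: inverse_limit_action_def)
  have sets_M: "sets M = sets (restrict_space (Pi\<^sub>M UNIV MX) (inverse_limit_set MX q))"
    using lim by (simp add: inverse_limit_action_def)
  have coordM: "coord n \<in> M \<rightarrow>\<^sub>M MX n" for n
    using lim by (simp add: inverse_limit_action_def measure_preserving_def)
  have setsX: "sets (MX n) = Pow (space (MX n))" and finX: "finite (space (MX n))" for n
    using fin[of n] by (auto simp: finite_probability_space_def)
  have coord_space: "coord n x \<in> space (MX n)" if "x \<in> space M" for n x
    using that by (simp add: sM inverse_limit_set_def coord_def)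
  have act_eq: "act g x = (\<lambda>n. \<alpha>X n g (x n))" if "g \<in> carrier G" "x \<in> space M" for g x
    using lim that by (simp add: inverse_limit_action_def)
  interpret ga: group_action G "space M" act using mp by (simp add: mp_action_def)
  show ?thesis
  proof (intro profinite_action.intro profinite_action_axioms.intro G N)
    show "prob_space M" using mp by (simp add: mp_action_def)
    show "act g \<in> M \<rightarrow>\<^sub>M M" "distr M M (act g) = M" if "g \<in> carrier G" for g
      using mp that by (auto simp: mp_action_def measure_preserving_def)
    show "act (g \<otimes>\<^bsub>G\<^esub> h) x = act g (act h x)" if "g \<in> carrier G" "h \<in> carrier G" "x \<in> space M" for g h x
      using that by (intro ga.composition_rule)
    show "act \<one>\<^bsub>G\<^esub> x = x" if "x \<in> space M" for x
      using ga.id_eq_one that by (metis restrict_apply')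
    show r_meas: "coord n \<in> M \<rightarrow>\<^sub>M count_space UNIV" for n
    proof (rule measurableI)
      fix A
      have "coord n -` A \<inter> space M = coord n -` (A \<inter> space (MX n)) \<inter> space M" using coord_space by auto
      also have "\<dots> \<in> sets M" using setsX by (intro measurable_sets[OF coordM]) auto
      finally show "coord n -` A \<inter> space M \<in> sets M" .
    qed simp
    show "finite (coord n ` space M)" for n
      by (rule finite_subset[OF _ finX[of n]]) (use coord_space in auto)
    show "coord n (act g x) = coord n (act g y)"
      if "g \<in> carrier G" "x \<in> space M" "y \<in> space M" "coord n x = coord n y" for g x y n
      using that by (simp add: act_eq coord_def)
    show "coord m x = coord m y" if "m \<le> n" "x \<in> space M" "y \<in> space M" "coord n x = coord n y" for m n x y
      using that
    proof (induction rule: inc_induct)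
      case (step k)
      then have "x (Suc k) = y (Suc k)" by (simp add: coord_def)
      moreover have "q k (x (Suc k)) = x k" "q k (y (Suc k)) = y k"
        using step.prems by (auto simp: sM inverse_limit_set_def)
      ultimately show ?case by (metis coord_def)
    qed simp
    show "sets M = sigma_sets (space M) {coord n -` {a} \<inter> space M |n a. True}"
    proof
      let ?E = "{coord n -` {a} \<inter> space M |n a. True}"
      have E: "?E \<subseteq> Pow (space M)" by auto
      have "?E \<subseteq> sets M" using r_meas by (auto intro!: measurable_sets[OF r_meas])
      then show "sigma_sets (space M) ?E \<subseteq> sets M" by (rule sets.sigma_sets_subset)
      \<comment> \<open>Minimality of the product \<open>\<sigma>\<close>-algebra is phrased as
        measurability of the identity from the candidate \<open>S\<close>; the coordinates are
        measurable on \<open>S\<close> because every subset of a finite quotient is a finite union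
        of points.\<close>
      define S where "S = sigma (space M) ?E"
      have spS: "space S = space M" unfolding S_def by (rule space_measure_of[OF E])
      have setS: "sets S = sigma_sets (space M) ?E" unfolding S_def by (rule sets_measure_of[OF E])
      have coordS: "coord n \<in> S \<rightarrow>\<^sub>M MX n" for n
      proof (rule measurableI)
        show "coord n x \<in> space (MX n)" if "x \<in> space S" for x using that coord_space spS by simp
        fix A assume "A \<in> sets (MX n)"
        then have A: "finite A" using setsX finX by (auto intro: finite_subset)
        have "coord n -` A \<inter> space S = (\<Union>a\<in>A. coord n -` {a} \<inter> space M)" using spS by auto
        also have "\<dots> \<in> sets S" using A by (intro sets.finite_UN) (auto simp: setS)
        finally show "coord n -` A \<inter> space S \<in> sets S" .
      qed
      have "(\<lambda>x n. coord n x) \<in> S \<rightarrow>\<^sub>M Pi\<^sub>M UNIV MX"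
        by (rule measurable_PiM_single'[OF coordS]) (use coord_space spS in auto)
      then have "(\<lambda>x. x) \<in> S \<rightarrow>\<^sub>M restrict_space (Pi\<^sub>M UNIV MX) (inverse_limit_set MX q)"
        by (intro measurable_restrict_space2) (simp_all add: spS sM coord_def)
      then have idm: "(\<lambda>x. x) \<in> S \<rightarrow>\<^sub>M M" by (subst measurable_cong_sets[OF refl sets_M])
      show "sets M \<subseteq> sigma_sets (space M) ?E"
      proof
        fix A assume A: "A \<in> sets M"
        then have "(\<lambda>x. x) -` A \<inter> space S \<in> sets S" by (rule measurable_sets[OF idm])
        moreover have "(\<lambda>x. x) -` A \<inter> space S = A" using sets.sets_into_space[OF A] spS by auto
        ultimately show "A \<in> sigma_sets (space M) ?E" by (simp only: setS)
      qed
    qed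
    show "measure M A = 0 \<or> measure M A = 1"
      if "A \<in> sets M" "\<And>g. g \<in> N \<Longrightarrow> act g -` A \<inter> space M = A" for A
      using erg that by (simp add: ergodic_action_def)
  qed
qed

theorem theoremB:
  fixes \<Gamma> :: "('g, 'a) monoid_scheme" and \<Gamma>0 :: "'g set"
    and \<Lambda> :: "('l, 'b) monoid_scheme"
    and MX :: "nat \<Rightarrow> 'y measure" and \<alpha>X :: "nat \<Rightarrow> 'g \<Rightarrow> 'y \<Rightarrow> 'y" and q :: "nat \<Rightarrow> 'y \<Rightarrow> 'y"
    and M :: "(nat \<Rightarrow> 'y) measure" and \<alpha> :: "'g \<Rightarrow> (nat \<Rightarrow> 'y) \<Rightarrow> (nat \<Rightarrow> 'y)"
    and w :: "'g \<times> (nat \<Rightarrow> 'y) \<Rightarrow> 'l"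
  assumes "group \<Gamma>" and "countable (carrier \<Gamma>)"
    and "normal \<Gamma>0 \<Gamma>" and "infinite \<Gamma>0"
    and "relative_property_T \<Gamma> \<Gamma>0"
    and "finitely_generated_group (\<Gamma> Mod \<Gamma>0)"
    and "standard_probability_space M"
    and "mp_action \<Gamma> M \<alpha>"
    and "inverse_limit_action \<Gamma> MX \<alpha>X q M \<alpha>"
    and "free_action \<Gamma> M \<alpha>"
    and "ergodic_action \<Gamma> M \<alpha>"
    and "ergodic_action (\<Gamma>\<lparr>carrier := \<Gamma>0\<rparr>) M \<alpha>"
    and "group \<Lambda>" and "countable (carrier \<Lambda>)"
    and "cocycle \<Gamma> M \<alpha> \<Lambda> w"
  shows "\<exists>n w' w''.
    cocycle \<Gamma> M \<alpha> \<Lambda> w' \<and> cohomologous \<Gamma> M \<alpha> \<Lambda> w w' \<and>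
    cocycle \<Gamma> (MX n) (\<alpha>X n) \<Lambda> w'' \<and> w' = w'' \<circ> map_prod id (coord n)"
proof -
  interpret PA: profinite_action M \<Gamma> \<alpha> coord \<Gamma>0
    using assms by (intro profinite_action_of_inverse_limit)
  obtain v where v: "strict_cocycle M \<Gamma> \<alpha> coord \<Gamma>0 \<Lambda> v"
    and vw: "\<And>g. g \<in> carrier \<Gamma> \<Longrightarrow> AE x in M. v g x = w (g, x)"
    using PA.strict_cocycle_of_cocycle[OF assms(13-15)] by blast
  interpret V: strict_cocycle M \<Gamma> \<alpha> coord \<Gamma>0 \<Lambda> v by (rule v)
  obtain m \<psi> where \<psi>: "\<psi> \<in> M \<rightarrow>\<^sub>M count_space (carrier \<Lambda>)"
    and fac: "\<forall>g\<in>carrier \<Gamma>. \<exists>h. AE x in M. inv\<^bsub>\<Lambda>\<^esub> (\<psi> (\<alpha> g x)) \<otimes>\<^bsub>\<Lambda>\<^esub> v g x \<otimes>\<^bsub>\<Lambda>\<^esub> \<psi> x = h (coord m x)"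
    using V.untwisting_exists[OF assms(5,6)] by blast
  define v' where "v' g x = inv\<^bsub>\<Lambda>\<^esub> (\<psi> (\<alpha> g x)) \<otimes>\<^bsub>\<Lambda>\<^esub> v g x \<otimes>\<^bsub>\<Lambda>\<^esub> \<psi> x" for g x
  interpret W: strict_cocycle M \<Gamma> \<alpha> coord \<Gamma>0 \<Lambda> v'
    unfolding v'_def by (rule V.twist_strict_cocycle[OF \<psi>])
  have \<psi>L: "\<psi> x \<in> carrier \<Lambda>" if "x \<in> space M" for x using measurable_space[OF \<psi> that] by simp
  obtain h where h: "\<And>g. g \<in> carrier \<Gamma> \<Longrightarrow> AE x in M. v' g x = h g (coord m x)"
    using bchoice[OF fac] unfolding v'_def by blast
  \<comment> \<open>\<open>h g\<close> is uncontrolled on labels of measure zero; the default one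
    puts all values into the carrier, which makes \<open>w''\<close> measurable.\<close>
  define w'' where "w'' = (\<lambda>(g, a). if h g a \<in> carrier \<Lambda> then h g a else \<one>\<^bsub>\<Lambda>\<^esub>)"
  define w' where "w' = w'' \<circ> map_prod id (coord m)"
  have w''L: "w'' z \<in> carrier \<Lambda>" for z by (auto simp: w''_def split: prod.split)
  have v'w: "AE x in M. v' g x = w'' (g, coord m x)" if g: "g \<in> carrier \<Gamma>" for g
    using h[OF g] AE_space
  proof eventually_elim
    case (elim x)
    then show ?case using W.v_carrier[OF g, of x] by (simp add: w''_def)
  qed
  have fin: "finite_probability_space (MX m)" and coordM: "coord m \<in> M \<rightarrow>\<^sub>M MX m"
    and distr: "distr M (MX m) (coord m) = MX m"
    using assms(9) by (auto simp: inverse_limit_action_def inverse_system_def measure_preserving_def)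
  have setsX: "sets (MX m) = sets (count_space (space (MX m)))"
    using fin by (simp add: finite_probability_space_def)
  have w''m: "w'' \<in> count_space (carrier \<Gamma>) \<Otimes>\<^sub>M MX m \<rightarrow>\<^sub>M count_space (carrier \<Lambda>)"
  proof -
    have "sets (count_space (carrier \<Gamma>) \<Otimes>\<^sub>M MX m) = sets (count_space (carrier \<Gamma>) \<Otimes>\<^sub>M count_space (space (MX m)))"
      by (rule sets_pair_measure_cong[OF refl setsX])
    also have "count_space (carrier \<Gamma>) \<Otimes>\<^sub>M count_space (space (MX m)) = count_space (carrier \<Gamma> \<times> space (MX m))"
      using fin assms(2) by (intro pair_measure_countable) (auto simp: finite_probability_space_def countable_finite)
    finally have "sets (count_space (carrier \<Gamma>) \<Otimes>\<^sub>M MX m) = sets (count_space (carrier \<Gamma> \<times> space (MX m)))" .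
    from measurable_cong_sets[OF this refl, of "count_space (carrier \<Lambda>)"] show ?thesis
      by (simp add: w''L)
  qed
  \<comment> \<open>The identity passes from \<open>v'\<close> to \<open>w''\<close> almost
    everywhere on \<open>M\<close>, and from there to the finite quotient because
    \<open>coord m\<close> carries the one measure to the other.\<close>
  have coc: "AE x in M. w'' (g \<otimes>\<^bsub>\<Gamma>\<^esub> k, coord m x) = w'' (g, coord m (\<alpha> k x)) \<otimes>\<^bsub>\<Lambda>\<^esub> w'' (k, coord m x)"
    if g: "g \<in> carrier \<Gamma>" and k: "k \<in> carrier \<Gamma>" for g k
    using v'w[OF PA.m_closed[OF g k]] PA.AE_act[OF k v'w[OF g]] v'w[OF k] AE_space
    by eventually_elim (use W.v_mult[OF g k] in simp)
  have act_coord: "coord m (\<alpha> k x) = \<alpha>X m k (coord m x)" if "k \<in> carrier \<Gamma>" "x \<in> space M" for k x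
    using assms(9) that by (simp add: inverse_limit_action_def coord_def)
  have "cocycle \<Gamma> (MX m) (\<alpha>X m) \<Lambda> w''"
    unfolding cocycle_def
  proof (intro conjI ballI w''m)
    fix g k assume g: "g \<in> carrier \<Gamma>" and k: "k \<in> carrier \<Gamma>"
    have "AE x in M. w'' (g \<otimes>\<^bsub>\<Gamma>\<^esub> k, coord m x) = w'' (g, \<alpha>X m k (coord m x)) \<otimes>\<^bsub>\<Lambda>\<^esub> w'' (k, coord m x)"
      using coc[OF g k] AE_space by eventually_elim (simp add: act_coord k)
    then have "AE a in distr M (MX m) (coord m). w'' (g \<otimes>\<^bsub>\<Gamma>\<^esub> k, a) = w'' (g, \<alpha>X m k a) \<otimes>\<^bsub>\<Lambda>\<^esub> w'' (k, a)"
      by (subst AE_distr_iff[OF coordM]) (auto simp: setsX)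
    then show "AE a in MX m. w'' (g \<otimes>\<^bsub>\<Gamma>\<^esub> k, a) = w'' (g, \<alpha>X m k a) \<otimes>\<^bsub>\<Lambda>\<^esub> w'' (k, a)"
      by (simp only: distr)
  qed
  moreover have "cocycle \<Gamma> M \<alpha> \<Lambda> w'"
    unfolding cocycle_def
  proof (intro conjI ballI)
    have "map_prod id (coord m) \<in> count_space (carrier \<Gamma>) \<Otimes>\<^sub>M M \<rightarrow>\<^sub>M count_space (carrier \<Gamma>) \<Otimes>\<^sub>M MX m"
      unfolding map_prod_def case_prod_beta' id_def
      by (intro measurable_Pair measurable_fst measurable_compose[OF measurable_snd coordM])
    then show "w' \<in> count_space (carrier \<Gamma>) \<Otimes>\<^sub>M M \<rightarrow>\<^sub>M count_space (carrier \<Lambda>)"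
      unfolding w'_def by (rule measurable_comp[OF _ w''m])
    show "AE x in M. w' (g \<otimes>\<^bsub>\<Gamma>\<^esub> k, x) = w' (g, \<alpha> k x) \<otimes>\<^bsub>\<Lambda>\<^esub> w' (k, x)"
      if "g \<in> carrier \<Gamma>" "k \<in> carrier \<Gamma>" for g k
      using coc[OF that] by (simp add: w'_def)
  qed
  \<comment> \<open>The conjugating map is the inverse of \<open>\<psi>\<close>, since the twist has
    the inverse of \<open>\<psi> (\<alpha> g x)\<close> on the left.\<close>
  moreover have "cohomologous \<Gamma> M \<alpha> \<Lambda> w w'"
    unfolding cohomologous_def
  proof (intro bexI[of _ "\<lambda>x. inv\<^bsub>\<Lambda>\<^esub> (\<psi> x)"] ballI)
    show "(\<lambda>x. inv\<^bsub>\<Lambda>\<^esub> (\<psi> x)) \<in> M \<rightarrow>\<^sub>M count_space (carrier \<Lambda>)"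
      by (rule measurable_compose[OF \<psi>]) auto
    fix g assume g: "g \<in> carrier \<Gamma>"
    show "AE x in M. w' (g, x) = inv\<^bsub>\<Lambda>\<^esub> (\<psi> (\<alpha> g x)) \<otimes>\<^bsub>\<Lambda>\<^esub> w (g, x) \<otimes>\<^bsub>\<Lambda>\<^esub> inv\<^bsub>\<Lambda>\<^esub> (inv\<^bsub>\<Lambda>\<^esub> (\<psi> x))"
      using v'w[OF g] vw[OF g] AE_space
      by eventually_elim (simp add: w'_def v'_def \<psi>L)
  qed
  ultimately show ?thesis unfolding w'_def by blast
qed

end
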